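(* $c_0(\mathbf R\oplus\mathbf C)$ has the $(2+\varepsilon)$-CSEP for all $\varepsilon>0$.
   Context: $\mathbf K$ denotes the compact operators on $\ell^2$, viewed as infinite matrices. $\mathbf R$ (row space) is the operator space of all matrices in $\mathbf K$ with non-zero entries only in the first row, and $\mathbf C$ (column space) is the operator space of all matrices in $\mathbf K$ with non-zero entries only in the first column. Direct sums of operator spaces are in the $\ell^\infty$-sense. For an operator space $Z$, $c_0(Z)$ is the space of sequences in $Z$ tending to $0$ in norm, with sup norm and matrix norms given by suprema over coordinates. An operator space $Z$ has the $\lambda$-CSEP ($\lambda$-Complete Separable Extension Property) if for all separable operator spaces $Y$, all closed linear subspaces $X\subset Y$, and all completely bounded operators $T:X\to Z$, there exists a completely bounded $\tilde T:Y\to Z$ extending $T$ with $\|\tilde T\|_{cb}\le\lambda\|T\|_{cb}$. *)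

theory Defs
  imports
    Complex_Main
    "HOL-Library.Countable_Set"
    "HOL-Library.Function_Algebras"
    "HOL-Library.Product_Plus"
    "Jordan_Normal_Form.Matrix"
begin

section \<open>Operator spaces\<close>

text \<open>
  A complex vector space with a norm on each matrix space. The carrier is a subset of a type
  with addition; \<open>os_norm V x\<close> is the norm of a square matrix \<open>x\<close> over the carrier,
  the size of \<open>x\<close> being recorded in \<open>x\<close> itself.
\<close>

record 'a op_space =
  os_carrier :: "'a set"
  os_scale :: "complex \<Rightarrow> 'a \<Rightarrow> 'a"
  os_norm :: "'a mat \<Rightarrow> real"

definition os_mats :: "'a op_space \<Rightarrow> nat \<Rightarrow> 'a mat set" where
  "os_mats V n = {x \<in> carrier_mat n n. \<forall>i<n. \<forall>j<n. x $$ (i, j) \<in> os_carrier V}"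

definition os_vnorm :: "'a op_space \<Rightarrow> 'a \<Rightarrow> real" where
  "os_vnorm V v = os_norm V (mat 1 1 (\<lambda>_. v))"

definition l2_norm_vec :: "complex vec \<Rightarrow> real" where
  "l2_norm_vec v = sqrt (\<Sum>i<dim_vec v. (cmod (v $ i))\<^sup>2)"

definition scalar_mat_norm :: "complex mat \<Rightarrow> real" where
  "scalar_mat_norm a =
     Sup {l2_norm_vec (a *\<^sub>v v) | v. v \<in> carrier_vec (dim_col a) \<and> l2_norm_vec v \<le> 1}"

text \<open>The product \<open>a x b\<close> of a matrix \<open>x\<close> over \<open>V\<close> with scalar matrices \<open>a\<close> and \<open>b\<close>.\<close>

definition os_sandwich ::
    "('a::ab_group_add) op_space \<Rightarrow> complex mat \<Rightarrow> 'a mat \<Rightarrow> complex mat \<Rightarrow> 'a mat" where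
  "os_sandwich V a x b = mat (dim_row a) (dim_col b)
     (\<lambda>(i, j). \<Sum>p<dim_row x. \<Sum>q<dim_col x. os_scale V (a $$ (i, p) * b $$ (q, j)) (x $$ (p, q)))"

definition os_diag_sum :: "('a::zero) mat \<Rightarrow> 'a mat \<Rightarrow> 'a mat" where
  "os_diag_sum x y =
     four_block_mat x (0\<^sub>m (dim_row x) (dim_col y)) (0\<^sub>m (dim_row y) (dim_col x)) y"

definition os_subspace :: "('a::ab_group_add) op_space \<Rightarrow> 'a set \<Rightarrow> bool" where
  "os_subspace V X \<longleftrightarrow> X \<subseteq> os_carrier V \<and> 0 \<in> X \<and>
     (\<forall>x\<in>X. \<forall>y\<in>X. x + y \<in> X) \<and> (\<forall>c. \<forall>x\<in>X. os_scale V c x \<in> X)"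

definition os_complete :: "('a::ab_group_add) op_space \<Rightarrow> bool" where
  "os_complete V \<longleftrightarrow> (\<forall>f::nat \<Rightarrow> 'a.
     (\<forall>k. f k \<in> os_carrier V) \<and>
     (\<forall>e>0. \<exists>N. \<forall>k\<ge>N. \<forall>l\<ge>N. os_vnorm V (f k - f l) < e) \<longrightarrow>
     (\<exists>v\<in>os_carrier V. (\<lambda>k. os_vnorm V (f k - v)) \<longlonglongrightarrow> 0))"

text \<open>
  Ruan's axioms, together with completeness. By Ruan's theorem these are, up to complete
  isometry, the closed linear subspaces of \<open>B(H)\<close>, \<open>H\<close> a complex Hilbert space. Matrices of
  size 0 are not excluded; the axioms force their norm to be 0.
\<close>

definition operator_space :: "('a::ab_group_add) op_space \<Rightarrow> bool" where
  "operator_space V \<longleftrightarrow>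
     vector_space (os_scale V) \<and>
     os_subspace V (os_carrier V) \<and>
     (\<forall>n. \<forall>x\<in>os_mats V n. os_norm V x \<ge> 0 \<and> (os_norm V x = 0 \<longleftrightarrow> x = 0\<^sub>m n n)) \<and>
     (\<forall>n. \<forall>x\<in>os_mats V n. \<forall>c. os_norm V (map_mat (os_scale V c) x) = cmod c * os_norm V x) \<and>
     (\<forall>n. \<forall>x\<in>os_mats V n. \<forall>y\<in>os_mats V n. os_norm V (x + y) \<le> os_norm V x + os_norm V y) \<and>
     (\<forall>m n. \<forall>x\<in>os_mats V m. \<forall>y\<in>os_mats V n.
        os_norm V (os_diag_sum x y) = max (os_norm V x) (os_norm V y)) \<and>
     (\<forall>m n. \<forall>x\<in>os_mats V m. \<forall>a\<in>carrier_mat n m. \<forall>b\<in>carrier_mat m n.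
        os_norm V (os_sandwich V a x b) \<le> scalar_mat_norm a * os_norm V x * scalar_mat_norm b) \<and>
     os_complete V"

definition os_separable :: "('a::ab_group_add) op_space \<Rightarrow> bool" where
  "os_separable V \<longleftrightarrow> (\<exists>D. countable D \<and> D \<subseteq> os_carrier V \<and>
     (\<forall>v\<in>os_carrier V. \<forall>e>0. \<exists>d\<in>D. os_vnorm V (v - d) < e))"

definition os_closed_subspace :: "('a::ab_group_add) op_space \<Rightarrow> 'a set \<Rightarrow> bool" where
  "os_closed_subspace V X \<longleftrightarrow> os_subspace V X \<and>
     (\<forall>f v. (\<forall>k::nat. f k \<in> X) \<and> v \<in> os_carrier V \<and>
        (\<lambda>k. os_vnorm V (f k - v)) \<longlonglongrightarrow> 0 \<longrightarrow> v \<in> X)"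

definition os_restrict :: "'a op_space \<Rightarrow> 'a set \<Rightarrow> 'a op_space" where
  "os_restrict V X = V\<lparr>os_carrier := X\<rparr>"


section \<open>Completely bounded maps and the extension property\<close>

definition os_linear ::
    "('a::ab_group_add) op_space \<Rightarrow> ('b::ab_group_add) op_space \<Rightarrow> ('a \<Rightarrow> 'b) \<Rightarrow> bool" where
  "os_linear V W T \<longleftrightarrow>
     (\<forall>x\<in>os_carrier V. T x \<in> os_carrier W) \<and>
     (\<forall>x\<in>os_carrier V. \<forall>y\<in>os_carrier V. T (x + y) = T x + T y) \<and>
     (\<forall>c. \<forall>x\<in>os_carrier V. T (os_scale V c x) = os_scale W c (T x))"

definition completely_bounded ::
    "('a::ab_group_add) op_space \<Rightarrow> ('b::ab_group_add) op_space \<Rightarrow> ('a \<Rightarrow> 'b) \<Rightarrow> bool" where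
  "completely_bounded V W T \<longleftrightarrow> os_linear V W T \<and>
     (\<exists>K. \<forall>n. \<forall>x\<in>os_mats V n. os_norm W (map_mat T x) \<le> K * os_norm V x)"

definition cb_norm :: "'a op_space \<Rightarrow> 'b op_space \<Rightarrow> ('a \<Rightarrow> 'b) \<Rightarrow> real" where
  "cb_norm V W T = Sup {os_norm W (map_mat T x) | n x. x \<in> os_mats V n \<and> os_norm V x \<le> 1}"

text \<open>
  A definition cannot quantify over types, so the type in which the spaces \<open>Y\<close> live is a
  parameter, to be left as a type variable in statements.
\<close>

definition has_CSEP ::
    "('y::ab_group_add) itself \<Rightarrow> real \<Rightarrow> ('z::ab_group_add) op_space \<Rightarrow> bool" where
  "has_CSEP _ lam Z \<longleftrightarrow>
     (\<forall>(Y::'y op_space) X T.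
        operator_space Y \<and> os_separable Y \<and> os_closed_subspace Y X \<and>
        completely_bounded (os_restrict Y X) Z T \<longrightarrow>
        (\<exists>T'. completely_bounded Y Z T' \<and> (\<forall>x\<in>X. T' x = T x) \<and>
           cb_norm Y Z T' \<le> lam * cb_norm (os_restrict Y X) Z T))"


section \<open>Direct sums\<close>

definition os_sum :: "'a op_space \<Rightarrow> 'b op_space \<Rightarrow> ('a \<times> 'b) op_space" where
  "os_sum V W =
     \<lparr>os_carrier = os_carrier V \<times> os_carrier W,
      os_scale = (\<lambda>c (v, w). (os_scale V c v, os_scale W c w)),
      os_norm = (\<lambda>x. max (os_norm V (map_mat fst x)) (os_norm W (map_mat snd x)))\<rparr>"

definition os_c0 :: "'a op_space \<Rightarrow> (nat \<Rightarrow> 'a) op_space" where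
  "os_c0 V =
     \<lparr>os_carrier = {f. (\<forall>k. f k \<in> os_carrier V) \<and> (\<lambda>k. os_vnorm V (f k)) \<longlonglongrightarrow> 0},
      os_scale = (\<lambda>c f k. os_scale V c (f k)),
      os_norm = (\<lambda>x. SUP k. os_norm V (map_mat (\<lambda>f. f k) x))\<rparr>"


section \<open>Compact operators on \<open>\<ell>\<^sup>2\<close>, row space and column space\<close>

definition ell2 :: "(nat \<Rightarrow> complex) set" where
  "ell2 = {f. summable (\<lambda>i. (cmod (f i))\<^sup>2)}"

definition ell2_norm :: "(nat \<Rightarrow> complex) \<Rightarrow> real" where
  "ell2_norm f = sqrt (\<Sum>i. (cmod (f i))\<^sup>2)"

definition inf_mat_apply :: "(nat \<Rightarrow> nat \<Rightarrow> complex) \<Rightarrow> (nat \<Rightarrow> complex) \<Rightarrow> nat \<Rightarrow> complex" where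
  "inf_mat_apply a f = (\<lambda>i. \<Sum>j. a i j * f j)"

text \<open>
  Infinite matrices acting on \<open>\<ell>\<^sup>2\<close> such that the image of the unit ball is relatively
  (sequentially) compact; boundedness follows.
\<close>

definition compact_inf_mats :: "(nat \<Rightarrow> nat \<Rightarrow> complex) set" where
  "compact_inf_mats = {a.
     (\<forall>f\<in>ell2. (\<forall>i. summable (\<lambda>j. a i j * f j)) \<and> inf_mat_apply a f \<in> ell2) \<and>
     (\<forall>F. (\<forall>k::nat. F k \<in> ell2 \<and> ell2_norm (F k) \<le> 1) \<longrightarrow>
        (\<exists>r g. strict_mono (r::nat \<Rightarrow> nat) \<and> g \<in> ell2 \<and>
           (\<lambda>k. ell2_norm (inf_mat_apply a (F (r k)) - g)) \<longlonglongrightarrow> 0))}"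

text \<open>
  An \<open>n \<times> n\<close> matrix of operators acts on the Hilbert space sum of \<open>n\<close> copies of \<open>\<ell>\<^sup>2\<close>,
  whose elements are given as families indexed by \<open>j < n\<close>.
\<close>

definition ell2_sum_norm :: "nat \<Rightarrow> (nat \<Rightarrow> nat \<Rightarrow> complex) \<Rightarrow> real" where
  "ell2_sum_norm n F = sqrt (\<Sum>j<n. (ell2_norm (F j))\<^sup>2)"

definition block_apply ::
    "(nat \<Rightarrow> nat \<Rightarrow> complex) mat \<Rightarrow> (nat \<Rightarrow> nat \<Rightarrow> complex) \<Rightarrow> nat \<Rightarrow> nat \<Rightarrow> complex" where
  "block_apply A F = (\<lambda>i. \<Sum>j<dim_col A. inf_mat_apply (A $$ (i, j)) (F j))"

definition block_norm :: "(nat \<Rightarrow> nat \<Rightarrow> complex) mat \<Rightarrow> real" where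
  "block_norm A = Sup {ell2_sum_norm (dim_row A) (block_apply A F) | F.
     (\<forall>j<dim_col A. F j \<in> ell2) \<and> ell2_sum_norm (dim_col A) F \<le> 1}"

definition compact_space :: "(nat \<Rightarrow> nat \<Rightarrow> complex) op_space" where
  "compact_space =
     \<lparr>os_carrier = compact_inf_mats, os_scale = (\<lambda>c a i j. c * a i j), os_norm = block_norm\<rparr>"

definition row_space :: "(nat \<Rightarrow> nat \<Rightarrow> complex) op_space" where
  "row_space = os_restrict compact_space {a \<in> compact_inf_mats. \<forall>i j. i \<noteq> 0 \<longrightarrow> a i j = 0}"

definition column_space :: "(nat \<Rightarrow> nat \<Rightarrow> complex) op_space" where
  "column_space = os_restrict compact_space {a \<in> compact_inf_mats. \<forall>i j. j \<noteq> 0 \<longrightarrow> a i j = 0}"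

end

theory Submission
  imports Defs "HOL-Analysis.L2_Norm" "HOL-Analysis.Inner_Product"
begin

text \<open>
  As Banach spaces, \<open>R\<close> and \<open>C\<close> are Hilbert spaces. The completely bounded norm of a map \<open>T\<close> into \<open>C\<close> is the
  least \<open>\<kappa>\<close> such that \<open>\<Sum> \<parallel>T (x i)\<parallel>\<^sup>2 \<le> \<kappa>\<^sup>2 \<parallel>x\<parallel>\<^sup>2\<close> for all finite columns \<open>x\<close>, and
  for maps into \<open>R\<close> columns are replaced by rows. Transposing all matrices exchanges the two
  cases. A map into the space of null sequences in \<open>R \<oplus> C\<close> consists of two sequences of maps
  \<open>T k\<close> into a Hilbert space that tend to zero at each point of \<open>X\<close>, and the theorem reduces to
  the extension of such sequences with control of column norms.

  There are two ingredients. The first is the injectivity of column space, in a form that allows more general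
  bounds than multiples of the column norm (\<open>column_extension\<close>). By Zorn's lemma it suffices to
  extend a map to one more vector. Its value there has to lie in a family of balls of the Hilbert space; as
  columns can be stacked and multiplied by scalar matrices, the parameters of these balls form
  a convex set, and minimizing a uniformly convex functional on this set gives a
  common point of the balls (\<open>convex_ball_intersection\<close>, \<open>one_step_extension\<close>). Everything
  is thus derived from Ruan's axioms, by way of what they say about columns.

  The second ingredient makes the extensions tend to zero, in the spirit of Sobczyk's theorem. Given
  \<open>y 0, \<dots>, y (m - 1)\<close>, extend \<open>T k\<close> with respect to the mixed bound that charges \<open>2 + \<epsilon>\<close> times the norm for
  general columns and only \<open>\<delta>\<close> for scalar columns times \<open>y j\<close>. The map \<open>T k\<close> respects
  this bound on \<open>X\<close> provided that it is small on a certain finite subset of \<open>X\<close>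
  (\<open>split_bound_dominates\<close>): replacing \<open>a y\<close> by a nearly closest column over \<open>X\<close> at most doubles
  the norm, and finitely many such columns suffice, because scalar
  \<open>n \<times> m\<close> matrices reduce to \<open>m \<times> m\<close> matrices by a partial isometry. Letting \<open>m\<close>
  grow slowly with \<open>k\<close> along a dense sequence gives \<open>null_sequence_extension\<close>.
\<close>

section \<open>The Hilbert space of square summable sequences\<close>

lemma cmod_add_power2_le: "(cmod (a + b))\<^sup>2 \<le> 2 * (cmod a)\<^sup>2 + 2 * (cmod b)\<^sup>2"
proof -
  have "(cmod (a + b))\<^sup>2 \<le> (cmod a + cmod b)\<^sup>2"
    by (intro power_mono norm_triangle_ineq) auto
  also have "\<dots> \<le> 2 * (cmod a)\<^sup>2 + 2 * (cmod b)\<^sup>2"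
    using sum_squares_bound[of "cmod a" "cmod b"] by (simp add: power2_sum)
  finally show ?thesis .
qed

lemma ell2_zero: "(\<lambda>_. 0) \<in> ell2"
  by (simp add: ell2_def)

lemma ell2_add:
  assumes "f \<in> ell2" "g \<in> ell2"
  shows "(\<lambda>i. f i + g i) \<in> ell2"
proof -
  have "summable (\<lambda>i. 2 * (cmod (f i))\<^sup>2 + 2 * (cmod (g i))\<^sup>2)"
    using assms by (auto simp: ell2_def intro!: summable_add summable_mult)
  then have "summable (\<lambda>i. (cmod (f i + g i))\<^sup>2)"
    by (rule summable_comparison_test'[of _ 0]) (simp add: cmod_add_power2_le)
  then show ?thesis by (simp add: ell2_def)
qed

lemma ell2_scale:
  assumes "f \<in> ell2"
  shows "(\<lambda>i. c * f i) \<in> ell2"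
  using assms by (auto simp: ell2_def norm_mult power_mult_distrib intro!: summable_mult)

lemma ell2_product_summable:
  assumes "f \<in> ell2" "g \<in> ell2"
  shows "summable (\<lambda>i. f i * g i)"
proof -
  have "summable (\<lambda>i. (cmod (f i))\<^sup>2 + (cmod (g i))\<^sup>2)"
    using assms by (auto simp: ell2_def intro!: summable_add)
  then show ?thesis
  proof (rule summable_comparison_test'[of _ 0])
    fix i
    have "2 * cmod (f i) * cmod (g i) \<le> (cmod (f i))\<^sup>2 + (cmod (g i))\<^sup>2"
      by (rule sum_squares_bound)
    moreover have "0 \<le> cmod (f i) * cmod (g i)" by simp
    ultimately show "norm (f i * g i) \<le> (cmod (f i))\<^sup>2 + (cmod (g i))\<^sup>2"
      unfolding norm_mult by linarith
  qed
qed

lemma ell2_cnj: "f \<in> ell2 \<Longrightarrow> (\<lambda>i. cnj (f i)) \<in> ell2"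
  by (simp add: ell2_def)

text \<open>
  Making the sequence space a type gives access to the class of real inner product spaces, in
  which the geometric arguments take place; complex scalars act by a separate operation.
\<close>

typedef hilb = ell2 morphisms coord Abs_hilb
  using ell2_zero by blast

lemma hilb_eqI: "(\<And>i. coord x i = coord y i) \<Longrightarrow> x = y"
  by (metis coord_inject ext)

lemma coord_Abs: "f \<in> ell2 \<Longrightarrow> coord (Abs_hilb f) i = f i"
  by (simp add: Abs_hilb_inverse)

lemma coord_summable: "summable (\<lambda>i. (cmod (coord x i))\<^sup>2)"
  using coord[of x] by (simp add: ell2_def)

lemma coord_product_summable: "summable (\<lambda>i. Re (coord x i * cnj (coord y i)))"
  by (intro summable_Re ell2_product_summable coord ell2_cnj)

definition cscale :: "complex \<Rightarrow> hilb \<Rightarrow> hilb" (infixr \<open>*\<^sub>C\<close> 75) where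
  "c *\<^sub>C x = Abs_hilb (\<lambda>i. c * coord x i)"

lemma coord_cscale [simp]: "coord (c *\<^sub>C x) i = c * coord x i"
  unfolding cscale_def by (rule coord_Abs) (intro ell2_scale coord)

instantiation hilb :: real_inner
begin

definition zero_hilb :: hilb where "0 = Abs_hilb (\<lambda>_. 0)"
definition plus_hilb :: "hilb \<Rightarrow> hilb \<Rightarrow> hilb" where
  "x + y = Abs_hilb (\<lambda>i. coord x i + coord y i)"
definition uminus_hilb :: "hilb \<Rightarrow> hilb" where "- x = (-1) *\<^sub>C x"
definition minus_hilb :: "hilb \<Rightarrow> hilb \<Rightarrow> hilb" where "x - y = x + - (y::hilb)"
definition scaleR_hilb :: "real \<Rightarrow> hilb \<Rightarrow> hilb" where "r *\<^sub>R x = complex_of_real r *\<^sub>C x"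
definition inner_hilb :: "hilb \<Rightarrow> hilb \<Rightarrow> real" where
  "inner x y = (\<Sum>i. Re (coord x i * cnj (coord y i)))"
definition norm_hilb :: "hilb \<Rightarrow> real" where "norm x = sqrt (inner x (x::hilb))"
definition sgn_hilb :: "hilb \<Rightarrow> hilb" where "sgn x = inverse (norm x) *\<^sub>R (x::hilb)"
definition dist_hilb :: "hilb \<Rightarrow> hilb \<Rightarrow> real" where "dist x y = norm (x - (y::hilb))"
definition uniformity_hilb :: "(hilb \<times> hilb) filter" where
  "uniformity_hilb = (INF e\<in>{0<..}. principal {(x, y). dist x (y::hilb) < e})"
definition open_hilb :: "hilb set \<Rightarrow> bool" where
  "open_hilb U \<longleftrightarrow> (\<forall>x\<in>U. eventually (\<lambda>(x', y). x' = x \<longrightarrow> y \<in> U) uniformity)"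

lemma coord_zero [simp]: "coord 0 i = 0"
  unfolding zero_hilb_def by (rule coord_Abs) (rule ell2_zero)

lemma coord_add [simp]: "coord (x + y) i = coord x i + coord y i"
  unfolding plus_hilb_def by (rule coord_Abs) (intro ell2_add coord)

lemma coord_uminus [simp]: "coord (- x) i = - coord x i"
  by (simp add: uminus_hilb_def)

lemma coord_minus [simp]: "coord (x - y) i = coord x i - coord y i"
  by (simp add: minus_hilb_def)

lemma coord_scaleR [simp]: "coord (r *\<^sub>R x) i = complex_of_real r * coord x i"
  by (simp add: scaleR_hilb_def)

instance
proof
  fix x y z :: hilb and a b r :: real
  show "(x + y) + z = x + (y + z)" "x + y = y + x" "0 + x = x" "- x + x = 0" "x - y = x + - y"
    "a *\<^sub>R (x + y) = a *\<^sub>R x + a *\<^sub>R y" "(a + b) *\<^sub>R x = a *\<^sub>R x + b *\<^sub>R x"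
    "a *\<^sub>R b *\<^sub>R x = (a * b) *\<^sub>R x" "1 *\<^sub>R x = x"
    by (auto intro!: hilb_eqI simp: algebra_simps)
  show "dist x y = norm (x - y)" by (rule dist_hilb_def)
  show "sgn x = inverse (norm x) *\<^sub>R x" by (rule sgn_hilb_def)
  show "uniformity = (INF e\<in>{0<..}. principal {(x, y). dist x (y::hilb) < e})"
    by (rule uniformity_hilb_def)
  show "open U \<longleftrightarrow> (\<forall>x\<in>U. eventually (\<lambda>(x', y). x' = x \<longrightarrow> y \<in> U) uniformity)" for U :: "hilb set"
    by (rule open_hilb_def)
  show "norm x = sqrt (inner x x)" by (rule norm_hilb_def)
  show "inner x y = inner y x"
    unfolding inner_hilb_def by (rule suminf_cong) (simp add: algebra_simps)
  show "inner (x + y) z = inner x z + inner y z"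
    unfolding inner_hilb_def
    by (subst suminf_add[OF coord_product_summable coord_product_summable])
      (simp add: algebra_simps)
  show "inner (r *\<^sub>R x) y = r * inner x y"
    unfolding inner_hilb_def
    by (subst suminf_mult[OF coord_product_summable, symmetric]) (simp add: algebra_simps)
  have sq: "Re (coord x i * cnj (coord x i)) = (cmod (coord x i))\<^sup>2" for i
    by (metis Re_complex_of_real complex_norm_square of_real_power)
  show "0 \<le> inner x x"
    unfolding inner_hilb_def sq by (intro suminf_nonneg coord_summable) auto
  show "inner x x = 0 \<longleftrightarrow> x = 0"
  proof
    assume "inner x x = 0"
    then have "\<forall>i. (cmod (coord x i))\<^sup>2 = 0"
      unfolding inner_hilb_def sq by (subst (asm) suminf_eq_zero_iff) (auto intro: coord_summable)
    then show "x = 0" by (intro hilb_eqI) simp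
  qed (simp add: inner_hilb_def)
qed

end

lemma norm_hilb_power2: "(norm (x::hilb))\<^sup>2 = (\<Sum>i. (cmod (coord x i))\<^sup>2)"
proof -
  have "Re (coord x i * cnj (coord x i)) = (cmod (coord x i))\<^sup>2" for i
    by (metis Re_complex_of_real complex_norm_square of_real_power)
  then show ?thesis
    by (simp add: power2_norm_eq_inner inner_hilb_def del: complex_cnj_mult times_complex.simps)
qed

lemma ell2_norm_coord: "ell2_norm (coord x) = norm x"
  by (simp add: ell2_norm_def flip: norm_hilb_power2)

lemma ell2_norm_eq_norm: "f \<in> ell2 \<Longrightarrow> ell2_norm f = norm (Abs_hilb f)"
  by (metis Abs_hilb_inverse ell2_norm_coord)

lemma cmod_coord_le_norm: "cmod (coord x i) \<le> norm x"
proof -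
  have "(cmod (coord x i))\<^sup>2 \<le> (norm x)\<^sup>2"
    unfolding norm_hilb_power2
    using sum_le_suminf[OF coord_summable[of x], of "{i}"] by auto
  then show ?thesis by (simp add: power2_le_iff_abs_le)
qed

lemma coord_sum: "coord (\<Sum>i\<in>A. f i) n = (\<Sum>i\<in>A. coord (f i) n)"
  by (induction A rule: infinite_finite_induct) auto

lemma hilb_vector_space: "vector_space cscale"
  by unfold_locales (auto intro!: hilb_eqI simp: algebra_simps)

interpretation hilb: vector_space cscale
  by (rule hilb_vector_space)

lemma scaleR_eq_cscale: "r *\<^sub>R x = complex_of_real r *\<^sub>C x"
  by (intro hilb_eqI) simp

lemma inner_cscale_left: "inner (c *\<^sub>C x) y = inner x (cnj c *\<^sub>C y)"
  unfolding inner_hilb_def by (rule suminf_cong) (simp add: algebra_simps)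

lemma norm_cscale [simp]: "norm (c *\<^sub>C x) = cmod c * norm x"
proof -
  have "(norm (c *\<^sub>C x))\<^sup>2 = (cmod c * norm x)\<^sup>2"
    unfolding norm_hilb_power2 power_mult_distrib
    by (subst suminf_mult[symmetric]) (auto simp: coord_summable norm_mult power_mult_distrib)
  then show ?thesis
    by (rule power2_eq_imp_eq) auto
qed

instance hilb :: complete_space
proof
  fix X :: "nat \<Rightarrow> hilb"
  assume C: "Cauchy X"
  have "Cauchy (\<lambda>n. coord (X n) i)" for i
  proof (rule metric_CauchyI)
    fix e :: real assume "e > 0"
    then obtain M where M: "\<forall>m\<ge>M. \<forall>n\<ge>M. dist (X m) (X n) < e"
      using metric_CauchyD[OF C] by blast
    have "dist (coord (X m) i) (coord (X n) i) < e" if "m \<ge> M" "n \<ge> M" for m n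
      using cmod_coord_le_norm[of "X m - X n" i] M that
      by (simp add: dist_norm) (meson le_less_trans)
    then show "\<exists>M. \<forall>m\<ge>M. \<forall>n\<ge>M. dist (coord (X m) i) (coord (X n) i) < e" by blast
  qed
  then have "\<forall>i. \<exists>l. (\<lambda>n. coord (X n) i) \<longlonglongrightarrow> l"
    by (simp add: Cauchy_convergent_iff convergent_def)
  then obtain L where L: "\<And>i. (\<lambda>n. coord (X n) i) \<longlonglongrightarrow> L i"
    by metis
  have part: "(\<Sum>i<K. (cmod (coord (X m) i - L i))\<^sup>2) \<le> e\<^sup>2"
    if e: "e > 0" and M: "\<And>m n. m \<ge> M \<Longrightarrow> n \<ge> M \<Longrightarrow> dist (X m) (X n) < e" and m: "m \<ge> M" for e M m K
  proof (rule LIMSEQ_le_const2)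
    show "(\<lambda>n. \<Sum>i<K. (cmod (coord (X m) i - coord (X n) i))\<^sup>2)
        \<longlonglongrightarrow> (\<Sum>i<K. (cmod (coord (X m) i - L i))\<^sup>2)"
      by (intro tendsto_intros L)
    have "(\<Sum>i<K. (cmod (coord (X m) i - coord (X n) i))\<^sup>2) \<le> e\<^sup>2" if "n \<ge> M" for n
    proof -
      have "(\<Sum>i<K. (cmod (coord (X m - X n) i))\<^sup>2) \<le> (norm (X m - X n))\<^sup>2"
        unfolding norm_hilb_power2 by (intro sum_le_suminf coord_summable) auto
      also have "\<dots> \<le> e\<^sup>2"
        using M[OF m that] by (intro power_mono) (auto simp: dist_norm)
      finally show ?thesis by simp
    qed
    then show "\<exists>N. \<forall>n\<ge>N. (\<Sum>i<K. (cmod (coord (X m) i - coord (X n) i))\<^sup>2) \<le> e\<^sup>2" by blast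
  qed
  have tail: "(\<lambda>i. coord (X m) i - L i) \<in> ell2 \<and> (\<Sum>i. (cmod (coord (X m) i - L i))\<^sup>2) \<le> e\<^sup>2"
    if "e > 0" "\<And>m n. m \<ge> M \<Longrightarrow> n \<ge> M \<Longrightarrow> dist (X m) (X n) < e" "m \<ge> M" for e M m
  proof -
    have "summable (\<lambda>i. (cmod (coord (X m) i - L i))\<^sup>2)"
      by (rule summableI_nonneg_bounded[of _ "e\<^sup>2"]) (auto intro: part[OF that])
    then show ?thesis
      by (auto simp: ell2_def intro!: suminf_le_const part[OF that])
  qed
  obtain M where M: "\<And>m n. m \<ge> M \<Longrightarrow> n \<ge> M \<Longrightarrow> dist (X m) (X n) < 1"
    using metric_CauchyD[OF C, of 1] by auto
  have "(\<lambda>i. coord (X M) i + - 1 * (coord (X M) i - L i)) \<in> ell2"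
    by (intro ell2_add ell2_scale coord conjunct1[OF tail[OF _ M]]) auto
  then have "L \<in> ell2" by simp
  have "X \<longlonglongrightarrow> Abs_hilb L"
  proof (rule metric_LIMSEQ_I)
    fix e :: real assume e: "e > 0"
    then obtain N where N: "\<And>m n. m \<ge> N \<Longrightarrow> n \<ge> N \<Longrightarrow> dist (X m) (X n) < e / 2"
      using metric_CauchyD[OF C, of "e / 2"] by auto
    have "dist (X m) (Abs_hilb L) < e" if "m \<ge> N" for m
    proof -
      have "(norm (X m - Abs_hilb L))\<^sup>2 \<le> (e / 2)\<^sup>2"
        using conjunct2[OF tail[OF _ N that]] e
        by (simp add: norm_hilb_power2 coord_Abs \<open>L \<in> ell2\<close>)
      then have "norm (X m - Abs_hilb L) \<le> e / 2"
        using e by (subst (asm) power2_le_iff_abs_le) auto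
      then show ?thesis using e by (simp add: dist_norm)
    qed
    then show "\<exists>N. \<forall>m\<ge>N. dist (X m) (Abs_hilb L) < e" by blast
  qed
  then show "convergent X" by (auto simp: convergent_def)
qed

section \<open>Matrix contractions\<close>

text \<open>
  Matrices are treated as functions together with explicit sizes, so that their columns can be
  stacked, padded and transposed without any bookkeeping of carrier conditions.
\<close>

definition contr :: "nat \<Rightarrow> nat \<Rightarrow> (nat \<Rightarrow> nat \<Rightarrow> complex) \<Rightarrow> bool" where
  "contr m n A \<longleftrightarrow> (\<forall>v. (\<Sum>i<m. (cmod (\<Sum>j<n. A i j * v j))\<^sup>2) \<le> (\<Sum>j<n. (cmod (v j))\<^sup>2))"

lemma contr_hilb:
  assumes "contr m n A"
  shows "(\<Sum>i<m. (norm (\<Sum>j<n. A i j *\<^sub>C h j))\<^sup>2) \<le> (\<Sum>j<n. (norm (h j))\<^sup>2)"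
proof -
  have "(\<Sum>i<m. (norm (\<Sum>j<n. A i j *\<^sub>C h j))\<^sup>2)
      = (\<Sum>k. \<Sum>i<m. (cmod (coord (\<Sum>j<n. A i j *\<^sub>C h j) k))\<^sup>2)"
    unfolding norm_hilb_power2 by (rule suminf_sum[symmetric]) (rule coord_summable)
  also have "\<dots> \<le> (\<Sum>k. \<Sum>j<n. (cmod (coord (h j) k))\<^sup>2)"
    using assms
    by (intro suminf_le summable_sum coord_summable) (simp add: coord_sum contr_def)
  also have "\<dots> = (\<Sum>j<n. (norm (h j))\<^sup>2)"
    unfolding norm_hilb_power2 by (rule suminf_sum) (rule coord_summable)
  finally show ?thesis .
qed

lemma cauchy_schwarz_sum:
  fixes a b :: "nat \<Rightarrow> complex"
  shows "(cmod (\<Sum>i<n. a i * b i))\<^sup>2 \<le> (\<Sum>i<n. (cmod (a i))\<^sup>2) * (\<Sum>i<n. (cmod (b i))\<^sup>2)"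
proof -
  have "cmod (\<Sum>i<n. a i * b i) \<le> (\<Sum>i<n. \<bar>cmod (a i)\<bar> * \<bar>cmod (b i)\<bar>)"
    by (rule order_trans[OF norm_sum]) (simp add: norm_mult)
  also have "\<dots> \<le> L2_set (\<lambda>i. cmod (a i)) {..<n} * L2_set (\<lambda>i. cmod (b i)) {..<n}"
    by (rule L2_set_mult_ineq)
  finally have "(cmod (\<Sum>i<n. a i * b i))\<^sup>2
      \<le> (L2_set (\<lambda>i. cmod (a i)) {..<n} * L2_set (\<lambda>i. cmod (b i)) {..<n})\<^sup>2"
    by (intro power_mono) auto
  then show ?thesis by (simp add: power_mult_distrib L2_set_def sum_nonneg)
qed

text \<open>
  With \<open>w = A\<^sup>* v\<close>, \<open>\<parallel>w\<parallel>\<^sup>2 = \<langle>v, A w\<rangle> \<le> \<parallel>v\<parallel> \<parallel>w\<parallel>\<close>, and one factor \<open>\<parallel>w\<parallel>\<close> cancels.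
\<close>

lemma contr_adjoint:
  assumes "contr m n A"
  shows "contr n m (\<lambda>i j. cnj (A j i))"
  unfolding contr_def
proof
  fix v :: "nat \<Rightarrow> complex"
  define w where "w i = (\<Sum>j<m. cnj (A j i) * v j)" for i
  define S where "S = (\<Sum>i<n. (cmod (w i))\<^sup>2)"
  have S0: "S \<ge> 0" unfolding S_def by (intro sum_nonneg) auto
  have "complex_of_real S = (\<Sum>i<n. cnj (w i) * w i)"
    by (simp add: S_def complex_norm_square mult.commute del: of_real_power)
  also have "\<dots> = (\<Sum>i<n. \<Sum>j<m. cnj (w i) * (cnj (A j i) * v j))"
    by (simp add: w_def sum_distrib_left)
  also have "\<dots> = (\<Sum>j<m. v j * cnj (\<Sum>i<n. A j i * w i))"
    by (subst sum.swap) (simp add: sum_distrib_left algebra_simps)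
  finally have "S\<^sup>2 = (cmod (\<Sum>j<m. v j * cnj (\<Sum>i<n. A j i * w i)))\<^sup>2"
    using S0 by (metis abs_of_nonneg norm_of_real)
  also have "\<dots> \<le> (\<Sum>j<m. (cmod (v j))\<^sup>2) * (\<Sum>j<m. (cmod (cnj (\<Sum>i<n. A j i * w i)))\<^sup>2)"
    by (rule cauchy_schwarz_sum)
  also have "\<dots> \<le> (\<Sum>j<m. (cmod (v j))\<^sup>2) * S"
    using assms unfolding S_def contr_def complex_mod_cnj
    by (intro mult_left_mono) (auto intro: sum_nonneg)
  finally have "S * S \<le> (\<Sum>j<m. (cmod (v j))\<^sup>2) * S" by (simp add: power2_eq_square)
  then have "S \<le> (\<Sum>j<m. (cmod (v j))\<^sup>2)"
    using S0 by (cases "S = 0") (auto intro: sum_nonneg)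
  then show "(\<Sum>i<n. (cmod (\<Sum>j<m. cnj (A j i) * v j))\<^sup>2) \<le> (\<Sum>j<m. (cmod (v j))\<^sup>2)"
    by (simp add: S_def w_def)
qed

lemma contr_cnj:
  assumes "contr m n A"
  shows "contr m n (\<lambda>i j. cnj (A i j))"
  unfolding contr_def
proof
  fix v :: "nat \<Rightarrow> complex"
  have "(\<Sum>i<m. (cmod (\<Sum>j<n. A i j * cnj (v j)))\<^sup>2) \<le> (\<Sum>j<n. (cmod (cnj (v j)))\<^sup>2)"
    using assms[unfolded contr_def, rule_format, of "\<lambda>j. cnj (v j)"] .
  moreover have "cmod (\<Sum>j<n. A i j * cnj (v j)) = cmod (\<Sum>j<n. cnj (A i j) * v j)" for i
    by (subst complex_mod_cnj[symmetric]) simp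
  ultimately show "(\<Sum>i<m. (cmod (\<Sum>j<n. cnj (A i j) * v j))\<^sup>2) \<le> (\<Sum>j<n. (cmod (v j))\<^sup>2)"
    by simp
qed

lemma contr_transpose: "contr m n A \<Longrightarrow> contr n m (\<lambda>i j. A j i)"
  using contr_cnj[OF contr_adjoint] by simp

section \<open>Extending Hilbert space valued maps with column estimates\<close>

text \<open>
  A Helly-type statement of Kirszbraun's kind. The condition on \<open>z\<close> says that \<open>-w\<close> has distance
  at most \<open>sqrt (\<parallel>w\<parallel>\<^sup>2 - s)\<close> from \<open>z\<close>. The functional \<open>f (w, s) = \<parallel>w\<parallel>\<^sup>2 - s\<close> is
  uniformly convex in \<open>w\<close>, so the first components of a minimizing sequence converge, and the
  variational inequality at the limit \<open>w0\<close> says that \<open>z = - w0\<close> lies in all the balls.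
  The common point is thus obtained from completeness.
\<close>

lemma convex_ball_intersection:
  fixes C :: "('a::{real_inner, complete_space} \<times> real) set"
  assumes ne: "C \<noteq> {}"
    and le: "\<And>w s. (w, s) \<in> C \<Longrightarrow> s \<le> (norm w)\<^sup>2"
    and conv: "\<And>w s w' s' t. (w, s) \<in> C \<Longrightarrow> (w', s') \<in> C \<Longrightarrow> 0 \<le> t \<Longrightarrow> t \<le> 1 \<Longrightarrow>
      ((1 - t) *\<^sub>R w + t *\<^sub>R w', (1 - t) * s + t * s') \<in> C"
  shows "\<exists>z. \<forall>(w, s)\<in>C. (norm z)\<^sup>2 + 2 * inner z w + s \<le> 0"
proof -
  define f where "f p = (norm (fst p))\<^sup>2 - snd p" for p :: "'a \<times> real"
  define \<mu> where "\<mu> = Inf (f ` C)"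
  have f0: "f p \<ge> 0" if "p \<in> C" for p
    using le[of "fst p" "snd p"] that by (simp add: f_def)
  have bdd: "bdd_below (f ` C)" using f0 by (intro bdd_belowI[of _ 0]) auto
  have \<mu>0: "\<mu> \<ge> 0" unfolding \<mu>_def using ne f0 by (intro cInf_greatest) auto
  have \<mu>le: "\<mu> \<le> f p" if "p \<in> C" for p
    unfolding \<mu>_def using that bdd by (intro cInf_lower) auto
  have "\<exists>p\<in>C. f p < \<mu> + 1 / real (Suc k)" for k
    using cInf_lessD[of "f ` C" "\<mu> + 1 / real (Suc k)"] ne unfolding \<mu>_def by auto
  then obtain p where p: "\<And>k. p k \<in> C" "\<And>k. f (p k) < \<mu> + 1 / real (Suc k)"
    by metis
  define w where "w k = fst (p k)" for k
  define s where "s k = snd (p k)" for k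
  have ws: "(w k, s k) \<in> C" for k using p(1)[of k] by (simp add: w_def s_def)
  have fws: "f (p k) = (norm (w k))\<^sup>2 - s k" for k by (simp add: f_def w_def s_def)
  have f_lim: "(\<lambda>k. f (p k)) \<longlonglongrightarrow> \<mu>"
  proof (rule tendsto_sandwich[of "\<lambda>_. \<mu>" _ _ "\<lambda>k. \<mu> + 1 / real (Suc k)"])
    show "\<forall>\<^sub>F k in sequentially. \<mu> \<le> f (p k)" using \<mu>le p(1) by auto
    show "\<forall>\<^sub>F k in sequentially. f (p k) \<le> \<mu> + 1 / real (Suc k)"
      using p(2) by (intro always_eventually allI less_imp_le)
    show "(\<lambda>k. \<mu> + 1 / real (Suc k)) \<longlonglongrightarrow> \<mu>"
      using tendsto_add[OF tendsto_const[of \<mu>] LIMSEQ_inverse_real_of_nat]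
      by (simp add: inverse_eq_divide)
  qed auto
  have near: "(norm (w m - w n))\<^sup>2 \<le> 2 / real (Suc m) + 2 / real (Suc n)" for m n
  proof -
    \<comment> \<open>the midpoint of two almost minimizers is no better than \<open>\<mu>\<close>: the parallelogram law\<close>
    have "\<mu> \<le> f ((1 - 1/2) *\<^sub>R w m + (1/2) *\<^sub>R w n, (1 - 1/2) * s m + (1/2) * s n)"
      by (intro \<mu>le conv ws) auto
    then have "4 * \<mu> \<le> (norm (w m + w n))\<^sup>2 - 2 * s m - 2 * s n"
      by (simp add: f_def power2_norm_eq_inner algebra_simps inner_commute)
    moreover have "(norm (w m - w n))\<^sup>2 + (norm (w m + w n))\<^sup>2
        = 2 * (norm (w m))\<^sup>2 + 2 * (norm (w n))\<^sup>2"
      by (simp add: power2_norm_eq_inner algebra_simps inner_commute)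
    ultimately show ?thesis
      using p(2)[of m] p(2)[of n] unfolding fws by (simp only: divide_inverse)
  qed
  have "Cauchy w"
  proof (rule metric_CauchyI)
    fix e :: real assume e: "e > 0"
    then obtain N where N: "1 / real (Suc N) < e\<^sup>2 / 4"
      using reals_Archimedean[of "e\<^sup>2 / 4"] by (auto simp: inverse_eq_divide)
    have "dist (w m) (w n) < e" if "m \<ge> N" "n \<ge> N" for m n
    proof -
      have "1 / real (Suc m) \<le> 1 / real (Suc N)" "1 / real (Suc n) \<le> 1 / real (Suc N)"
        using that by (auto intro!: divide_left_mono)
      then have "(norm (w m - w n))\<^sup>2 < e\<^sup>2"
        using near[of m n] N by simp
      then show ?thesis
        using e by (simp add: dist_norm power_less_imp_less_base)
    qed
    then show "\<exists>M. \<forall>m\<ge>M. \<forall>n\<ge>M. dist (w m) (w n) < e" by blast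
  qed
  then obtain w0 where w0: "w \<longlonglongrightarrow> w0"
    using Cauchy_convergent_iff convergent_def by blast
  \<comment> \<open>compare \<open>w0\<close> with the points at distance \<open>t\<close> from it towards \<open>v\<close>, divide by \<open>t\<close>, let \<open>t\<close> tend to 0\<close>
  have var: "2 * inner w0 v - (norm w0)\<^sup>2 - r \<ge> \<mu>" if vr: "(v, r) \<in> C" for v r
  proof -
    have t: "- t * (norm (v - w0))\<^sup>2 \<le> 2 * inner w0 v - (norm w0)\<^sup>2 - r - \<mu>"
      if t: "0 < t" "t \<le> 1" for t
    proof -
      have lim: "(\<lambda>n. (norm ((1 - t) *\<^sub>R w n + t *\<^sub>R v))\<^sup>2 - ((1 - t) * ((norm (w n))\<^sup>2 - f (p n)) + t * r))
          \<longlonglongrightarrow> (norm ((1 - t) *\<^sub>R w0 + t *\<^sub>R v))\<^sup>2 - ((1 - t) * ((norm w0)\<^sup>2 - \<mu>) + t * r)"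
        by (intro tendsto_intros w0 f_lim)
      have "\<mu> \<le> (norm ((1 - t) *\<^sub>R w0 + t *\<^sub>R v))\<^sup>2 - ((1 - t) * ((norm w0)\<^sup>2 - \<mu>) + t * r)"
      proof (rule LIMSEQ_le_const[OF lim], intro exI allI impI)
        fix n
        have "\<mu> \<le> f ((1 - t) *\<^sub>R w n + t *\<^sub>R v, (1 - t) * s n + t * r)"
          using t by (intro \<mu>le conv ws vr) auto
        moreover have "s n = (norm (w n))\<^sup>2 - f (p n)" by (simp add: fws)
        ultimately show "\<mu> \<le> (norm ((1 - t) *\<^sub>R w n + t *\<^sub>R v))\<^sup>2 - ((1 - t) * ((norm (w n))\<^sup>2 - f (p n)) + t * r)"
          by (simp add: f_def)
      qed
      then have "0 \<le> t * (2 * inner w0 v - (norm w0)\<^sup>2 - r - \<mu> + t * (norm (v - w0))\<^sup>2)"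
        by (simp add: power2_norm_eq_inner algebra_simps inner_commute)
      then show ?thesis using t by (simp add: zero_le_mult_iff)
    qed
    have "((\<lambda>t. - t * (norm (v - w0))\<^sup>2) \<longlongrightarrow> - 0 * (norm (v - w0))\<^sup>2) (at_right (0::real))"
      by (intro tendsto_intros)
    then have "- 0 * (norm (v - w0))\<^sup>2 \<le> 2 * inner w0 v - (norm w0)\<^sup>2 - r - \<mu>"
    proof (rule tendsto_upperbound)
      show "\<forall>\<^sub>F t in at_right (0::real). - t * (norm (v - w0))\<^sup>2 \<le> 2 * inner w0 v - (norm w0)\<^sup>2 - r - \<mu>"
        unfolding eventually_at_right_field by (rule exI[of _ 1]) (auto intro: t[simplified])
    qed simp
    then show ?thesis by simp
  qed
  show ?thesis
  proof (rule exI[of _ "- w0"], clarify)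
    fix v r assume "(v, r) \<in> C"
    from var[OF this] \<mu>0 show "(norm (- w0))\<^sup>2 + 2 * inner (- w0) v + r \<le> 0" by simp
  qed
qed

lemma sum_norm_add_cscale:
  "(\<Sum>i<n. (norm (h i + l i *\<^sub>C z))\<^sup>2)
    = (\<Sum>i<n. (norm (h i))\<^sup>2) + 2 * inner z (\<Sum>i<n. cnj (l i) *\<^sub>C h i) + (\<Sum>i<n. (cmod (l i))\<^sup>2) * (norm z)\<^sup>2"
proof -
  have "(norm (h i + l i *\<^sub>C z))\<^sup>2
      = (norm (h i))\<^sup>2 + 2 * inner z (cnj (l i) *\<^sub>C h i) + (cmod (l i))\<^sup>2 * (norm z)\<^sup>2" for i
  proof -
    have "(norm (h i + l i *\<^sub>C z))\<^sup>2
        = (norm (h i))\<^sup>2 + 2 * inner (l i *\<^sub>C z) (h i) + (norm (l i *\<^sub>C z))\<^sup>2"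
      by (simp only: power2_norm_eq_inner inner_add_left inner_add_right)
        (simp add: inner_commute[of "h i" "l i *\<^sub>C z"])
    then show ?thesis by (simp add: inner_cscale_left power_mult_distrib)
  qed
  then show ?thesis
    by (simp add: sum.distrib inner_sum_right sum_distrib_left sum_distrib_right)
qed

text \<open>
  The matrix is the orthogonal projection onto the complement of the unit vector \<open>l\<close>. It is used
  to remove from a column \<open>u + l y\<close> everything that involves \<open>y\<close>.
\<close>

lemma contr_complement:
  assumes "(\<Sum>i<n. (cmod (l i))\<^sup>2) = 1"
  shows "contr n n (\<lambda>i j. (if i = j then 1 else 0) - l i * cnj (l j))"
  unfolding contr_def
proof
  fix v :: "nat \<Rightarrow> complex"
  define c where "c = (\<Sum>j<n. cnj (l j) * v j)"
  have row: "(\<Sum>j<n. ((if i = j then 1 else 0) - l i * cnj (l j)) * v j) = v i - l i * c" if "i < n" for i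
    using that
    by (simp add: c_def left_diff_distrib sum_subtractf sum_distrib_left mult.assoc if_distrib[of "\<lambda>x. x * _"] cong: if_cong)
  have sq: "(cmod (v i - l i * c))\<^sup>2 = (cmod (v i))\<^sup>2 + (cmod (l i))\<^sup>2 * (cmod c)\<^sup>2 - 2 * Re (cnj c * (cnj (l i) * v i))" for i
  proof -
    have "(cmod (a - b))\<^sup>2 = (cmod a)\<^sup>2 + (cmod b)\<^sup>2 - 2 * Re (cnj b * a)" for a b
      unfolding cmod_power2 by (simp add: power2_eq_square algebra_simps)
    from this[of "v i" "l i * c"] show ?thesis
      by (simp only: norm_mult power_mult_distrib complex_cnj_mult mult_ac)
  qed
  have "(\<Sum>i<n. (cmod (v i - l i * c))\<^sup>2) = (\<Sum>i<n. (cmod (v i))\<^sup>2) + (cmod c)\<^sup>2 - 2 * Re (cnj c * c)"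
    using assms
    by (simp only: sq sum.distrib sum_subtractf flip: sum_distrib_left sum_distrib_right Re_sum)
      (simp add: c_def)
  also have "Re (cnj c * c) = (cmod c)\<^sup>2" 
    unfolding cmod_power2 by (simp add: power2_eq_square)
  finally show "(\<Sum>i<n. (cmod (\<Sum>j<n. ((if i = j then 1 else 0) - l i * cnj (l j)) * v j))\<^sup>2)
      \<le> (\<Sum>j<n. (cmod (v j))\<^sup>2)"
    by (simp add: row)
qed

definition stack :: "nat \<Rightarrow> (nat \<Rightarrow> 'a) \<Rightarrow> (nat \<Rightarrow> 'a) \<Rightarrow> nat \<Rightarrow> 'a" where
  "stack n u v i = (if i < n then u i else v (i - n))"

lemma sum_lessThan_add:
  fixes f :: "nat \<Rightarrow> 'a::comm_monoid_add"
  shows "(\<Sum>i<n + m. f i) = (\<Sum>i<n. f i) + (\<Sum>i<m. f (n + i))"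
  by (induction m) (auto simp: add.assoc)

lemma stack_less [simp]: "i < n \<Longrightarrow> stack n u v i = u i"
  and stack_add [simp]: "stack n u v (n + i) = v i"
  by (auto simp: stack_def)

lemma stack_cases: "i < n + m \<Longrightarrow> (\<And>i. i < n \<Longrightarrow> P (u i)) \<Longrightarrow> (\<And>i. i < m \<Longrightarrow> P (v i)) \<Longrightarrow> P (stack n u v i)"
  by (auto simp: stack_def)

text \<open>
  Partially defined linear maps are represented by their graphs, for Zorn's lemma. A relation
  that satisfies the column estimates is single valued, since the column 0 has bound 0.
\<close>

definition graph_subspace :: "(complex \<Rightarrow> 'y \<Rightarrow> 'y) \<Rightarrow> ('y::ab_group_add \<times> hilb) set \<Rightarrow> bool" where
  "graph_subspace sc G \<longleftrightarrow> (0, 0) \<in> G \<and>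
     (\<forall>(u, h)\<in>G. \<forall>(u', h')\<in>G. (u + u', h + h') \<in> G) \<and> (\<forall>c. \<forall>(u, h)\<in>G. (sc c u, c *\<^sub>C h) \<in> G)"

lemma graph_subspace_zero: "graph_subspace sc G \<Longrightarrow> (0, 0) \<in> G"
  and graph_subspace_add: "graph_subspace sc G \<Longrightarrow> (u, h) \<in> G \<Longrightarrow> (u', h') \<in> G \<Longrightarrow> (u + u', h + h') \<in> G"
  and graph_subspace_scale: "graph_subspace sc G \<Longrightarrow> (u, h) \<in> G \<Longrightarrow> (sc c u, c *\<^sub>C h) \<in> G"
  by (auto simp: graph_subspace_def)

lemma graph_subspace_sum:
  assumes "graph_subspace sc G" "\<And>i. i \<in> I \<Longrightarrow> (u i, h i) \<in> G"
  shows "(\<Sum>i\<in>I. sc (c i) (u i), \<Sum>i\<in>I. c i *\<^sub>C h i) \<in> G"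
  using assms(2)
  by (induction I rule: infinite_finite_induct)
    (auto intro: graph_subspace_zero graph_subspace_add graph_subspace_scale assms(1))

text \<open>
  \<open>B n u r\<close> stands for an upper bound \<open>r\<close> on the squared norm of the column \<open>u\<close> of length \<open>n\<close>.
  A relation in place of a norm makes it possible to impose several kinds of bounds at once without
  passing to an infimum. The axioms are what is left of Ruan's axioms on columns: scalar contractions
  act from the left, and squared norms are subadditive when columns are stacked.
\<close>

locale column_bound = vector_space sc
  for sc :: "complex \<Rightarrow> 'y::ab_group_add \<Rightarrow> 'y" (infixr \<open>*s\<close> 75) +
  fixes S :: "'y set" and B :: "nat \<Rightarrow> (nat \<Rightarrow> 'y) \<Rightarrow> real \<Rightarrow> bool"
  assumes subspace_S: "subspace S"
    and B_exists: "y \<in> S \<Longrightarrow> \<exists>r. B 1 (\<lambda>_. y) r"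
    and B_cong: "B n u r \<Longrightarrow> (\<And>i. i < n \<Longrightarrow> u i = v i) \<Longrightarrow> B n v r"
    and B_contr: "contr m n A \<Longrightarrow> (\<And>j. j < n \<Longrightarrow> u j \<in> S) \<Longrightarrow> B n u r \<Longrightarrow>
      B m (\<lambda>i. \<Sum>j<n. A i j *s u j) r"
    and B_scale: "(\<And>j. j < n \<Longrightarrow> u j \<in> S) \<Longrightarrow> B n u r \<Longrightarrow> B n (\<lambda>i. c *s u i) ((cmod c)\<^sup>2 * r)"
    and B_stack: "(\<And>j. j < n \<Longrightarrow> u j \<in> S) \<Longrightarrow> (\<And>j. j < m \<Longrightarrow> v j \<in> S) \<Longrightarrow> B n u r \<Longrightarrow> B m v s \<Longrightarrow>
      B (n + m) (stack n u v) (r + s)"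
begin

definition dominated :: "('y \<times> hilb) set \<Rightarrow> bool" where
  "dominated G \<longleftrightarrow> (\<forall>n u h r. (\<forall>i<n. (u i, h i) \<in> G) \<longrightarrow> B n u r \<longrightarrow> (\<Sum>i<n. (norm (h i))\<^sup>2) \<le> r)"

lemma dominatedD:
  "dominated G \<Longrightarrow> (\<And>i. i < n \<Longrightarrow> (u i, h i) \<in> G) \<Longrightarrow> B n u r \<Longrightarrow> (\<Sum>i<n. (norm (h i))\<^sup>2) \<le> r"
  unfolding dominated_def by blast

definition adjoin :: "'y \<Rightarrow> hilb \<Rightarrow> ('y \<times> hilb) set \<Rightarrow> ('y \<times> hilb) set" where
  "adjoin y z G = {(u + c *s y, h + c *\<^sub>C z) | c u h. (u, h) \<in> G}"

lemma graph_subspace_adjoin: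
  assumes "graph_subspace sc G"
  shows "graph_subspace sc (adjoin y z G)"
  unfolding graph_subspace_def
proof (intro conjI ballI allI; clarify?)
  show "(0, 0) \<in> adjoin y z G"
    unfolding adjoin_def using graph_subspace_zero[OF assms]
    by (auto intro!: exI[of _ 0])
next
  fix u h u' h' assume "(u, h) \<in> adjoin y z G" "(u', h') \<in> adjoin y z G"
  then obtain v k c v' k' c' where "u = v + c *s y" "h = k + c *\<^sub>C z" "(v, k) \<in> G"
    "u' = v' + c' *s y" "h' = k' + c' *\<^sub>C z" "(v', k') \<in> G"
    unfolding adjoin_def by auto
  then show "(u + u', h + h') \<in> adjoin y z G"
    using graph_subspace_add[OF assms, of v k v' k'] unfolding adjoin_def
    by (auto intro!: exI[of _ "c + c'"] exI[of _ "v + v'"] exI[of _ "k + k'"]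
        simp: scale_left_distrib hilb.scale_left_distrib)
next
  fix a u h assume "(u, h) \<in> adjoin y z G"
  then obtain v k c where "u = v + c *s y" "h = k + c *\<^sub>C z" "(v, k) \<in> G"
    unfolding adjoin_def by auto
  then show "(a *s u, a *\<^sub>C h) \<in> adjoin y z G"
    using graph_subspace_scale[OF assms, of v k a] unfolding adjoin_def
    by (auto intro!: exI[of _ "a * c"] exI[of _ "a *s v"] exI[of _ "a *\<^sub>C k"]
        simp: scale_right_distrib hilb.scale_right_distrib)
qed

lemma S_add: "u \<in> S \<Longrightarrow> v \<in> S \<Longrightarrow> u + v \<in> S"
  and S_scale: "u \<in> S \<Longrightarrow> c *s u \<in> S"
  by (auto intro: subspace_add subspace_scale subspace_S)

text \<open>
  A value \<open>z\<close> at \<open>y\<close> is admissible if \<open>\<Sum> \<parallel>h i + l i z\<parallel>\<^sup>2 \<le> r\<close> for all columns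
  \<open>u + l y\<close> with bound \<open>r\<close> and \<open>(u i, h i)\<close> in the graph; by homogeneity, \<open>l\<close> may be taken to be
  a unit vector. Each condition confines \<open>z\<close> to a ball, with parameters \<open>w = \<Sum> cnj (l i) h i\<close> and
  \<open>s = \<Sum> \<parallel>h i\<parallel>\<^sup>2 - r\<close>. Stacking two columns with weights \<open>sqrt (1 - t)\<close> and \<open>sqrt t\<close> shows
  that the set of these parameters is convex, and projecting a column to the complement of \<open>l\<close>,
  which leaves a column over the graph, shows that the balls are non-empty.
\<close>

lemma one_step_extension:
  assumes G: "graph_subspace sc G" "dominated G" and GS: "G \<subseteq> S \<times> UNIV" and y: "y \<in> S"
  shows "\<exists>z. dominated (adjoin y z G)"
proof -
  define P where "P w s n u h l r \<longleftrightarrow>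
      (\<forall>i<n. (u i, h i) \<in> G) \<and> (\<Sum>i<n. (cmod (l i))\<^sup>2) = 1 \<and> B n (\<lambda>i. u i + l i *s y) r \<and>
      w = (\<Sum>i<n. cnj (l i) *\<^sub>C h i) \<and> s = (\<Sum>i<n. (norm (h i))\<^sup>2) - r"
    for w s n u h and l :: "nat \<Rightarrow> complex" and r
  define C where "C = {(w, s). \<exists>n u h l r. P w s n u h l r}"
  have inS: "u \<in> S" if "(u, h) \<in> G" for u h using that GS by auto
  have ySl: "u + c *s y \<in> S" if "(u, h) \<in> G" for u h c
    using inS[OF that] y by (intro S_add S_scale)
  have "\<exists>z. \<forall>(w, s)\<in>C. (norm z)\<^sup>2 + 2 * inner z w + s \<le> 0"
  proof (rule convex_ball_intersection)
    obtain r where "B 1 (\<lambda>_. y) r" using B_exists[OF y] by blast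
    then have "P 0 (- r) 1 (\<lambda>_. 0) (\<lambda>_. 0) (\<lambda>_. 1) r"
      unfolding P_def using graph_subspace_zero[OF G(1)] by simp
    then show "C \<noteq> {}" unfolding C_def by blast
  next
    fix w s assume "(w, s) \<in> C"
    then obtain n u h l r where "P w s n u h l r" unfolding C_def by blast
    then have uh: "\<And>i. i < n \<Longrightarrow> (u i, h i) \<in> G" and l: "(\<Sum>i<n. (cmod (l i))\<^sup>2) = 1"
      and B: "B n (\<lambda>i. u i + l i *s y) r"
      and w: "w = (\<Sum>i<n. cnj (l i) *\<^sub>C h i)" and s: "s = (\<Sum>i<n. (norm (h i))\<^sup>2) - r"
      unfolding P_def by auto
    define A where "A i j = (if i = j then 1 else 0) - l i * cnj (l j)" for i j
    have A: "contr n n A" using contr_complement[OF l] by (simp add: A_def[abs_def])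
    have Al: "(\<Sum>j<n. A i j * l j) = 0" if "i < n" for i
    proof -
      have "(\<Sum>j<n. cnj (l j) * l j) = complex_of_real (\<Sum>j<n. (cmod (l j))\<^sup>2)"
        by (simp add: complex_norm_square mult.commute del: of_real_power)
      then have "(\<Sum>j<n. cnj (l j) * l j) = 1" using l by simp
      then have "(\<Sum>j<n. l i * cnj (l j) * l j) = l i"
        by (simp add: mult.assoc flip: sum_distrib_left)
      then show ?thesis using that
        by (simp add: A_def left_diff_distrib sum_subtractf if_distrib[of "\<lambda>x. x * _"] cong: if_cong)
    qed
    have "B n (\<lambda>i. \<Sum>j<n. A i j *s (u j + l j *s y)) r"
      by (rule B_contr[OF A _ B]) (auto intro: ySl uh)
    then have "B n (\<lambda>i. \<Sum>j<n. A i j *s u j) r"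
    proof (rule B_cong)
      fix i assume "i < n"
      then show "(\<Sum>j<n. A i j *s (u j + l j *s y)) = (\<Sum>j<n. A i j *s u j)"
        by (simp add: scale_right_distrib sum.distrib Al flip: scale_sum_left)
    qed
    then have "(\<Sum>i<n. (norm (\<Sum>j<n. A i j *\<^sub>C h j))\<^sup>2) \<le> r"
      by (rule dominatedD[OF G(2), rotated]) (rule graph_subspace_sum[OF G(1)], simp add: uh)
    moreover have "(\<Sum>j<n. A i j *\<^sub>C h j) = h i + l i *\<^sub>C (- w)" if "i < n" for i
    proof -
      have "(\<Sum>j<n. (l i * cnj (l j)) *\<^sub>C h j) = l i *\<^sub>C w"
        by (simp add: w hilb.scale_sum_right)
      moreover have "(\<Sum>j<n. (if i = j then 1 else 0) *\<^sub>C h j) = h i"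
        using that by (simp add: if_distrib[of "\<lambda>x. x *\<^sub>C _"] cong: if_cong)
      ultimately show ?thesis
        by (simp add: A_def hilb.scale_left_diff_distrib sum_subtractf)
    qed
    ultimately have "(\<Sum>i<n. (norm (h i + l i *\<^sub>C (- w)))\<^sup>2) \<le> r" by simp
    then show "s \<le> (norm w)\<^sup>2"
      unfolding sum_norm_add_cscale l w[symmetric] s
      by (simp add: power2_norm_eq_inner)
  next
    fix w s w' s' and t :: real
    assume "(w, s) \<in> C" "(w', s') \<in> C" and t: "0 \<le> t" "t \<le> 1"
    then obtain n u h l r n' u' h' l' r' where "P w s n u h l r" "P w' s' n' u' h' l' r'"
      unfolding C_def by blast
    then have uh: "\<And>i. i < n \<Longrightarrow> (u i, h i) \<in> G" and l: "(\<Sum>i<n. (cmod (l i))\<^sup>2) = 1"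
      and B: "B n (\<lambda>i. u i + l i *s y) r"
      and w: "w = (\<Sum>i<n. cnj (l i) *\<^sub>C h i)" and s: "s = (\<Sum>i<n. (norm (h i))\<^sup>2) - r"
      and uh': "\<And>i. i < n' \<Longrightarrow> (u' i, h' i) \<in> G" and l': "(\<Sum>i<n'. (cmod (l' i))\<^sup>2) = 1"
      and B': "B n' (\<lambda>i. u' i + l' i *s y) r'"
      and w': "w' = (\<Sum>i<n'. cnj (l' i) *\<^sub>C h' i)" and s': "s' = (\<Sum>i<n'. (norm (h' i))\<^sup>2) - r'"
      unfolding P_def by auto
    define a where "a = complex_of_real (sqrt (1 - t))"
    define b where "b = complex_of_real (sqrt t)"
    have ab: "(cmod a)\<^sup>2 = 1 - t" "(cmod b)\<^sup>2 = t" "a * a = complex_of_real (1 - t)"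
      "b * b = complex_of_real t" "cnj a = a" "cnj b = b"
      using t by (auto simp: a_def b_def simp flip: of_real_mult)
    define U where "U = stack n (\<lambda>i. a *s u i) (\<lambda>i. b *s u' i)"
    define H where "H = stack n (\<lambda>i. a *\<^sub>C h i) (\<lambda>i. b *\<^sub>C h' i)"
    define L where "L = stack n (\<lambda>i. a * l i) (\<lambda>i. b * l' i)"
    have "P ((1 - t) *\<^sub>R w + t *\<^sub>R w') ((1 - t) * s + t * s') (n + n') U H L ((1 - t) * r + t * r')"
      unfolding P_def
    proof (intro conjI allI impI)
      fix i assume "i < n + n'"
      then show "(U i, H i) \<in> G"
        by (auto simp: U_def H_def stack_def intro!: graph_subspace_scale[OF G(1)] uh uh')
    next
      show "(\<Sum>i<n + n'. (cmod (L i))\<^sup>2) = 1"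
        using l l' by (simp add: L_def sum_lessThan_add norm_mult power_mult_distrib ab flip: sum_distrib_left)
    next
      have "B (n + n') (stack n (\<lambda>i. a *s (u i + l i *s y)) (\<lambda>i. b *s (u' i + l' i *s y)))
          ((cmod a)\<^sup>2 * r + (cmod b)\<^sup>2 * r')"
        by (intro B_stack B_scale B B') (auto intro: S_scale ySl[OF uh] ySl[OF uh'])
      then show "B (n + n') (\<lambda>i. U i + L i *s y) ((1 - t) * r + t * r')"
        unfolding ab
        by (rule B_cong) (auto simp: U_def L_def stack_def scale_right_distrib)
    next
      have "(\<Sum>i<n. cnj (a * l i) *\<^sub>C a *\<^sub>C h i) = (1 - t) *\<^sub>R w"
      proof -
        have "(\<Sum>i<n. cnj (a * l i) *\<^sub>C a *\<^sub>C h i) = (\<Sum>i<n. (a * a) *\<^sub>C cnj (l i) *\<^sub>C h i)"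
          by (intro sum.cong) (auto simp: ab(5) mult_ac)
        then show ?thesis by (simp only: ab(3) w scaleR_eq_cscale hilb.scale_sum_right)
      qed
      moreover have "(\<Sum>i<n'. cnj (b * l' i) *\<^sub>C b *\<^sub>C h' i) = t *\<^sub>R w'"
      proof -
        have "(\<Sum>i<n'. cnj (b * l' i) *\<^sub>C b *\<^sub>C h' i) = (\<Sum>i<n'. (b * b) *\<^sub>C cnj (l' i) *\<^sub>C h' i)"
          by (intro sum.cong) (auto simp: ab(6) mult_ac)
        then show ?thesis by (simp only: ab(4) w' scaleR_eq_cscale hilb.scale_sum_right)
      qed
      ultimately show "(1 - t) *\<^sub>R w + t *\<^sub>R w' = (\<Sum>i<n + n'. cnj (L i) *\<^sub>C H i)"
        by (simp add: L_def H_def sum_lessThan_add)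
    next
      show "(1 - t) * s + t * s' = (\<Sum>i<n + n'. (norm (H i))\<^sup>2) - ((1 - t) * r + t * r')"
        unfolding H_def sum_lessThan_add
        by (simp add: s s' power_mult_distrib ab flip: sum_distrib_left) (simp add: algebra_simps)
    qed
    then show "((1 - t) *\<^sub>R w + t *\<^sub>R w', (1 - t) * s + t * s') \<in> C"
      unfolding C_def by blast
  qed
  then obtain z where z: "\<And>w s. (w, s) \<in> C \<Longrightarrow> (norm z)\<^sup>2 + 2 * inner z w + s \<le> 0" by blast
  have "dominated (adjoin y z G)"
    unfolding dominated_def
  proof (intro allI impI)
    fix n and v :: "nat \<Rightarrow> 'y" and k :: "nat \<Rightarrow> hilb" and r
    assume vk: "\<forall>i<n. (v i, k i) \<in> adjoin y z G" and B: "B n v r"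
    have "\<forall>i. \<exists>c u h. i < n \<longrightarrow> v i = u + c *s y \<and> k i = h + c *\<^sub>C z \<and> (u, h) \<in> G"
      using vk unfolding adjoin_def by blast
    then obtain c u h where cuh: "\<And>i. i < n \<Longrightarrow> v i = u i + c i *s y"
        "\<And>i. i < n \<Longrightarrow> k i = h i + c i *\<^sub>C z" "\<And>i. i < n \<Longrightarrow> (u i, h i) \<in> G"
      by metis
    define \<sigma> where "\<sigma> = (\<Sum>i<n. (cmod (c i))\<^sup>2)"
    have \<sigma>0: "\<sigma> \<ge> 0" unfolding \<sigma>_def by (intro sum_nonneg) auto
    show "(\<Sum>i<n. (norm (k i))\<^sup>2) \<le> r"
    proof (cases "\<sigma> = 0")
      case True
      then have "c i = 0" if "i < n" for i
        using that by (auto simp: \<sigma>_def sum_nonneg_eq_0_iff)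
      then have vk': "v i = u i" "k i = h i" if "i < n" for i using cuh that by auto
      then show ?thesis
        using cuh(3) by (intro dominatedD[OF G(2) _ B]) auto
    next
      case False
      define b where "b = complex_of_real (1 / sqrt \<sigma>)"
      have b: "(cmod b)\<^sup>2 = 1 / \<sigma>" "cnj b = b" "b * b = complex_of_real (1 / \<sigma>)"
        using \<sigma>0 False by (auto simp: b_def norm_divide power_divide simp flip: of_real_mult)
      have "B n (\<lambda>i. b *s v i) ((cmod b)\<^sup>2 * r)"
        by (rule B_scale[OF _ B]) (simp add: cuh(1) ySl[OF cuh(3)])
      then have "B n (\<lambda>i. b *s v i) (r / \<sigma>)" by (simp add: b)
      then have "B n (\<lambda>i. b *s u i + (b * c i) *s y) (r / \<sigma>)"
        by (rule B_cong) (simp add: cuh(1) scale_right_distrib)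
      moreover have "(\<Sum>i<n. (cmod (b * c i))\<^sup>2) = 1"
        using False by (simp add: norm_mult power_mult_distrib b \<sigma>_def flip: sum_divide_distrib)
      ultimately have "P (\<Sum>i<n. cnj (b * c i) *\<^sub>C b *\<^sub>C h i) ((\<Sum>i<n. (norm (b *\<^sub>C h i))\<^sup>2) - r / \<sigma>) n
          (\<lambda>i. b *s u i) (\<lambda>i. b *\<^sub>C h i) (\<lambda>i. b * c i) (r / \<sigma>)"
        unfolding P_def using cuh(3) by (auto intro: graph_subspace_scale[OF G(1)])
      then have "(norm z)\<^sup>2 + 2 * inner z (\<Sum>i<n. cnj (b * c i) *\<^sub>C b *\<^sub>C h i)
          + ((\<Sum>i<n. (norm (b *\<^sub>C h i))\<^sup>2) - r / \<sigma>) \<le> 0"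
        by (intro z) (unfold C_def mem_Collect_eq case_prod_conv, blast)
      moreover have "(\<Sum>i<n. cnj (b * c i) *\<^sub>C b *\<^sub>C h i) = (1 / \<sigma>) *\<^sub>R (\<Sum>i<n. cnj (c i) *\<^sub>C h i)"
      proof -
        have "(\<Sum>i<n. cnj (b * c i) *\<^sub>C b *\<^sub>C h i) = (\<Sum>i<n. (b * b) *\<^sub>C cnj (c i) *\<^sub>C h i)"
          by (intro sum.cong) (auto simp: b(2) mult_ac)
        then show ?thesis by (simp only: b(3) scaleR_eq_cscale hilb.scale_sum_right)
      qed
      ultimately have "(norm z)\<^sup>2 + 2 * (inner z (\<Sum>i<n. cnj (c i) *\<^sub>C h i) / \<sigma>)
          + ((\<Sum>i<n. (norm (h i))\<^sup>2) / \<sigma> - r / \<sigma>) \<le> 0"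
        by (simp add: power_mult_distrib b flip: sum_divide_distrib)
      then have "\<sigma> * ((norm z)\<^sup>2 + 2 * (inner z (\<Sum>i<n. cnj (c i) *\<^sub>C h i) / \<sigma>)
          + ((\<Sum>i<n. (norm (h i))\<^sup>2) / \<sigma> - r / \<sigma>)) \<le> 0"
        using \<sigma>0 by (simp add: mult_nonneg_nonpos)
      then have "(\<Sum>i<n. (norm (h i))\<^sup>2) + 2 * inner z (\<Sum>i<n. cnj (c i) *\<^sub>C h i) + \<sigma> * (norm z)\<^sup>2 \<le> r"
        using False by (simp add: algebra_simps)
      then show ?thesis
        unfolding \<sigma>_def sum_norm_add_cscale[symmetric] by (simp add: cuh)
    qed
  qed
  then show ?thesis by blast
qed

text \<open>
  This is the injectivity of column space: a map with values in a Hilbert space that respects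
  the bounds on columns over \<open>X\<close> extends with the same bounds. Unions of chains of graphs pose
  no problem since a column has only finitely many entries.
\<close>

theorem column_extension:
  assumes X: "subspace X" "X \<subseteq> S"
    and T_add: "\<And>x y. x \<in> X \<Longrightarrow> y \<in> X \<Longrightarrow> T (x + y) = T x + T y"
    and T_scale: "\<And>c x. x \<in> X \<Longrightarrow> T (c *s x) = c *\<^sub>C T x"
    and T_bound: "\<And>n u r. (\<And>i. i < n \<Longrightarrow> u i \<in> X) \<Longrightarrow> B n u r \<Longrightarrow> (\<Sum>i<n. (norm (T (u i)))\<^sup>2) \<le> r"
  obtains T' where "\<And>x. x \<in> X \<Longrightarrow> T' x = T x"
    "\<And>x y. x \<in> S \<Longrightarrow> y \<in> S \<Longrightarrow> T' (x + y) = T' x + T' y"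
    "\<And>c x. x \<in> S \<Longrightarrow> T' (c *s x) = c *\<^sub>C T' x"
    "\<And>n u r. (\<And>i. i < n \<Longrightarrow> u i \<in> S) \<Longrightarrow> B n u r \<Longrightarrow> (\<Sum>i<n. (norm (T' (u i)))\<^sup>2) \<le> r"
proof -
  define G0 where "G0 = {(x, T x) | x. x \<in> X}"
  define \<G> where "\<G> = {G. G0 \<subseteq> G \<and> graph_subspace sc G \<and> dominated G \<and> G \<subseteq> S \<times> UNIV}"
  have T0: "T 0 = 0"
    using T_scale[of 0 0] subspace_0[OF X(1)] by simp
  have G0: "G0 \<in> \<G>"
  proof -
    have "graph_subspace sc G0"
      unfolding graph_subspace_def G0_def
      using T0 by (auto simp: T_add T_scale intro: subspace_0[OF X(1)] subspace_add[OF X(1)] subspace_scale[OF X(1)]) 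
    moreover have "dominated G0"
      unfolding dominated_def
    proof (intro allI impI)
      fix n u and h :: "nat \<Rightarrow> hilb" and r
      assume "\<forall>i<n. (u i, h i) \<in> G0" "B n u r"
      then have "\<And>i. i < n \<Longrightarrow> u i \<in> X \<and> h i = T (u i)" unfolding G0_def by auto
      then show "(\<Sum>i<n. (norm (h i))\<^sup>2) \<le> r"
        using T_bound[of n u r] \<open>B n u r\<close> by simp
    qed
    ultimately show ?thesis unfolding \<G>_def G0_def using X(2) by auto
  qed
  have "\<exists>M\<in>\<G>. \<forall>G\<in>\<G>. M \<subseteq> G \<longrightarrow> G = M"
  proof (rule subset_Zorn_nonempty)
    show "\<G> \<noteq> {}" using G0 by blast
  next
    fix \<C> assume ne: "\<C> \<noteq> {}" and ch: "subset.chain \<G> \<C>"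
    have sub: "\<C> \<subseteq> \<G>" using ch by (simp add: subset.chain_def)
    have tot: "\<And>G G'. G \<in> \<C> \<Longrightarrow> G' \<in> \<C> \<Longrightarrow> G \<subseteq> G' \<or> G' \<subseteq> G"
      using ch by (auto simp: subset_chain_def)
    have fin: "\<exists>G\<in>\<C>. \<forall>i<n. p i \<in> G" if "\<forall>i<n. p i \<in> \<Union>\<C>" for n and p :: "nat \<Rightarrow> 'y \<times> hilb"
      using that
    proof (induction n)
      case 0 then show ?case using ne by auto
    next
      case (Suc n)
      then obtain G where G: "G \<in> \<C>" "\<forall>i<n. p i \<in> G" by auto
      obtain G' where G': "G' \<in> \<C>" "p n \<in> G'" using Suc.prems by auto
      from tot[OF G(1) G'(1)] show ?case
        using G G' by (auto simp: less_Suc_eq)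
    qed
    have two: "\<exists>G\<in>\<C>. p \<in> G \<and> q \<in> G" if "p \<in> \<Union>\<C>" "q \<in> \<Union>\<C>" for p q
      using that tot by blast
    have gs: "\<And>G. G \<in> \<C> \<Longrightarrow> graph_subspace sc G" using sub by (auto simp: \<G>_def)
    have "graph_subspace sc (\<Union>\<C>)"
      unfolding graph_subspace_def
    proof (intro conjI ballI allI; (elim UnionE)?; clarify?)
      show "(0, 0) \<in> \<Union>\<C>" using ne gs graph_subspace_zero by blast
    next
      fix u h u' h' G G'
      assume "(u, h) \<in> G" "G \<in> \<C>" "(u', h') \<in> G'" "G' \<in> \<C>"
      then show "(u + u', h + h') \<in> \<Union>\<C>"
        using two[of "(u, h)" "(u', h')"] graph_subspace_add gs by blast
    next
      fix c u h G assume "(u, h) \<in> G" "G \<in> \<C>"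
      then show "(c *s u, c *\<^sub>C h) \<in> \<Union>\<C>" using graph_subspace_scale gs by blast
    qed
    moreover have "dominated (\<Union>\<C>)"
      unfolding dominated_def
    proof (intro allI impI)
      fix n u h r assume uh: "\<forall>i<n. (u i, h i) \<in> \<Union>\<C>" and "B n u r"
      obtain G where "G \<in> \<C>" "\<forall>i<n. (u i, h i) \<in> G"
        using fin[of n "\<lambda>i. (u i, h i)"] uh by blast
      then show "(\<Sum>i<n. (norm (h i))\<^sup>2) \<le> r"
        using sub \<open>B n u r\<close> by (intro dominatedD[of G n u h]) (auto simp: \<G>_def)
    qed
    ultimately show "\<Union>\<C> \<in> \<G>" using sub ne unfolding \<G>_def by blast
  qed
  then obtain M where M: "G0 \<subseteq> M" "graph_subspace sc M" "dominated M" "M \<subseteq> S \<times> UNIV"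
    and max: "\<And>G. G \<in> \<G> \<Longrightarrow> M \<subseteq> G \<Longrightarrow> G = M"
    unfolding \<G>_def by auto
  have total: "\<exists>h. (y, h) \<in> M" if y: "y \<in> S" for y
  proof -
    obtain z where z: "dominated (adjoin y z M)"
      using one_step_extension[OF M(2-4) y] by blast
    have "M \<subseteq> adjoin y z M"
    proof
      fix p assume "p \<in> M"
      then have "(fst p + 0 *s y, snd p + 0 *\<^sub>C z) \<in> adjoin y z M"
        unfolding adjoin_def by (metis (mono_tags, lifting) CollectI prod.collapse)
      then show "p \<in> adjoin y z M" by simp
    qed
    moreover have "adjoin y z M \<subseteq> S \<times> UNIV"
      using M(4) y unfolding adjoin_def by (auto intro!: S_add S_scale)
    ultimately have "adjoin y z M = M"
      using z M graph_subspace_adjoin[OF M(2)] by (intro max) (auto simp: \<G>_def)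
    moreover have "(0 + 1 *s y, 0 + 1 *\<^sub>C z) \<in> adjoin y z M"
      unfolding adjoin_def using graph_subspace_zero[OF M(2)] by blast
    ultimately show ?thesis by auto
  qed
  have zero: "h = 0" if "(0, h) \<in> M" for h
  proof -
    have "0 \<in> S" by (rule subspace_0[OF subspace_S])
    then obtain r where r: "B 1 (\<lambda>_. 0) r" using B_exists by blast
    have "B 1 (\<lambda>_. 0 *s 0) ((cmod 0)\<^sup>2 * r)" by (rule B_scale[OF _ r]) (rule \<open>0 \<in> S\<close>)
    then have "B 1 (\<lambda>_. 0) 0" by simp
    then show ?thesis
      using dominatedD[OF M(3), of 1 "\<lambda>_. 0" "\<lambda>_. h" 0] that by simp
  qed
  have single: "h = h'" if "(y, h) \<in> M" "(y, h') \<in> M" for y h h'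
  proof -
    have "(y + (-1) *s y, h + (-1) *\<^sub>C h') \<in> M"
      using that by (intro graph_subspace_add[OF M(2)] graph_subspace_scale[OF M(2)])
    then show ?thesis using zero[of "h - h'"] by simp
  qed
  define T' where "T' y = (SOME h. (y, h) \<in> M)" for y
  have T': "(y, T' y) \<in> M" if "y \<in> S" for y
    unfolding T'_def by (rule someI_ex) (rule total[OF that])
  show ?thesis
  proof (rule that[of T'])
    show "T' x = T x" if "x \<in> X" for x
      using that M(1) X(2) by (intro single[OF T']) (auto simp: G0_def)
    show "T' (x + y) = T' x + T' y" if "x \<in> S" "y \<in> S" for x y
      using that by (intro single[OF T'] graph_subspace_add[OF M(2)] T' S_add)
    show "T' (c *s x) = c *\<^sub>C T' x" if "x \<in> S" for c x
      using that by (intro single[OF T'] graph_subspace_scale[OF M(2)] T' S_scale)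
    show "(\<Sum>i<n. (norm (T' (u i)))\<^sup>2) \<le> r" if "\<And>i. i < n \<Longrightarrow> u i \<in> S" "B n u r" for n u r
      by (rule dominatedD[OF M(3) T' that(2)]) (rule that(1))
  qed
qed

end

section \<open>Simultaneous extension with small values on a finite set\<close>

text \<open>
  Gram-Schmidt: the \<open>m\<close> columns of \<open>a\<close>, of whatever length \<open>n\<close>, satisfy \<open>a = W (W\<^sup>* a)\<close> with a
  contraction \<open>W\<close>. Hence \<open>a\<close> may be replaced by the \<open>m \<times> m\<close> matrix \<open>W\<^sup>* a\<close>, and
  matrices of bounded size form a totally bounded set. This is where it matters that only
  finitely many vectors are controlled at a time.
\<close>

lemma orthonormal_span:
  fixes a :: "nat \<Rightarrow> nat \<Rightarrow> complex"
  shows "\<exists>W. contr n m W \<and>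
    (\<forall>j<m. \<forall>i<n. (\<Sum>k<m. W i k * (\<Sum>l<n. cnj (W l k) * a l j)) = a i j)"
proof -
  define ip where "ip f g = (\<Sum>i<n. cnj (f i) * g i)" for f g :: "nat \<Rightarrow> complex"
  have ip_add: "ip f (\<lambda>i. g i + h i) = ip f g + ip f h"
    and ip_diff: "ip f (\<lambda>i. g i - h i) = ip f g - ip f h"
    and ip_scale: "ip f (\<lambda>i. g i * c) = ip f g * c" for f g h c
    by (simp_all add: ip_def sum.distrib sum_subtractf distrib_left right_diff_distrib
        sum_distrib_right mult.assoc)
  have ip_div: "ip (\<lambda>i. f i / of_real s) g = ip f g / of_real s"
    and ip_div': "ip g (\<lambda>i. f i / of_real s) = ip g f / of_real s" for f g s
    by (simp_all add: ip_def sum_divide_distrib)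
  have ip_sum: "ip f (\<lambda>i. \<Sum>k<q. G k i) = (\<Sum>k<q. ip f (G k))" for f q and G :: "nat \<Rightarrow> nat \<Rightarrow> complex"
    unfolding ip_def by (subst sum.swap) (simp add: sum_distrib_left)
  have ip_sum_left: "ip (\<lambda>i. \<Sum>k<q. G k i * v k) f = (\<Sum>k<q. cnj (v k) * ip (G k) f)"
    for f q v and G :: "nat \<Rightarrow> nat \<Rightarrow> complex"
    unfolding ip_def sum_distrib_left by (subst sum.swap) (simp add: sum_distrib_left sum_distrib_right mult_ac)
  have ip_cnj: "cnj (ip f g) = ip g f" for f g
    by (simp add: ip_def mult.commute)
  have ip_self: "ip f f = complex_of_real (\<Sum>i<n. (cmod (f i))\<^sup>2)" for f
    by (simp add: ip_def complex_norm_square mult.commute del: of_real_power)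
  have ip_zero: "ip f f = 0 \<Longrightarrow> i < n \<Longrightarrow> f i = 0" for f i
    unfolding ip_self of_real_eq_0_iff by (subst (asm) sum_nonneg_eq_0_iff) auto
  have ip_cong: "(\<And>i. i < n \<Longrightarrow> g i = h i) \<Longrightarrow> ip f g = ip f h" for f g h
    by (simp add: ip_def)
  define good where "good m V \<longleftrightarrow>
      (\<forall>k<m. \<forall>k'<m. k \<noteq> k' \<longrightarrow> ip (V k) (V k') = 0) \<and>
      (\<forall>k<m. ip (V k) (V k) = 0 \<or> ip (V k) (V k) = 1) \<and>
      (\<forall>j<m. \<forall>i<n. (\<Sum>k<m. V k i * ip (V k) (\<lambda>l. a l j)) = a i j)" for m V
  have goodD: "k < m \<Longrightarrow> k' < m \<Longrightarrow> k \<noteq> k' \<Longrightarrow> ip (V k) (V k') = 0"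
    "k < m \<Longrightarrow> ip (V k) (V k) = 0 \<or> ip (V k) (V k) = 1"
    "j < m \<Longrightarrow> i < n \<Longrightarrow> (\<Sum>k<m. V k i * ip (V k) (\<lambda>l. a l j)) = a i j"
    if "good m V" for m V k k' i j
    using that unfolding good_def by simp_all
  have "\<exists>V. good m V"
  proof (induction m)
    case 0 show ?case by (simp add: good_def)
  next
    case (Suc m)
    then obtain V where V: "good m V" ..
    note orth = goodD(1)[OF V] and unit = goodD(2)[OF V] and rep = goodD(3)[OF V]
    define b where "b i = a i m" for i
    define r where "r i = b i - (\<Sum>k<m. V k i * ip (V k) b)" for i
    define s where "s = sqrt (\<Sum>i<n. (cmod (r i))\<^sup>2)"
    \<comment> \<open>if \<open>s = 0\<close>, then \<open>w = 0\<close> by division by zero, which is the right choice\<close>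
    define w where "w i = r i / complex_of_real s" for i
    have s2: "ip r r = complex_of_real s * complex_of_real s"
      by (simp add: ip_self s_def sum_nonneg flip: of_real_mult)
    have Vr: "ip (V k) r = 0" if k: "k < m" for k
    proof -
      have "ip (V k) r = ip (V k) b - (\<Sum>k'<m. ip (V k) (V k') * ip (V k') b)"
        unfolding r_def by (simp add: ip_diff ip_sum ip_scale)
      also have "(\<Sum>k'<m. ip (V k) (V k') * ip (V k') b) = (\<Sum>k'<m. if k' = k then ip (V k) (V k) * ip (V k) b else 0)"
        by (intro sum.cong) (auto simp: orth k)
      also have "\<dots> = ip (V k) b"
      proof -
        have "ip (V k) b = 0" if "ip (V k) (V k) = 0"
          using ip_zero[OF that] by (simp add: ip_def)
        then show ?thesis using unit[OF k] k by auto
      qed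
      finally show ?thesis by simp
    qed
    have Vw: "ip (V k) w = 0" if "k < m" for k
      using Vr[OF that] unfolding w_def by (simp add: ip_div')
    have wV: "ip w (V k) = 0" if "k < m" for k
      using Vw[OF that] by (metis complex_cnj_zero ip_cnj)
    have ww: "ip w w = 0 \<or> ip w w = 1"
      unfolding w_def ip_div ip_div' s2 by simp
    have wb: "ip w b = ip w r"
    proof -
      have "ip w b = ip w (\<lambda>i. r i + (\<Sum>k<m. V k i * ip (V k) b))"
        by (simp add: r_def)
      also have "\<dots> = ip w r" by (simp add: ip_add ip_sum ip_scale wV)
      finally show ?thesis .
    qed
    have wr: "w i * ip w r = r i" if "i < n" for i
    proof (cases "s = 0")
      case True
      then have "ip r r = 0" by (simp add: s2)
      then have "r i = 0" using that by (rule ip_zero)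
      then show ?thesis by (simp add: w_def)
    next
      case False
      then have "ip w r = complex_of_real s"
        unfolding w_def[abs_def] ip_div s2 by simp
      with False show ?thesis by (simp add: w_def)
    qed
    define V' where "V' k = (if k = m then w else V k)" for k
    have V': "V' m = w" "\<And>k. k < m \<Longrightarrow> V' k = V k" by (auto simp: V'_def)
    have "(\<Sum>k<Suc m. V' k i * ip (V' k) (\<lambda>l. a l j)) = a i j" if j: "j < Suc m" and i: "i < n" for i j
    proof (cases "j = m")
      case True
      then show ?thesis
        using wr[OF i] by (simp add: V' wb r_def[of i] flip: b_def)
    next
      case False
      with j have j: "j < m" by simp
      have "ip w (\<lambda>l. a l j) = ip w (\<lambda>l. \<Sum>k<m. V k l * ip (V k) (\<lambda>l. a l j))"
        by (rule ip_cong) (simp add: rep j)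
      also have "\<dots> = 0" by (simp add: ip_sum ip_scale wV)
      finally show ?thesis using rep[OF j i] by (simp add: V')
    qed
    moreover have "\<forall>k<Suc m. \<forall>k'<Suc m. k \<noteq> k' \<longrightarrow> ip (V' k) (V' k') = 0"
      by (auto simp: V'_def orth Vw wV less_Suc_eq)
    moreover have "\<forall>k<Suc m. ip (V' k) (V' k) = 0 \<or> ip (V' k) (V' k) = 1"
      using unit ww by (auto simp: V'_def less_Suc_eq)
    ultimately have "good (Suc m) V'" unfolding good_def by simp
    then show ?case by (intro exI)
  qed
  then obtain V where V: "good m V" ..
  note orth = goodD(1)[OF V] and unit = goodD(2)[OF V] and rep = goodD(3)[OF V]
  have "contr n m (\<lambda>i k. V k i)"
    unfolding contr_def
  proof
    fix v :: "nat \<Rightarrow> complex"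
    define f where "f i = (\<Sum>k<m. V k i * v k)" for i
    have fV: "ip (V k) f = ip (V k) (V k) * v k" if k: "k < m" for k
    proof -
      have "ip (V k) f = (\<Sum>k'<m. ip (V k) (V k') * v k')"
        unfolding f_def by (simp add: ip_sum ip_scale)
      also have "\<dots> = (\<Sum>k'<m. if k' = k then ip (V k) (V k) * v k else 0)"
        by (intro sum.cong) (auto simp: orth k)
      finally show ?thesis using k by simp
    qed
    have "ip f f = (\<Sum>k<m. cnj (v k) * ip (V k) f)"
      unfolding f_def[abs_def] by (rule ip_sum_left)
    also have "\<dots> = (\<Sum>k<m. ip (V k) (V k) * complex_of_real ((cmod (v k))\<^sup>2))"
      by (intro sum.cong) (simp_all add: fV complex_norm_square mult_ac del: of_real_power)
    also have "\<dots> = (\<Sum>k<m. complex_of_real (if ip (V k) (V k) = 0 then 0 else (cmod (v k))\<^sup>2))"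
      using unit by (intro sum.cong) auto
    finally have "(\<Sum>i<n. (cmod (f i))\<^sup>2) = (\<Sum>k<m. if ip (V k) (V k) = 0 then 0 else (cmod (v k))\<^sup>2)"
      unfolding ip_self of_real_sum[symmetric] of_real_eq_iff .
    also have "\<dots> \<le> (\<Sum>k<m. (cmod (v k))\<^sup>2)" by (intro sum_mono) auto
    finally show "(\<Sum>i<n. (cmod (\<Sum>k<m. V k i * v k))\<^sup>2) \<le> (\<Sum>k<m. (cmod (v k))\<^sup>2)"
      by (simp add: f_def)
  qed
  then show ?thesis
    using rep unfolding ip_def by (intro exI[of _ "\<lambda>i k. V k i"]) auto
qed

lemma unit_disc_net:
  assumes "\<theta> > (0::real)"
  shows "\<exists>D. finite D \<and> (\<forall>z. cmod z \<le> 1 \<longrightarrow> (\<exists>p\<in>D. cmod (z - p) \<le> \<theta>))"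
proof -
  define h where "h = \<theta> / 2"
  have h: "h > 0" using assms by (simp add: h_def)
  define R where "R = \<lceil>1 / h\<rceil> + 1"
  define D where "D = (\<lambda>(p, q). Complex (h * of_int p) (h * of_int q)) ` ({-R..R} \<times> {-R..R})"
  have "finite D" unfolding D_def by simp
  moreover have "\<exists>p\<in>D. cmod (z - p) \<le> \<theta>" if z: "cmod z \<le> 1" for z
  proof -
    have part: "\<bar>x - h * of_int \<lfloor>x / h\<rfloor>\<bar> \<le> h \<and> \<lfloor>x / h\<rfloor> \<in> {-R..R}" if x: "\<bar>x\<bar> \<le> 1" for x :: real
    proof
      have 1: "of_int \<lfloor>x / h\<rfloor> \<le> x / h" "x / h < of_int \<lfloor>x / h\<rfloor> + 1"
        by linarith+
      have "h * of_int \<lfloor>x / h\<rfloor> \<le> h * (x / h)" "h * (x / h) < h * (of_int \<lfloor>x / h\<rfloor> + 1)"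
        using mult_left_mono[OF 1(1), of h] mult_strict_left_mono[OF 1(2) h] h by linarith+
      then have "h * of_int \<lfloor>x / h\<rfloor> \<le> x" "x < h * of_int \<lfloor>x / h\<rfloor> + h"
        using h by (simp_all add: distrib_left)
      then show "\<bar>x - h * of_int \<lfloor>x / h\<rfloor>\<bar> \<le> h" by linarith
      have "\<bar>x / h\<bar> \<le> 1 / h" using x h by (simp add: abs_divide divide_right_mono)
      then show "\<lfloor>x / h\<rfloor> \<in> {-R..R}" 
        unfolding R_def atLeastAtMost_iff abs_le_iff by (intro conjI; linarith)
    qed
    define p where "p = Complex (h * of_int \<lfloor>Re z / h\<rfloor>) (h * of_int \<lfloor>Im z / h\<rfloor>)"
    have "\<bar>Re z\<bar> \<le> 1" "\<bar>Im z\<bar> \<le> 1"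
      using z abs_Re_le_cmod[of z] abs_Im_le_cmod[of z] by linarith+
    then have "p \<in> D" "\<bar>Re (z - p)\<bar> \<le> h" "\<bar>Im (z - p)\<bar> \<le> h"
      using part[of "Re z"] part[of "Im z"] unfolding D_def p_def by auto
    moreover have "cmod (z - p) \<le> \<bar>Re (z - p)\<bar> + \<bar>Im (z - p)\<bar>" by (rule cmod_le)
    ultimately show ?thesis by (intro bexI[of _ p]) (auto simp: h_def)
  qed
  ultimately show ?thesis by blast
qed

lemma unit_matrix_net:
  assumes "\<theta> > (0::real)"
  shows "\<exists>N :: (nat \<Rightarrow> nat \<Rightarrow> complex) set. finite N \<and> (\<forall>a. (\<forall>i<m. \<forall>j<m. cmod (a i j) \<le> 1) \<longrightarrow>
    (\<exists>b\<in>N. \<forall>i<m. \<forall>j<m. cmod (a i j - b i j) \<le> \<theta>))"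
proof -
  from unit_disc_net[OF assms]
  obtain D where D: "finite D" "\<forall>z. cmod z \<le> 1 \<longrightarrow> (\<exists>p\<in>D. cmod (z - p) \<le> \<theta>)"
    by (elim exE conjE)
  define N where "N = (\<lambda>f (i::nat) (j::nat). f (i, j)) ` PiE ({..<m} \<times> {..<m}) (\<lambda>_. D)"
  have "finite N" unfolding N_def by (rule finite_imageI, rule finite_PiE) (simp_all add: D(1))
  moreover have "\<exists>b\<in>N. \<forall>i<m. \<forall>j<m. cmod (a i j - b i j) \<le> \<theta>"
    if a: "\<forall>i<m. \<forall>j<m. cmod (a i j) \<le> 1" for a
  proof -
    have "\<exists>p\<in>D. cmod (a (fst ij) (snd ij) - p) \<le> \<theta>" if "ij \<in> {..<m} \<times> {..<m}" for ij
      using that a by (intro D(2)[rule_format]) auto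
    then have "\<forall>ij\<in>{..<m} \<times> {..<m}. \<exists>p. p \<in> D \<and> cmod (a (fst ij) (snd ij) - p) \<le> \<theta>" by blast
    from bchoice[OF this] obtain f
      where f: "\<forall>ij\<in>{..<m} \<times> {..<m}. f ij \<in> D \<and> cmod (a (fst ij) (snd ij) - f ij) \<le> \<theta>"
      by (elim exE)
    define g where "g = restrict f ({..<m} \<times> {..<m})"
    have "g \<in> PiE ({..<m} \<times> {..<m}) (\<lambda>_. D)" unfolding g_def restrict_PiE_iff using f by blast
    then have "(\<lambda>i j. g (i, j)) \<in> N" unfolding N_def by (rule imageI)
    moreover have "cmod (a i j - g (i, j)) \<le> \<theta>" if "i < m" "j < m" for i j
      using f that by (force simp: g_def)
    ultimately show ?thesis by (intro bexI[of _ "\<lambda>i j. g (i, j)"]) auto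
  qed
  ultimately show ?thesis by blast
qed

text \<open>
  What Ruan's axioms say about the norms of columns over an operator space, or of rows.
\<close>

locale column_norm = vector_space sc
  for sc :: "complex \<Rightarrow> 'y::ab_group_add \<Rightarrow> 'y" (infixr \<open>*s\<close> 75) +
  fixes S :: "'y set" and c :: "nat \<Rightarrow> (nat \<Rightarrow> 'y) \<Rightarrow> real"
  assumes subspace_S: "subspace S"
    and c_nonneg: "(\<And>i. i < n \<Longrightarrow> u i \<in> S) \<Longrightarrow> 0 \<le> c n u"
    and c_cong: "(\<And>i. i < n \<Longrightarrow> u i = v i) \<Longrightarrow> c n u = c n v"
    and c_contr: "contr m n A \<Longrightarrow> (\<And>j. j < n \<Longrightarrow> u j \<in> S) \<Longrightarrow> c m (\<lambda>i. \<Sum>j<n. A i j *s u j) \<le> c n u"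
    and c_scale: "(\<And>i. i < n \<Longrightarrow> u i \<in> S) \<Longrightarrow> c n (\<lambda>i. a *s u i) = cmod a * c n u"
    and c_add: "(\<And>i. i < n \<Longrightarrow> u i \<in> S) \<Longrightarrow> (\<And>i. i < n \<Longrightarrow> v i \<in> S) \<Longrightarrow>
      c n (\<lambda>i. u i + v i) \<le> c n u + c n v"
    and c_stack: "(\<And>i. i < n \<Longrightarrow> u i \<in> S) \<Longrightarrow> (\<And>i. i < m \<Longrightarrow> v i \<in> S) \<Longrightarrow>
      (c (n + m) (stack n u v))\<^sup>2 \<le> (c n u)\<^sup>2 + (c m v)\<^sup>2"
begin

lemmas S_closed = subspace_add[OF subspace_S] subspace_scale[OF subspace_S] subspace_sum[OF subspace_S]
  subspace_diff[OF subspace_S]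

lemma c_minus_commute:
  assumes "\<And>i. i < n \<Longrightarrow> u i \<in> S" "\<And>i. i < n \<Longrightarrow> v i \<in> S"
  shows "c n (\<lambda>i. u i - v i) = c n (\<lambda>i. v i - u i)"
proof -
  have "c n (\<lambda>i. (-1) *s (v i - u i)) = cmod (-1) * c n (\<lambda>i. v i - u i)"
    using assms by (intro c_scale S_closed)
  then show ?thesis by simp
qed

lemma c_const_column:
  assumes y: "y \<in> S"
  shows "c n (\<lambda>i. b i *s y) \<le> (\<Sum>i<n. cmod (b i)) * c 1 (\<lambda>_. y)"
proof (cases "(\<Sum>i<n. cmod (b i)) = 0")
  case True
  then have "b i = 0" if "i < n" for i using that by (simp add: sum_nonneg_eq_0_iff)
  then have "c n (\<lambda>i. b i *s y) = c n (\<lambda>i. 0 *s y)" by (intro c_cong) auto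
  also have "\<dots> = 0" using c_scale[of n "\<lambda>_. y" 0] y by simp
  finally show ?thesis using True by simp
next
  case False
  define s where "s = (\<Sum>i<n. cmod (b i))"
  have s: "s > 0" using False by (simp add: s_def less_le sum_nonneg)
  have "contr n 1 (\<lambda>i _. b i / of_real s)"
    unfolding contr_def
  proof
    fix v :: "nat \<Rightarrow> complex"
    have "(L2_set (\<lambda>i. cmod (b i)) {..<n})\<^sup>2 \<le> s\<^sup>2"
      unfolding s_def by (intro power_mono L2_set_le_sum) auto
    then have "(\<Sum>i<n. (cmod (b i))\<^sup>2) \<le> s\<^sup>2" by (simp add: L2_set_def sum_nonneg)
    then have "(\<Sum>i<n. (cmod (b i))\<^sup>2) / s\<^sup>2 \<le> 1" using s by simp
    then have "(\<Sum>i<n. (cmod (b i))\<^sup>2) / s\<^sup>2 * (cmod (v 0))\<^sup>2 \<le> 1 * (cmod (v 0))\<^sup>2"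
      by (intro mult_right_mono) auto
    then show "(\<Sum>i<n. (cmod (\<Sum>j<1. b i / of_real s * v j))\<^sup>2) \<le> (\<Sum>j<1. (cmod (v j))\<^sup>2)"
      by (simp add: norm_mult norm_divide power_mult_distrib power_divide sum_distrib_right sum_divide_distrib)
  qed
  then have "c n (\<lambda>i. \<Sum>j<1::nat. (b i / of_real s) *s (of_real s *s y)) \<le> c 1 (\<lambda>_. of_real s *s y)"
    by (rule c_contr) (auto intro: S_closed y)
  also have "\<dots> = cmod (of_real s) * c 1 (\<lambda>_. y)"
    using y by (intro c_scale)
  finally show ?thesis using s unfolding s_def[symmetric] by simp
qed

lemma c_sum:
  fixes f :: "nat \<Rightarrow> nat \<Rightarrow> 'y"
  assumes "\<And>i j. j < m \<Longrightarrow> i < n \<Longrightarrow> f i j \<in> S"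
  shows "c n (\<lambda>i. \<Sum>j<m. f i j) \<le> (\<Sum>j<m. c n (\<lambda>i. f i j))"
  using assms
proof (induction m rule: nat_induct)
  case 0
  have "c n (\<lambda>i. 0 *s 0) = 0"
    using c_scale[of n "\<lambda>_. 0" 0] subspace_0[OF subspace_S] by simp
  then show ?case by simp
next
  case (Suc m)
  have "c n (\<lambda>i. (\<Sum>j<m. f i j) + f i m) \<le> c n (\<lambda>i. \<Sum>j<m. f i j) + c n (\<lambda>i. f i m)"
    using Suc.prems by (intro c_add S_closed) auto
  with Suc show ?case by simp
qed

lemma c_small_combination:
  fixes m n :: nat
  assumes y: "\<And>j. j < m \<Longrightarrow> y j \<in> S"
    and b: "\<And>i j. i < n \<Longrightarrow> j < m \<Longrightarrow> cmod (b i j) \<le> \<theta>"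
  shows "c n (\<lambda>i. \<Sum>j<m. b i j *s y j) \<le> real n * \<theta> * (\<Sum>j<m. c 1 (\<lambda>_. y j))"
proof -
  have "c n (\<lambda>i. \<Sum>j<m. b i j *s y j) \<le> (\<Sum>j<m. c n (\<lambda>i. b i j *s y j))"
    by (intro c_sum S_closed y)
  also have "\<dots> \<le> (\<Sum>j<m. real n * \<theta> * c 1 (\<lambda>_. y j))"
  proof (rule sum_mono)
    fix j assume "j \<in> {..<m}"
    then have j: "j < m" by simp
    have "c n (\<lambda>i. b i j *s y j) \<le> (\<Sum>i<n. cmod (b i j)) * c 1 (\<lambda>_. y j)"
      by (rule c_const_column[OF y[OF j]])
    also have "\<dots> \<le> real n * \<theta> * c 1 (\<lambda>_. y j)"
      using sum_bounded_above[of "{..<n}" "\<lambda>i. cmod (b i j)" \<theta>] b j y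
      by (intro mult_right_mono c_nonneg) auto
    finally show "c n (\<lambda>i. b i j *s y j) \<le> real n * \<theta> * c 1 (\<lambda>_. y j)" .
  qed
  finally show ?thesis by (simp add: sum_distrib_left)
qed

text \<open>
  The square of a mixed norm, for which columns over \<open>S\<close> cost \<open>\<kappa>\<close> times their norm and
  scalar columns times \<open>y j\<close> cost \<open>\<delta>\<close> times their Euclidean norm. A map that respects
  these bounds has norm at most \<open>\<kappa>\<close> and is of size at most \<open>\<delta>\<close> at each \<open>y j\<close>.
  The squares of the two costs are added since this sum is subadditive under stacking, unlike
  the square of the sum.
\<close>

definition split_bound :: "nat \<Rightarrow> (nat \<Rightarrow> 'y) \<Rightarrow> real \<Rightarrow> real \<Rightarrow> nat \<Rightarrow> (nat \<Rightarrow> 'y) \<Rightarrow> real \<Rightarrow> bool" where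
  "split_bound m y \<kappa> \<delta> n u r \<longleftrightarrow> (\<exists>v a. (\<forall>i<n. v i \<in> S \<and> u i = v i + (\<Sum>j<m. a i j *s y j)) \<and>
     (\<kappa> * c n v)\<^sup>2 + \<delta>\<^sup>2 * (\<Sum>i<n. \<Sum>j<m. (cmod (a i j))\<^sup>2) \<le> r)"

lemma split_bound_trivial:
  assumes "\<And>i. i < n \<Longrightarrow> u i \<in> S"
  shows "split_bound m y \<kappa> \<delta> n u ((\<kappa> * c n u)\<^sup>2)"
  unfolding split_bound_def using assms by (intro exI[of _ u] exI[of _ "\<lambda>_ _. 0"]) auto

lemma column_bound_split_bound:
  assumes y: "\<And>j. j < m \<Longrightarrow> y j \<in> S"
  shows "column_bound sc S (split_bound m y \<kappa> \<delta>)"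
proof
  show "subspace S" by (rule subspace_S)
  show "\<exists>r. split_bound m y \<kappa> \<delta> 1 (\<lambda>_. u) r" if "u \<in> S" for u
    using split_bound_trivial[of 1 "\<lambda>_. u"] that by blast
next
  fix n u v r
  assume "split_bound m y \<kappa> \<delta> n u r" and uv: "\<And>i. i < n \<Longrightarrow> u i = v i"
  then obtain w a where "\<forall>i<n. w i \<in> S \<and> u i = w i + (\<Sum>j<m. a i j *s y j)"
    and "(\<kappa> * c n w)\<^sup>2 + \<delta>\<^sup>2 * (\<Sum>i<n. \<Sum>j<m. (cmod (a i j))\<^sup>2) \<le> r"
    unfolding split_bound_def by (elim exE conjE)
  then show "split_bound m y \<kappa> \<delta> n v r"
    unfolding split_bound_def using uv by (intro exI[of _ w] exI[of _ a]) simp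
next
  fix p n A u r
  assume A: "contr p n A" and "split_bound m y \<kappa> \<delta> n u r"
  then obtain v a where vu: "\<forall>i<n. v i \<in> S \<and> u i = v i + (\<Sum>j<m. a i j *s y j)"
    and r: "(\<kappa> * c n v)\<^sup>2 + \<delta>\<^sup>2 * (\<Sum>i<n. \<Sum>j<m. (cmod (a i j))\<^sup>2) \<le> r"
    unfolding split_bound_def by (elim exE conjE)
  note v = vu[rule_format, THEN conjunct1] and u = vu[rule_format, THEN conjunct2]
  have Av: "(\<Sum>k<n. A i k *s v k) \<in> S" for i by (intro S_closed) (auto intro: v)
  have "(\<Sum>k<n. A i k *s u k) = (\<Sum>k<n. A i k *s v k) + (\<Sum>j<m. (\<Sum>k<n. A i k * a k j) *s y j)" for i
  proof -
    have "(\<Sum>k<n. A i k *s u k) = (\<Sum>k<n. A i k *s v k) + (\<Sum>k<n. \<Sum>j<m. (A i k * a k j) *s y j)"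
      by (simp add: u scale_right_distrib sum.distrib scale_sum_right)
    also have "(\<Sum>k<n. \<Sum>j<m. (A i k * a k j) *s y j) = (\<Sum>j<m. (\<Sum>k<n. A i k * a k j) *s y j)"
      by (subst sum.swap) (simp add: scale_sum_left)
    finally show ?thesis .
  qed
  moreover have "(\<kappa> * c p (\<lambda>i. \<Sum>k<n. A i k *s v k))\<^sup>2 \<le> (\<kappa> * c n v)\<^sup>2"
    unfolding power_mult_distrib
    by (intro mult_left_mono power_mono c_contr[OF A] c_nonneg Av) (auto intro: v)
  moreover have "(\<Sum>i<p. \<Sum>j<m. (cmod (\<Sum>k<n. A i k * a k j))\<^sup>2) \<le> (\<Sum>i<n. \<Sum>j<m. (cmod (a i j))\<^sup>2)"
    by (subst (1 2) sum.swap) (intro sum_mono A[unfolded contr_def, rule_format])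
  ultimately show "split_bound m y \<kappa> \<delta> p (\<lambda>i. \<Sum>k<n. A i k *s u k) r"
    unfolding split_bound_def using r Av
    by (intro exI[of _ "\<lambda>i. \<Sum>k<n. A i k *s v k"] exI[of _ "\<lambda>i j. \<Sum>k<n. A i k * a k j"])
      (auto intro: order_trans[OF add_mono[OF _ mult_left_mono]])
next
  fix n u r b
  assume "split_bound m y \<kappa> \<delta> n u r"
  then obtain v a where vu: "\<forall>i<n. v i \<in> S \<and> u i = v i + (\<Sum>j<m. a i j *s y j)"
    and r: "(\<kappa> * c n v)\<^sup>2 + \<delta>\<^sup>2 * (\<Sum>i<n. \<Sum>j<m. (cmod (a i j))\<^sup>2) \<le> r"
    unfolding split_bound_def by (elim exE conjE)
  note v = vu[rule_format, THEN conjunct1] and u = vu[rule_format, THEN conjunct2]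
  have "(\<kappa> * c n (\<lambda>i. b *s v i))\<^sup>2 + \<delta>\<^sup>2 * (\<Sum>i<n. \<Sum>j<m. (cmod (b * a i j))\<^sup>2)
      = (cmod b)\<^sup>2 * ((\<kappa> * c n v)\<^sup>2 + \<delta>\<^sup>2 * (\<Sum>i<n. \<Sum>j<m. (cmod (a i j))\<^sup>2))"
    by (simp add: c_scale v norm_mult power_mult_distrib algebra_simps flip: sum_distrib_left)
  also have "\<dots> \<le> (cmod b)\<^sup>2 * r" using r by (intro mult_left_mono) auto
  finally show "split_bound m y \<kappa> \<delta> n (\<lambda>i. b *s u i) ((cmod b)\<^sup>2 * r)"
    unfolding split_bound_def
    by (intro exI[of _ "\<lambda>i. b *s v i"] exI[of _ "\<lambda>i j. b * a i j"])
      (auto simp: u v scale_right_distrib scale_sum_right intro: S_closed)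
next
  fix n u p u' r r'
  assume "split_bound m y \<kappa> \<delta> n u r" "split_bound m y \<kappa> \<delta> p u' r'"
  then obtain v a v' a' where vu: "\<forall>i<n. v i \<in> S \<and> u i = v i + (\<Sum>j<m. a i j *s y j)"
    and r: "(\<kappa> * c n v)\<^sup>2 + \<delta>\<^sup>2 * (\<Sum>i<n. \<Sum>j<m. (cmod (a i j))\<^sup>2) \<le> r"
    and vu': "\<forall>i<p. v' i \<in> S \<and> u' i = v' i + (\<Sum>j<m. a' i j *s y j)"
    and r': "(\<kappa> * c p v')\<^sup>2 + \<delta>\<^sup>2 * (\<Sum>i<p. \<Sum>j<m. (cmod (a' i j))\<^sup>2) \<le> r'"
    unfolding split_bound_def by (elim exE conjE)
  note v = vu[rule_format, THEN conjunct1] and u = vu[rule_format, THEN conjunct2]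
  note v' = vu'[rule_format, THEN conjunct1] and u' = vu'[rule_format, THEN conjunct2]
  have "(\<kappa> * c (n + p) (stack n v v'))\<^sup>2 \<le> \<kappa>\<^sup>2 * ((c n v)\<^sup>2 + (c p v')\<^sup>2)"
    unfolding power_mult_distrib by (intro mult_left_mono c_stack v v') auto
  then have "(\<kappa> * c (n + p) (stack n v v'))\<^sup>2
      + \<delta>\<^sup>2 * (\<Sum>i<n + p. \<Sum>j<m. (cmod (stack n a a' i j))\<^sup>2) \<le> r + r'"
    using r r' unfolding sum_lessThan_add stack_add
    by (simp add: power_mult_distrib) (simp add: algebra_simps)
  then show "split_bound m y \<kappa> \<delta> (n + p) (stack n u u') (r + r')"
    unfolding split_bound_def
    by (intro exI[of _ "stack n v v'"] exI[of _ "stack n a a'"])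
      (auto simp: stack_def u u' v v')
qed

text \<open>
  The column inequality says that \<open>T\<close>, as a map into column space, has completely bounded norm
  at most \<open>\<kappa>\<close>.
\<close>

definition admissible :: "'y set \<Rightarrow> ('y \<Rightarrow> hilb) \<Rightarrow> real \<Rightarrow> bool" where
  "admissible X T \<kappa> \<longleftrightarrow> (\<forall>x\<in>X. \<forall>y\<in>X. T (x + y) = T x + T y) \<and> (\<forall>a. \<forall>x\<in>X. T (a *s x) = a *\<^sub>C T x) \<and>
     (\<forall>n u. (\<forall>i<n. u i \<in> X) \<longrightarrow> (\<Sum>i<n. (norm (T (u i)))\<^sup>2) \<le> (\<kappa> * c n u)\<^sup>2)"

lemma admissible_bound:
  "admissible X T \<kappa> \<Longrightarrow> (\<And>i. i < n \<Longrightarrow> u i \<in> X) \<Longrightarrow> (\<Sum>i<n. (norm (T (u i)))\<^sup>2) \<le> (\<kappa> * c n u)\<^sup>2"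
  and admissible_add: "admissible X T \<kappa> \<Longrightarrow> x \<in> X \<Longrightarrow> y \<in> X \<Longrightarrow> T (x + y) = T x + T y"
  and admissible_scale: "admissible X T \<kappa> \<Longrightarrow> x \<in> X \<Longrightarrow> T (a *s x) = a *\<^sub>C T x"
  unfolding admissible_def by blast+

lemma admissible_norm_le:
  assumes "admissible X T \<kappa>" "\<kappa> \<ge> 0" "x \<in> X" "X \<subseteq> S"
  shows "norm (T x) \<le> \<kappa> * c 1 (\<lambda>_. x)"
proof -
  have "(norm (T x))\<^sup>2 \<le> (\<kappa> * c 1 (\<lambda>_. x))\<^sup>2"
    using admissible_bound[OF assms(1), of 1 "\<lambda>_. x"] assms(3) by simp
  moreover have "0 \<le> \<kappa> * c 1 (\<lambda>_. x)"
    using assms by (intro mult_nonneg_nonneg c_nonneg) auto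
  ultimately show ?thesis by (rule power2_le_imp_le)
qed

lemma admissible_sum:
  assumes "admissible X T \<kappa>" "subspace X" "\<And>i. i \<in> I \<Longrightarrow> x i \<in> X"
  shows "T (\<Sum>i\<in>I. a i *s x i) = (\<Sum>i\<in>I. a i *\<^sub>C T (x i))"
proof -
  have T0: "T 0 = 0" using admissible_scale[OF assms(1) subspace_0[OF assms(2)], of 0] by simp
  show ?thesis
    using assms(3)
    by (induction I rule: infinite_finite_induct)
      (simp_all add: T0 admissible_add[OF assms(1)] admissible_scale[OF assms(1)]
        subspace_sum[OF assms(2)] subspace_scale[OF assms(2)])
qed

lemma extension_of_split_bound:
  assumes X: "subspace X" "X \<subseteq> S" and T: "admissible X T \<kappa>0"
    and y: "\<And>j. j < m \<Longrightarrow> y j \<in> S" and "\<delta> \<ge> 0"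
    and dom: "\<And>n u r. (\<And>i. i < n \<Longrightarrow> u i \<in> X) \<Longrightarrow> split_bound m y \<kappa> \<delta> n u r \<Longrightarrow>
      (\<Sum>i<n. (norm (T (u i)))\<^sup>2) \<le> r"
  shows "\<exists>T'. (\<forall>x\<in>X. T' x = T x) \<and> admissible S T' \<kappa> \<and> (\<forall>j<m. norm (T' (y j)) \<le> \<delta>)"
proof -
  interpret B: column_bound sc S "split_bound m y \<kappa> \<delta>"
    by (rule column_bound_split_bound[OF y])
  show ?thesis
  proof (rule B.column_extension[OF X, of T])
    show "T (x + x') = T x + T x'" if "x \<in> X" "x' \<in> X" for x x'
      using that by (rule admissible_add[OF T])
    show "T (a *s x) = a *\<^sub>C T x" if "x \<in> X" for a x
      using that by (rule admissible_scale[OF T])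
    show "(\<Sum>i<n. (norm (T (u i)))\<^sup>2) \<le> r" if "\<And>i. i < n \<Longrightarrow> u i \<in> X" "split_bound m y \<kappa> \<delta> n u r" for n u r
      using that by (rule dom)
    fix T' assume T': "\<And>x. x \<in> X \<Longrightarrow> T' x = T x"
      "\<And>x y. x \<in> S \<Longrightarrow> y \<in> S \<Longrightarrow> T' (x + y) = T' x + T' y"
      "\<And>c x. x \<in> S \<Longrightarrow> T' (c *s x) = c *\<^sub>C T' x"
      "\<And>n u r. (\<And>i. i < n \<Longrightarrow> u i \<in> S) \<Longrightarrow> split_bound m y \<kappa> \<delta> n u r \<Longrightarrow> (\<Sum>i<n. (norm (T' (u i)))\<^sup>2) \<le> r"
    have "norm (T' (y j)) \<le> \<delta>" if j: "j < m" for j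
    proof -
      have z: "0 \<in> S" by (rule subspace_0[OF subspace_S])
      have "c 1 (\<lambda>_. 0 *s 0) = 0" using c_scale[of 1 "\<lambda>_. 0" 0] z by simp
      then have "split_bound m y \<kappa> \<delta> 1 (\<lambda>_. y j) (\<delta>\<^sup>2)"
        unfolding split_bound_def using z j
        by (intro exI[of _ "\<lambda>_. 0"] exI[of _ "\<lambda>_ k. if k = j then 1 else 0"])
          (auto simp: if_distrib[of cmod] if_distrib[of "\<lambda>x. x\<^sup>2"] if_distrib[of "\<lambda>x. x *s _"] cong: if_cong)
      then have "(norm (T' (y j)))\<^sup>2 \<le> \<delta>\<^sup>2" using T'(4)[of 1 "\<lambda>_. y j"] y[OF j] by simp
      then show ?thesis using \<open>\<delta> \<ge> 0\<close> by (rule power2_le_imp_le)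
    qed
    moreover have bd: "(\<Sum>i<n. (norm (T' (u i)))\<^sup>2) \<le> (\<kappa> * c n u)\<^sup>2" if "\<And>i. i < n \<Longrightarrow> u i \<in> S" for n u
      using that by (intro T'(4) split_bound_trivial)
    have "admissible S T' \<kappa>"
      unfolding admissible_def
    proof (intro conjI ballI allI impI)
      show "(\<Sum>i<n. (norm (T' (u i)))\<^sup>2) \<le> (\<kappa> * c n u)\<^sup>2" if "\<forall>i<n. u i \<in> S" for n u
        using that by (intro bd) simp
    qed (rule T'(2,3), assumption+)+
    ultimately show ?thesis using T'(1) by blast
  qed
qed

end

context column_norm
begin

lemma near_best_approximation:
  assumes X: "subspace X" "X \<subseteq> S" and z: "\<And>i. i < n \<Longrightarrow> z i \<in> S" and "\<tau> > 0"
  shows "\<exists>x. (\<forall>i<n. x i \<in> X) \<and>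
    (\<forall>x'. (\<forall>i<n. x' i \<in> X) \<longrightarrow> c n (\<lambda>i. x i - z i) \<le> c n (\<lambda>i. x' i - z i) + \<tau>)"
proof -
  define C where "C = {c n (\<lambda>i. x i - z i) | x. \<forall>i<n. x i \<in> X}"
  have C_I: "c n (\<lambda>i. x i - z i) \<in> C" if "\<forall>i<n. x i \<in> X" for x
    unfolding C_def mem_Collect_eq by (intro exI[of _ x] conjI refl that)
  have ne: "C \<noteq> {}" using C_I[of "\<lambda>_. 0"] subspace_0[OF X(1)] by auto
  have bdd: "bdd_below C"
  proof (rule bdd_belowI[of _ 0])
    fix r assume "r \<in> C"
    then obtain x where x: "\<forall>i<n. x i \<in> X" and r: "r = c n (\<lambda>i. x i - z i)"
      unfolding C_def mem_Collect_eq by (elim exE conjE)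
    have "0 \<le> c n (\<lambda>i. x i - z i)" using x X(2) z by (intro c_nonneg S_closed) auto
    then show "0 \<le> r" by (simp add: r)
  qed
  have "Inf C < Inf C + \<tau>" using \<open>\<tau> > 0\<close> by simp
  from cInf_lessD[OF ne this] obtain r where "r \<in> C" "r < Inf C + \<tau>" by blast
  from \<open>r \<in> C\<close> obtain x where x: "r = c n (\<lambda>i. x i - z i)" "\<forall>i<n. x i \<in> X"
    unfolding C_def mem_Collect_eq by (elim exE conjE)
  have "c n (\<lambda>i. x i - z i) \<le> c n (\<lambda>i. x' i - z i) + \<tau>" if "\<forall>i<n. x' i \<in> X" for x'
    using cInf_lower[OF C_I[OF that] bdd] \<open>r < Inf C + \<tau>\<close> x(1) by linarith
  with x(2) show ?thesis by (intro exI[of _ x]) simp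
qed

lemma sqrt_sum_triangle:
  fixes f g :: "nat \<Rightarrow> hilb"
  assumes "(\<Sum>i<n. (norm (f i))\<^sup>2) \<le> p\<^sup>2" "(\<Sum>i<n. (norm (g i))\<^sup>2) \<le> q\<^sup>2" "p \<ge> 0" "q \<ge> 0"
  shows "(\<Sum>i<n. (norm (f i + g i))\<^sup>2) \<le> (p + q)\<^sup>2"
proof -
  have "L2_set (\<lambda>i. norm (f i + g i)) {..<n} \<le> L2_set (\<lambda>i. norm (f i) + norm (g i)) {..<n}"
    by (intro L2_set_mono norm_triangle_ineq) auto
  also have "\<dots> \<le> L2_set (\<lambda>i. norm (f i)) {..<n} + L2_set (\<lambda>i. norm (g i)) {..<n}"
    by (rule L2_set_triangle_ineq)
  also have "\<dots> \<le> p + q"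
    using assms unfolding L2_set_def by (intro add_mono real_le_lsqrt) (auto intro: sum_nonneg)
  finally have "(L2_set (\<lambda>i. norm (f i + g i)) {..<n})\<^sup>2 \<le> (p + q)\<^sup>2"
    by (intro power_mono) auto
  then show ?thesis by (simp add: L2_set_def sum_nonneg)
qed

text \<open>
  The price for adding squares in the mixed norm; here the \<open>\<epsilon>\<close> of the theorem is used.
\<close>

lemma perturbation_estimate:
  fixes \<epsilon> \<tau> t :: real
  assumes "\<epsilon> > 0"
  shows "(2 * t + 4 * \<tau>)\<^sup>2 \<le> ((2 + \<epsilon>) * t)\<^sup>2 + 16 * \<tau>\<^sup>2 * (1 + 1 / \<epsilon>)"
proof -
  have "0 \<le> (4 / \<epsilon>) * (\<epsilon> * t - 2 * \<tau>)\<^sup>2" using assms by simp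
  also have "\<dots> = 4 * \<epsilon> * t\<^sup>2 - 16 * t * \<tau> + 16 * \<tau>\<^sup>2 / \<epsilon>"
    using assms by (simp add: power2_eq_square field_simps)
  finally have "16 * t * \<tau> \<le> 4 * \<epsilon> * t\<^sup>2 + 16 * \<tau>\<^sup>2 / \<epsilon>" by simp
  moreover have "((2 + \<epsilon>) * t)\<^sup>2 = 4 * t\<^sup>2 + 4 * \<epsilon> * t\<^sup>2 + (\<epsilon> * t)\<^sup>2"
    by (simp add: power2_eq_square algebra_simps)
  moreover have "(2 * t + 4 * \<tau>)\<^sup>2 = 4 * t\<^sup>2 + 16 * t * \<tau> + 16 * \<tau>\<^sup>2"
    by (simp add: power2_eq_square algebra_simps)
  moreover have "16 * \<tau>\<^sup>2 * (1 + 1 / \<epsilon>) = 16 * \<tau>\<^sup>2 + 16 * \<tau>\<^sup>2 / \<epsilon>"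
    by (simp add: distrib_left)
  moreover have "0 \<le> (\<epsilon> * t)\<^sup>2" by simp
  ultimately show ?thesis by linarith
qed

text \<open>
  The source of the constant 2. Let \<open>u = v + a y\<close> be a column over \<open>X\<close>, with \<open>a\<close> of Euclidean norm
  1. Then \<open>a y\<close> has distance at most \<open>\<parallel>v\<parallel>\<close> from the columns over \<open>X\<close>. Choose a column \<open>z\<close> over
  \<open>X\<close> for which this distance is almost attained; then \<open>\<parallel>u - z\<parallel> \<le> \<parallel>v\<parallel> + \<parallel>a y - z\<parallel>\<close>, which is
  almost at most \<open>2 \<parallel>v\<parallel>\<close>, so that \<open>T u = T (u - z) + T z\<close> is almost at most \<open>2 \<parallel>v\<parallel>\<close> as soon as \<open>T z\<close>
  is small. By the Gram-Schmidt reduction and total boundedness, the columns \<open>z\<close> may be chosen of the form \<open>W x\<close>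
  with a contraction \<open>W\<close> and \<open>x\<close> from a finite set that does not depend on \<open>T\<close>; its entries
  form the set \<open>F\<close>.
\<close>

lemma split_bound_dominates:
  assumes X: "subspace X" "X \<subseteq> S" and y: "\<And>j. j < m \<Longrightarrow> y j \<in> S"
    and pos: "\<epsilon> > 0" "\<delta> > 0"
  shows "\<exists>F \<eta>. finite F \<and> F \<subseteq> X \<and> \<eta> > 0 \<and>
    (\<forall>T. admissible X T 1 \<longrightarrow> (\<forall>x\<in>F. norm (T x) \<le> \<eta>) \<longrightarrow>
      (\<forall>n u r. (\<forall>i<n. u i \<in> X) \<longrightarrow> split_bound m y (2 + \<epsilon>) \<delta> n u r \<longrightarrow>
        (\<Sum>i<n. (norm (T (u i)))\<^sup>2) \<le> r))"
proof -
  define \<tau> where "\<tau> = \<delta> / (4 * sqrt (1 + 1 / \<epsilon>))"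
  have \<tau>: "\<tau> > 0" using pos unfolding \<tau>_def by (intro divide_pos_pos mult_pos_pos) (auto intro: add_pos_pos)
  have \<tau>\<delta>: "16 * \<tau>\<^sup>2 * (1 + 1 / \<epsilon>) = \<delta>\<^sup>2"
  proof -
    have "16 * (\<delta> / (4 * sqrt g))\<^sup>2 * g = \<delta>\<^sup>2" if "g > 0" for g
      using that by (simp add: power_divide power_mult_distrib)
    from this[of "1 + 1 / \<epsilon>"] pos show ?thesis unfolding \<tau>_def by (simp add: add_pos_pos)
  qed
  define Q where "Q = real m * (\<Sum>j<m. c 1 (\<lambda>_. y j))"
  have Q0: "Q \<ge> 0" unfolding Q_def by (intro mult_nonneg_nonneg sum_nonneg c_nonneg) (auto intro: y)
  define \<theta> where "\<theta> = \<tau> / (Q + 1)"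
  have \<theta>: "\<theta> > 0" "\<theta> * Q \<le> \<tau>" using Q0 \<tau> by (auto simp: \<theta>_def field_simps)
  from unit_matrix_net[OF \<theta>(1), of m] obtain N where N: "finite N"
    "\<forall>a. (\<forall>i<m. \<forall>j<m. cmod (a i j) \<le> 1) \<longrightarrow> (\<exists>b\<in>N. \<forall>i<m. \<forall>j<m. cmod (a i j - b i j) \<le> \<theta>)"
    by (elim exE conjE)
  define comb where "comb b i = (\<Sum>j<m. b i j *s y j)" for b :: "nat \<Rightarrow> nat \<Rightarrow> complex" and i :: nat
  have comb_S: "comb b i \<in> S" for b i unfolding comb_def by (intro S_closed) (auto intro: y)
  have "\<forall>b. \<exists>x. (\<forall>i<m. x i \<in> X) \<and>
      (\<forall>x'. (\<forall>i<m. x' i \<in> X) \<longrightarrow> c m (\<lambda>i. x i - comb b i) \<le> c m (\<lambda>i. x' i - comb b i) + \<tau>)"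
    by (intro allI near_best_approximation X comb_S \<tau>)
  from choice[OF this] obtain best where best_X: "\<And>b i. i < m \<Longrightarrow> best b i \<in> X"
    and best: "\<And>b x'. (\<forall>i<m. x' i \<in> X) \<Longrightarrow> c m (\<lambda>i. best b i - comb b i) \<le> c m (\<lambda>i. x' i - comb b i) + \<tau>"
    by metis
  define F where "F = (\<Union>b\<in>N. best b ` {..<m})"
  define \<eta> where "\<eta> = \<tau> / (real m + 1)"
  have \<eta>: "\<eta> > 0" "real m * \<eta> \<le> \<tau>" using \<tau> by (auto simp: \<eta>_def field_simps)
  have normalized: "(\<Sum>i<n. (norm (T (u i)))\<^sup>2) \<le> ((2 + \<epsilon>) * c n v)\<^sup>2 + \<delta>\<^sup>2"
    if T: "admissible X T 1" and small: "\<forall>x\<in>F. norm (T x) \<le> \<eta>"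
      and uX: "\<And>i. i < n \<Longrightarrow> u i \<in> X" and vS: "\<And>i. i < n \<Longrightarrow> v i \<in> S"
      and uv: "\<And>i. i < n \<Longrightarrow> u i = v i + (\<Sum>j<m. a i j *s y j)"
      and a1: "(\<Sum>i<n. \<Sum>j<m. (cmod (a i j))\<^sup>2) = 1" for T n u v a
  proof -
    from orthonormal_span[of n m a] obtain W where W: "contr n m W"
      and Wa: "\<forall>j<m. \<forall>i<n. (\<Sum>k<m. W i k * (\<Sum>l<n. cnj (W l k) * a l j)) = a i j"
      by (elim exE conjE)
    have Wadj: "contr m n (\<lambda>k l. cnj (W l k))" by (rule contr_adjoint[OF W])
    define a' where "a' k j = (\<Sum>l<n. cnj (W l k) * a l j)" for k j
    have "cmod (a' k j) \<le> 1" if k: "k < m" and j: "j < m" for k j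
    proof -
      have "(cmod (a' k j))\<^sup>2 \<le> (\<Sum>k<m. (cmod (a' k j))\<^sup>2)"
        using k by (intro member_le_sum) auto
      also have "\<dots> \<le> (\<Sum>l<n. (cmod (a l j))\<^sup>2)"
        unfolding a'_def by (rule Wadj[unfolded contr_def, rule_format])
      also have "\<dots> \<le> (\<Sum>j<m. \<Sum>l<n. (cmod (a l j))\<^sup>2)"
        using j by (intro member_le_sum[of j "{..<m}" "\<lambda>j. \<Sum>l<n. (cmod (a l j))\<^sup>2"]) (auto intro: sum_nonneg)
      also have "\<dots> = 1" using a1 by (subst sum.swap)
      finally show ?thesis by (simp add: power_le_one_iff)
    qed
    then obtain b where b: "b \<in> N" "\<forall>i<m. \<forall>j<m. cmod (a' i j - b i j) \<le> \<theta>"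
      using N(2)[rule_format, of a'] by blast
    \<comment> \<open>\<open>ud\<close>, \<open>vd\<close> and \<open>a'\<close> are the images of \<open>u\<close>, \<open>v\<close> and \<open>a\<close> under the adjoint of \<open>W\<close>;
      \<open>b\<close> is the point of the net next to \<open>a'\<close>, and \<open>e\<close> the resulting error\<close>
    define ud where "ud k = (\<Sum>l<n. cnj (W l k) *s u l)" for k
    define vd where "vd k = (\<Sum>l<n. cnj (W l k) *s v l)" for k
    define e where "e k = (\<Sum>j<m. (a' k j - b k j) *s y j)" for k
    define z where "z i = (\<Sum>k<m. W i k *s best b k)" for i
    have udX: "ud k \<in> X" for k
      unfolding ud_def by (intro subspace_sum subspace_scale X(1)) (auto intro: uX)
    have vdS: "vd k \<in> S" for k unfolding vd_def by (intro S_closed) (auto intro: vS)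
    have eS: "e k \<in> S" for k unfolding e_def by (intro S_closed) (auto intro: y)
    have bestS: "best b k \<in> S" if "k < m" for k using best_X[OF that] X(2) by blast
    have zX: "z i \<in> X" for i
      unfolding z_def by (intro subspace_sum subspace_scale X(1)) (auto intro: best_X)
    have comb_a': "comb a' k = comb b k + e k" for k
      by (simp add: comb_def e_def scale_left_diff_distrib sum_subtractf)
    have ud: "ud k = vd k + comb a' k" for k
    proof -
      have "ud k = vd k + (\<Sum>l<n. \<Sum>j<m. (cnj (W l k) * a l j) *s y j)"
        by (simp add: ud_def vd_def uv scale_right_distrib sum.distrib scale_sum_right)
      also have "(\<Sum>l<n. \<Sum>j<m. (cnj (W l k) * a l j) *s y j) = comb a' k"
        unfolding comb_def a'_def by (subst sum.swap) (simp add: scale_sum_left)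
      finally show ?thesis .
    qed
    have ay: "(\<Sum>j<m. a i j *s y j) = (\<Sum>k<m. W i k *s comb a' k)" if i: "i < n" for i
    proof -
      have "(\<Sum>k<m. W i k *s comb a' k) = (\<Sum>j<m. (\<Sum>k<m. W i k * a' k j) *s y j)"
        unfolding comb_def scale_sum_right scale_sum_left by (subst sum.swap) simp
      also have "\<dots> = (\<Sum>j<m. a i j *s y j)"
        using Wa i by (intro sum.cong) (auto simp: a'_def)
      finally show ?thesis by simp
    qed
    have e_small: "c m e \<le> \<tau>"
    proof -
      have "c m e \<le> real m * \<theta> * (\<Sum>j<m. c 1 (\<lambda>_. y j))"
        unfolding e_def using b(2) by (intro c_small_combination y) auto
      also have "\<dots> = \<theta> * Q" by (simp add: Q_def)
      finally show ?thesis using \<theta>(2) by simp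
    qed
    have "c m (\<lambda>k. best b k - comb b k) \<le> c m (\<lambda>k. ud k - comb b k) + \<tau>"
      by (rule best) (simp add: udX)
    also have "(\<lambda>k. ud k - comb b k) = (\<lambda>k. vd k + e k)"
      by (simp add: ud comb_a' fun_eq_iff)
    also have "c m (\<lambda>k. vd k + e k) \<le> c m vd + c m e"
      by (intro c_add vdS eS)
    also have "c m vd \<le> c n v"
      unfolding vd_def by (rule c_contr[OF Wadj]) (rule vS)
    finally have best_est: "c m (\<lambda>k. best b k - comb b k) \<le> c n v + 2 * \<tau>"
      using e_small by linarith
    have "c m (\<lambda>k. comb a' k - best b k) = c m (\<lambda>k. (comb b k - best b k) + e k)"
      by (rule c_cong) (simp add: comb_a')
    also have "\<dots> \<le> c m (\<lambda>k. comb b k - best b k) + c m e"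
      by (intro c_add S_closed comb_S bestS eS)
    also have "c m (\<lambda>k. comb b k - best b k) = c m (\<lambda>k. best b k - comb b k)"
      by (intro c_minus_commute comb_S bestS)
    finally have diff_est: "c m (\<lambda>k. comb a' k - best b k) \<le> c n v + 3 * \<tau>"
      using best_est e_small by linarith
    have "c n (\<lambda>i. u i - z i) = c n (\<lambda>i. v i + (\<Sum>k<m. W i k *s (comb a' k - best b k)))"
      by (rule c_cong) (simp add: uv ay z_def scale_right_diff_distrib sum_subtractf)
    also have "\<dots> \<le> c n v + c n (\<lambda>i. \<Sum>k<m. W i k *s (comb a' k - best b k))"
      by (intro c_add vS S_closed) (auto intro: comb_S bestS)
    also have "c n (\<lambda>i. \<Sum>k<m. W i k *s (comb a' k - best b k)) \<le> c m (\<lambda>k. comb a' k - best b k)"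
      by (rule c_contr[OF W]) (intro S_closed comb_S bestS)
    finally have uz: "c n (\<lambda>i. u i - z i) \<le> 2 * c n v + 3 * \<tau>"
      using diff_est by linarith
    have c0: "c n v \<ge> 0" "c n (\<lambda>i. u i - z i) \<ge> 0"
      using uX zX X(2) by (auto intro!: c_nonneg vS S_closed)
    have uzX: "u i - z i \<in> X" if "i < n" for i
      using uX[OF that] zX X(1) by (intro subspace_diff)
    have "(\<Sum>i<n. (norm (T (u i - z i)))\<^sup>2) \<le> (1 * c n (\<lambda>i. u i - z i))\<^sup>2"
      by (rule admissible_bound[OF T]) (rule uzX)
    also have "\<dots> \<le> (2 * c n v + 3 * \<tau>)\<^sup>2"
      using uz c0 by (intro power_mono) auto
    finally have part1: "(\<Sum>i<n. (norm (T (u i - z i)))\<^sup>2) \<le> (2 * c n v + 3 * \<tau>)\<^sup>2" .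
    have "(\<Sum>i<n. (norm (T (z i)))\<^sup>2) = (\<Sum>i<n. (norm (\<Sum>k<m. W i k *\<^sub>C T (best b k)))\<^sup>2)"
      unfolding z_def by (intro sum.cong refl arg_cong[of _ _ "\<lambda>h. (norm h)\<^sup>2"] admissible_sum[OF T X(1)] best_X) simp
    also have "\<dots> \<le> (\<Sum>k<m. (norm (T (best b k)))\<^sup>2)" by (rule contr_hilb[OF W])
    also have "\<dots> \<le> (L2_set (\<lambda>k. norm (T (best b k))) {..<m})\<^sup>2"
      by (simp add: L2_set_def sum_nonneg)
    also have "\<dots> \<le> \<tau>\<^sup>2"
    proof (rule power_mono)
      have "L2_set (\<lambda>k. norm (T (best b k))) {..<m} \<le> (\<Sum>k<m. norm (T (best b k)))"
        by (rule L2_set_le_sum) simp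
      also have "\<dots> \<le> (\<Sum>k<m. \<eta>)"
        using small b(1) unfolding F_def by (intro sum_mono) auto
      also have "\<dots> \<le> \<tau>" using \<eta>(2) by simp
      finally show "L2_set (\<lambda>k. norm (T (best b k))) {..<m} \<le> \<tau>" .
    qed simp
    finally have part2: "(\<Sum>i<n. (norm (T (z i)))\<^sup>2) \<le> \<tau>\<^sup>2" .
    have "(\<Sum>i<n. (norm (T (u i)))\<^sup>2) = (\<Sum>i<n. (norm (T (u i - z i) + T (z i)))\<^sup>2)"
      by (intro sum.cong refl) (simp add: zX uzX flip: admissible_add[OF T])
    also have "\<dots> \<le> (2 * c n v + 3 * \<tau> + \<tau>)\<^sup>2"
      using c0 \<tau> by (intro sqrt_sum_triangle part1 part2) auto
    also have "2 * c n v + 3 * \<tau> + \<tau> = 2 * c n v + 4 * \<tau>" by simp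
    also have "(2 * c n v + 4 * \<tau>)\<^sup>2 \<le> ((2 + \<epsilon>) * c n v)\<^sup>2 + \<delta>\<^sup>2"
      using perturbation_estimate[OF pos(1), of "c n v" \<tau>] unfolding \<tau>\<delta> .
    finally show ?thesis .
  qed
  have "(\<Sum>i<n. (norm (T (u i)))\<^sup>2) \<le> r"
    if T: "admissible X T 1" and small: "\<forall>x\<in>F. norm (T x) \<le> \<eta>" and uX: "\<forall>i<n. u i \<in> X"
      and sb: "split_bound m y (2 + \<epsilon>) \<delta> n u r" for T n u r
  proof -
    from sb obtain v a where vu: "\<forall>i<n. v i \<in> S \<and> u i = v i + (\<Sum>j<m. a i j *s y j)"
      and r: "((2 + \<epsilon>) * c n v)\<^sup>2 + \<delta>\<^sup>2 * (\<Sum>i<n. \<Sum>j<m. (cmod (a i j))\<^sup>2) \<le> r"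
      unfolding split_bound_def by (elim exE conjE)
    note v = vu[rule_format, THEN conjunct1] and u = vu[rule_format, THEN conjunct2]
    define q where "q = (\<Sum>i<n. \<Sum>j<m. (cmod (a i j))\<^sup>2)"
    have q0: "q \<ge> 0" unfolding q_def by (intro sum_nonneg) auto
    show ?thesis
    proof (cases "q = 0")
      case True
      have "a i j = 0" if "i < n" "j < m" for i j
      proof -
        have "(\<Sum>j<m. (cmod (a i j))\<^sup>2) = 0"
          using True that unfolding q_def by (subst (asm) sum_nonneg_eq_0_iff) (auto intro: sum_nonneg)
        then show ?thesis using that by (subst (asm) sum_nonneg_eq_0_iff) auto
      qed
      then have uv: "u i = v i" if "i < n" for i using that by (simp add: u)
      have "(\<Sum>i<n. (norm (T (u i)))\<^sup>2) \<le> (1 * c n u)\<^sup>2"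
        using uX by (intro admissible_bound[OF T]) auto
      also have "c n u = c n v" by (rule c_cong) (rule uv)
      also have "(1 * c n v)\<^sup>2 \<le> ((2 + \<epsilon>) * c n v)\<^sup>2"
        using pos by (intro power_mono mult_right_mono mult_nonneg_nonneg c_nonneg v) auto
      finally show ?thesis using r True by (simp add: q_def)
    next
      case False
      define s where "s = complex_of_real (1 / sqrt q)"
      have s: "(cmod s)\<^sup>2 = 1 / q"
        using q0 by (simp add: s_def norm_divide power_divide)
      have "(\<Sum>i<n. (norm (T (s *s u i)))\<^sup>2) \<le> ((2 + \<epsilon>) * c n (\<lambda>i. s *s v i))\<^sup>2 + \<delta>\<^sup>2"
      proof (rule normalized[OF T small])
        show "s *s u i \<in> X" if "i < n" for i using uX that by (intro subspace_scale X(1)) simp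
        show "s *s v i \<in> S" if "i < n" for i using v[OF that] by (intro S_closed)
        show "s *s u i = s *s v i + (\<Sum>j<m. (s * a i j) *s y j)" if "i < n" for i
          by (simp add: u[OF that] scale_right_distrib scale_sum_right)
        show "(\<Sum>i<n. \<Sum>j<m. (cmod (s * a i j))\<^sup>2) = 1"
          using False by (simp add: norm_mult power_mult_distrib s q_def flip: sum_divide_distrib)
      qed
      also have "c n (\<lambda>i. s *s v i) = cmod s * c n v" by (intro c_scale v)
      also have "((2 + \<epsilon>) * (cmod s * c n v))\<^sup>2 = ((2 + \<epsilon>) * c n v)\<^sup>2 / q"
        by (simp add: power_mult_distrib s)
      also have "(\<Sum>i<n. (norm (T (s *s u i)))\<^sup>2) = (\<Sum>i<n. (norm (T (u i)))\<^sup>2) / q"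
        using uX by (simp add: admissible_scale[OF T] power_mult_distrib s flip: sum_divide_distrib)
      finally have "(\<Sum>i<n. (norm (T (u i)))\<^sup>2) \<le> ((2 + \<epsilon>) * c n v)\<^sup>2 + \<delta>\<^sup>2 * q"
        using q0 False by (simp add: field_simps)
      then show ?thesis using r by (simp add: q_def)
    qed
  qed
  moreover have "finite F" unfolding F_def using N(1) by simp
  moreover have "F \<subseteq> X" unfolding F_def using best_X by auto
  ultimately show ?thesis using \<eta>(1) by (intro exI[of _ F] exI[of _ \<eta>]) simp
qed

text \<open>
  The operator version of Sobczyk's theorem, for a single column space. Along a dense sequence
  \<open>y\<close>, the maps \<open>T k\<close> are eventually small on each of the finite sets that control the first \<open>m\<close> members; so for
  large \<open>k\<close> they have extensions that are of size \<open>1 / (m + 1)\<close> there, and \<open>m\<close> may tend to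
  infinity slowly with \<open>k\<close>.
\<close>

theorem null_sequence_extension:
  fixes T :: "nat \<Rightarrow> 'y \<Rightarrow> hilb"
  assumes X: "subspace X" "X \<subseteq> S"
    and D: "countable D" "D \<subseteq> S" "\<And>u e. u \<in> S \<Longrightarrow> e > 0 \<Longrightarrow> \<exists>d\<in>D. c 1 (\<lambda>_. u - d) < e"
    and T: "\<And>k. admissible X (T k) 1" and T_null: "\<And>x. x \<in> X \<Longrightarrow> (\<lambda>k. T k x) \<longlonglongrightarrow> 0"
    and "\<epsilon> > 0"
  shows "\<exists>T'. (\<forall>k. \<forall>x\<in>X. T' k x = T k x) \<and> (\<forall>k. admissible S (T' k) (2 + \<epsilon>)) \<and>
    (\<forall>u\<in>S. (\<lambda>k. T' k u) \<longlonglongrightarrow> 0)"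
proof -
  define y where "y = from_nat_into (insert 0 D)"
  have range_y: "range y = insert 0 D"
    unfolding y_def by (rule range_from_nat_into) (use D(1) in auto)
  have y: "y j \<in> S" for j
    using range_y D(2) subspace_0[OF subspace_S] by (metis insertE rangeI subset_iff)
  define E where "E k m T' \<longleftrightarrow> (\<forall>x\<in>X. T' x = T k x) \<and> admissible S T' (2 + \<epsilon>) \<and>
      (\<forall>j<m. norm (T' (y j)) \<le> 1 / real (Suc m))" for k m T'
  have E0: "\<exists>T'. E k 0 T'" for k
  proof -
    have "\<exists>T'. (\<forall>x\<in>X. T' x = T k x) \<and> admissible S T' (2 + \<epsilon>) \<and> (\<forall>j<0. norm (T' (y j)) \<le> 0)"
    proof (rule extension_of_split_bound[OF X T])
      fix n u r assume u: "\<And>i. i < n \<Longrightarrow> u i \<in> X" and "split_bound 0 y (2 + \<epsilon>) 0 n u r"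
      then obtain v where v: "\<forall>i<n. v i \<in> S \<and> u i = v i" and r: "((2 + \<epsilon>) * c n v)\<^sup>2 \<le> r"
        unfolding split_bound_def by auto
      have "(\<Sum>i<n. (norm (T k (u i)))\<^sup>2) \<le> (1 * c n u)\<^sup>2"
        by (rule admissible_bound[OF T]) (rule u)
      also have "c n u = c n v" by (rule c_cong) (use v in simp)
      also have "(1 * c n v)\<^sup>2 \<le> ((2 + \<epsilon>) * c n v)\<^sup>2"
        using \<open>\<epsilon> > 0\<close> v by (intro power_mono mult_right_mono mult_nonneg_nonneg c_nonneg) auto
      finally show "(\<Sum>i<n. (norm (T k (u i)))\<^sup>2) \<le> r" using r by simp
    qed simp_all
    then show ?thesis unfolding E_def by simp
  qed
  have E_ev: "\<exists>K. \<forall>k\<ge>K. \<exists>T'. E k m T'" for m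
  proof -
    have "1 / real (Suc m) > 0" by simp
    from split_bound_dominates[of X m y, OF X y \<open>\<epsilon> > 0\<close> this] obtain F \<eta>
      where F: "finite F" "F \<subseteq> X" "\<eta> > 0" and dom: "\<forall>T. admissible X T 1 \<longrightarrow> (\<forall>x\<in>F. norm (T x) \<le> \<eta>) \<longrightarrow>
      (\<forall>n u r. (\<forall>i<n. u i \<in> X) \<longrightarrow> split_bound m y (2 + \<epsilon>) (1 / real (Suc m)) n u r \<longrightarrow>
        (\<Sum>i<n. (norm (T (u i)))\<^sup>2) \<le> r)"
      by (elim exE conjE)
    have "\<forall>\<^sub>F k in sequentially. \<forall>x\<in>F. norm (T k x) < \<eta>"
      using F(2,3) T_null by (intro eventually_ball_finite F(1)) (auto simp: tendsto_iff)
    then obtain K where K: "\<And>k x. k \<ge> K \<Longrightarrow> x \<in> F \<Longrightarrow> norm (T k x) < \<eta>"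
      unfolding eventually_sequentially by blast
    have "\<exists>T'. E k m T'" if "k \<ge> K" for k
    proof -
      have small: "\<forall>x\<in>F. norm (T k x) \<le> \<eta>" using K[OF that] by (auto intro: less_imp_le)
      show ?thesis
        unfolding E_def
      proof (rule extension_of_split_bound[OF X T y])
        fix n u r assume u: "\<And>i. i < n \<Longrightarrow> u i \<in> X" "split_bound m y (2 + \<epsilon>) (1 / real (Suc m)) n u r"
        then show "(\<Sum>i<n. (norm (T k (u i)))\<^sup>2) \<le> r"
          using dom[rule_format, OF T] small by blast
      qed simp
    qed
    then show ?thesis by blast
  qed
  define \<mu> where "\<mu> k = Max {m. m \<le> k \<and> (\<exists>T'. E k m T')}" for k
  have fin: "finite {m. m \<le> k \<and> (\<exists>T'. E k m T')}" for k by simp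
  have "\<mu> k \<in> {m. m \<le> k \<and> (\<exists>T'. E k m T')}" for k
    unfolding \<mu>_def using E0[of k] by (intro Max_in fin) blast
  then have "\<forall>k. \<exists>T'. E k (\<mu> k) T'" by blast
  from choice[OF this] obtain T' where T': "\<And>k. E k (\<mu> k) (T' k)" by blast
  have \<mu>_ge: "\<forall>\<^sub>F k in sequentially. \<mu> k \<ge> m" for m
  proof -
    obtain K where K: "\<forall>k\<ge>K. \<exists>T'. E k m T'" using E_ev[of m] by blast
    have "\<mu> k \<ge> m" if "k \<ge> max K m" for k
      unfolding \<mu>_def using K that by (intro Max_ge fin) simp
    then show ?thesis unfolding eventually_sequentially by blast
  qed
  have ext: "\<forall>x\<in>X. T' k x = T k x" and adm: "admissible S (T' k) (2 + \<epsilon>)"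
    and val: "\<And>j. j < \<mu> k \<Longrightarrow> norm (T' k (y j)) \<le> 1 / real (Suc (\<mu> k))" for k
    using T'[of k] unfolding E_def by auto
  have null: "(\<lambda>k. T' k u) \<longlonglongrightarrow> 0" if u: "u \<in> S" for u
    unfolding tendsto_iff
  proof (intro allI impI)
    fix e :: real assume e: "e > 0"
    have "e / 2 / (2 + \<epsilon>) > 0" using e \<open>\<epsilon> > 0\<close> by simp
    then obtain d where d: "d \<in> D" "c 1 (\<lambda>_. u - d) < e / 2 / (2 + \<epsilon>)" using D(3)[OF u] by blast
    have near: "(2 + \<epsilon>) * c 1 (\<lambda>_. u - d) < e / 2"
    proof -
      have "(2 + \<epsilon>) * c 1 (\<lambda>_. u - d) < (2 + \<epsilon>) * (e / 2 / (2 + \<epsilon>))"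
        using \<open>\<epsilon> > 0\<close> d(2) by (intro mult_strict_left_mono) auto
      moreover have "g * (e / 2 / g) = e / 2" if "g > 0" for g :: real using that by simp
      from this[of "2 + \<epsilon>"] have "(2 + \<epsilon>) * (e / 2 / (2 + \<epsilon>)) = e / 2"
        using \<open>\<epsilon> > 0\<close> by linarith
      ultimately show ?thesis by linarith
    qed
    have "d \<in> range y" unfolding range_y using d(1) by blast
    then obtain j where j: "d = y j" by blast
    obtain M where M: "1 / real (Suc M) < e / 2"
      using reals_Archimedean[of "e / 2"] e by (auto simp: inverse_eq_divide)
    from \<mu>_ge[of "max (Suc j) M"] show "\<forall>\<^sub>F k in sequentially. dist (T' k u) 0 < e"
    proof eventually_elim
      case (elim k)
      have dS: "d \<in> S" using d(1) D(2) by blast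
      have "norm (T' k (u - d)) \<le> (2 + \<epsilon>) * c 1 (\<lambda>_. u - d)"
        using u dS \<open>\<epsilon> > 0\<close> by (intro admissible_norm_le[OF adm] S_closed) auto
      moreover have "norm (T' k d) \<le> 1 / real (Suc (\<mu> k))"
        using elim unfolding j by (intro val) simp
      moreover have "1 / real (Suc (\<mu> k)) \<le> 1 / real (Suc M)"
        using elim by (intro divide_left_mono) auto
      moreover have "T' k u = T' k (u - d) + T' k d"
        using admissible_add[OF adm, of "u - d" d k] u dS by (simp add: S_closed)
      ultimately show ?case
        using norm_triangle_ineq[of "T' k (u - d)" "T' k d"] near M by simp
    qed
  qed
  show ?thesis using ext adm null by blast
qed

end

section \<open>Column and row norms of an operator space\<close>

lemma contr_id: "contr n n (\<lambda>i j. if i = j then 1 else 0)"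
  unfolding contr_def by (simp add: if_distrib[of "\<lambda>x. x * _"] cong: if_cong)

lemma contr_single_column:
  assumes "(\<Sum>i<m. (cmod (b i))\<^sup>2) \<le> 1"
  shows "contr m n (\<lambda>i j. if j = 0 then b i else 0)"
  unfolding contr_def
proof
  fix v :: "nat \<Rightarrow> complex"
  show "(\<Sum>i<m. (cmod (\<Sum>j<n. (if j = 0 then b i else 0) * v j))\<^sup>2) \<le> (\<Sum>j<n. (cmod (v j))\<^sup>2)"
  proof (cases n)
    case 0 then show ?thesis by simp
  next
    case (Suc k)
    have "(\<Sum>j<n. (if j = 0 then b i else 0) * v j) = b i * v 0" for i
      by (simp add: Suc if_distrib[of "\<lambda>x. x * _"] cong: if_cong)
    then have "(\<Sum>i<m. (cmod (\<Sum>j<n. (if j = 0 then b i else 0) * v j))\<^sup>2)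
        = (\<Sum>i<m. (cmod (b i))\<^sup>2) * (cmod (v 0))\<^sup>2"
      by (simp add: norm_mult power_mult_distrib sum_distrib_right)
    also have "\<dots> \<le> 1 * (cmod (v 0))\<^sup>2" using assms by (intro mult_right_mono) auto
    also have "\<dots> \<le> (\<Sum>j<n. (cmod (v j))\<^sup>2)"
      using member_le_sum[of 0 "{..<n}" "\<lambda>j. (cmod (v j))\<^sup>2"] Suc by simp
    finally show ?thesis .
  qed
qed

text \<open>
  Ruan's axioms for matrices given as functions are visibly invariant under transposition, which
  exchanges columns and rows.
\<close>

locale matrix_norm = vector_space sc
  for sc :: "complex \<Rightarrow> 'y::ab_group_add \<Rightarrow> 'y" (infixr \<open>*s\<close> 75) +
  fixes S :: "'y set" and N :: "nat \<Rightarrow> (nat \<Rightarrow> nat \<Rightarrow> 'y) \<Rightarrow> real"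
  assumes subspace_S: "subspace S"
    and N_nonneg: "(\<And>i j. i < n \<Longrightarrow> j < n \<Longrightarrow> f i j \<in> S) \<Longrightarrow> 0 \<le> N n f"
    and N_cong: "(\<And>i j. i < n \<Longrightarrow> j < n \<Longrightarrow> f i j = g i j) \<Longrightarrow> N n f = N n g"
    and N_scale: "(\<And>i j. i < n \<Longrightarrow> j < n \<Longrightarrow> f i j \<in> S) \<Longrightarrow> N n (\<lambda>i j. s *s f i j) = cmod s * N n f"
    and N_add: "(\<And>i j. i < n \<Longrightarrow> j < n \<Longrightarrow> f i j \<in> S) \<Longrightarrow> (\<And>i j. i < n \<Longrightarrow> j < n \<Longrightarrow> g i j \<in> S) \<Longrightarrow>
      N n (\<lambda>i j. f i j + g i j) \<le> N n f + N n g"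
    and N_diag: "(\<And>i j. i < m \<Longrightarrow> j < m \<Longrightarrow> f i j \<in> S) \<Longrightarrow> (\<And>i j. i < n \<Longrightarrow> j < n \<Longrightarrow> g i j \<in> S) \<Longrightarrow>
      N (m + n) (\<lambda>i j. if i < m \<and> j < m then f i j else if m \<le> i \<and> m \<le> j then g (i - m) (j - m) else 0)
        \<le> max (N m f) (N n g)"
    and N_contr: "contr n m a \<Longrightarrow> contr m n b \<Longrightarrow> (\<And>i j. i < m \<Longrightarrow> j < m \<Longrightarrow> f i j \<in> S) \<Longrightarrow>
      N n (\<lambda>i j. \<Sum>p<m. \<Sum>q<m. (a i p * b q j) *s f p q) \<le> N m f"
begin

lemma matrix_norm_transpose: "matrix_norm sc S (\<lambda>n f. N n (\<lambda>i j. f j i))"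
proof
  show "subspace S" by (rule subspace_S)
  show "0 \<le> N n (\<lambda>i j. f j i)" if "\<And>i j. i < n \<Longrightarrow> j < n \<Longrightarrow> f i j \<in> S" for n f
    by (rule N_nonneg) (rule that)
  show "N n (\<lambda>i j. f j i) = N n (\<lambda>i j. g j i)" if "\<And>i j. i < n \<Longrightarrow> j < n \<Longrightarrow> f i j = g i j" for n f g
    by (rule N_cong) (rule that)
  show "N n (\<lambda>i j. a *s f j i) = cmod a * N n (\<lambda>i j. f j i)" if "\<And>i j. i < n \<Longrightarrow> j < n \<Longrightarrow> f i j \<in> S" for n f a
    by (rule N_scale) (rule that)
  show "N n (\<lambda>i j. f j i + g j i) \<le> N n (\<lambda>i j. f j i) + N n (\<lambda>i j. g j i)"
    if "\<And>i j. i < n \<Longrightarrow> j < n \<Longrightarrow> f i j \<in> S" "\<And>i j. i < n \<Longrightarrow> j < n \<Longrightarrow> g i j \<in> S" for n f g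
    by (rule N_add) (rule that, assumption+)+
  show "N (m + n) (\<lambda>i j. if j < m \<and> i < m then f j i else if m \<le> j \<and> m \<le> i then g (j - m) (i - m) else 0)
        \<le> max (N m (\<lambda>i j. f j i)) (N n (\<lambda>i j. g j i))"
    if "\<And>i j. i < m \<Longrightarrow> j < m \<Longrightarrow> f i j \<in> S" "\<And>i j. i < n \<Longrightarrow> j < n \<Longrightarrow> g i j \<in> S" for m n f g
  proof -
    have "N (m + n) (\<lambda>i j. if i < m \<and> j < m then f j i else if m \<le> i \<and> m \<le> j then g (j - m) (i - m) else 0)
        \<le> max (N m (\<lambda>i j. f j i)) (N n (\<lambda>i j. g j i))"
      by (rule N_diag) (rule that, assumption+)+
    then show ?thesis by (simp only: conj_commute)
  qed
  show "N n (\<lambda>j i. \<Sum>p<m. \<Sum>q<m. (a i p * b q j) *s f p q) \<le> N m (\<lambda>i j. f j i)"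
    if a: "contr n m a" and b: "contr m n b" and f: "\<And>i j. i < m \<Longrightarrow> j < m \<Longrightarrow> f i j \<in> S" for n m a b f
  proof -
    have "N n (\<lambda>i j. \<Sum>p<m. \<Sum>q<m. (b p i * a j q) *s f q p) \<le> N m (\<lambda>i j. f j i)"
      by (rule N_contr[OF contr_transpose[OF b] contr_transpose[OF a]]) (rule f)
    moreover have "(\<Sum>p<m. \<Sum>q<m. (b p i * a j q) *s f q p) = (\<Sum>p<m. \<Sum>q<m. (a j p * b q i) *s f p q)" for i j
      by (subst sum.swap) (simp add: mult.commute)
    ultimately show ?thesis by simp
  qed
qed

definition colnorm :: "nat \<Rightarrow> (nat \<Rightarrow> 'y) \<Rightarrow> real" where
  "colnorm n u = N n (\<lambda>i j. if j = 0 then u i else 0)"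

lemma zero_S: "0 \<in> S"
  by (rule subspace_0[OF subspace_S])

lemma N_zero: "(\<And>i j. i < n \<Longrightarrow> j < n \<Longrightarrow> f i j = 0) \<Longrightarrow> N n f = 0"
  using N_scale[of n "\<lambda>_ _. 0" 0] N_cong[of n f "\<lambda>_ _. 0 *s 0"] zero_S by simp

lemma colnorm_nonneg: "(\<And>i. i < n \<Longrightarrow> u i \<in> S) \<Longrightarrow> 0 \<le> colnorm n u"
  unfolding colnorm_def by (intro N_nonneg) (simp add: zero_S)

lemma colnorm_cong: "(\<And>i. i < n \<Longrightarrow> u i = v i) \<Longrightarrow> colnorm n u = colnorm n v"
  unfolding colnorm_def by (intro N_cong) simp

lemma colnorm_apply_le:
  assumes "\<And>i j. i < n \<Longrightarrow> j < n \<Longrightarrow> f i j \<in> S" "(\<Sum>j<n. (cmod (\<xi> j))\<^sup>2) \<le> 1"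
  shows "colnorm n (\<lambda>i. \<Sum>j<n. \<xi> j *s f i j) \<le> N n f"
proof -
  have "N n (\<lambda>i j. \<Sum>p<n. \<Sum>q<n. ((if i = p then 1 else 0) * (if j = 0 then \<xi> q else 0)) *s f p q) \<le> N n f"
    by (rule N_contr[OF contr_id contr_single_column]) (rule assms, assumption?)+
  moreover have "colnorm n (\<lambda>i. \<Sum>j<n. \<xi> j *s f i j)
      = N n (\<lambda>i j. \<Sum>p<n. \<Sum>q<n. ((if i = p then 1 else 0) * (if j = 0 then \<xi> q else 0)) *s f p q)"
    unfolding colnorm_def
  proof (rule N_cong)
    fix i j assume "i < n" "j < n"
    have "(\<Sum>p<n. \<Sum>q<n. ((if i = p then 1 else 0) * (if j = 0 then \<xi> q else 0)) *s f p q)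
        = (\<Sum>p<n. if i = p then (\<Sum>q<n. (if j = 0 then \<xi> q else 0) *s f p q) else 0)"
      by (intro sum.cong) auto
    also have "\<dots> = (\<Sum>q<n. (if j = 0 then \<xi> q else 0) *s f i q)" using \<open>i < n\<close> by simp
    finally show "(if j = 0 then \<Sum>j<n. \<xi> j *s f i j else 0)
      = (\<Sum>p<n. \<Sum>q<n. ((if i = p then 1 else 0) * (if j = 0 then \<xi> q else 0)) *s f p q)"
      by (cases "j = 0") auto
  qed
  ultimately show ?thesis by simp
qed

lemma colnorm_contr:
  assumes A: "contr m n A" and u: "\<And>j. j < n \<Longrightarrow> u j \<in> S"
  shows "colnorm m (\<lambda>i. \<Sum>j<n. A i j *s u j) \<le> colnorm n u"
proof (cases "n = 0")
  case True
  then have "colnorm m (\<lambda>i. \<Sum>j<n. A i j *s u j) = 0" unfolding colnorm_def by (intro N_zero) simp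
  then show ?thesis using colnorm_nonneg[of n u, OF u] by simp
next
  case False
  define b :: "nat \<Rightarrow> complex" where "b q = (if q = 0 then 1 else 0)" for q
  have "(\<Sum>q<n. (cmod (b q))\<^sup>2) \<le> 1"
    using False by (simp add: b_def if_distrib[of cmod] if_distrib[of "\<lambda>x. x\<^sup>2"] cong: if_cong)
  from N_contr[OF A contr_single_column[OF this], of "\<lambda>i j. if j = 0 then u i else 0"]
  have "N m (\<lambda>i j. \<Sum>p<n. \<Sum>q<n. (A i p * (if j = 0 then b q else 0)) *s (if q = 0 then u p else 0)) \<le> colnorm n u"
    using u zero_S by (simp add: colnorm_def)
  moreover have "colnorm m (\<lambda>i. \<Sum>j<n. A i j *s u j)
      = N m (\<lambda>i j. \<Sum>p<n. \<Sum>q<n. (A i p * (if j = 0 then b q else 0)) *s (if q = 0 then u p else 0))"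
    unfolding colnorm_def
  proof (rule N_cong)
    fix i j
    have "(\<Sum>q<n. (A i p * (if j = 0 then b q else 0)) *s (if q = 0 then u p else 0))
        = (\<Sum>q<n. if q = 0 then (if j = 0 then A i p *s u p else 0) else 0)" for p
      by (intro sum.cong) (auto simp: b_def)
    then have "(\<Sum>q<n. (A i p * (if j = 0 then b q else 0)) *s (if q = 0 then u p else 0))
        = (if j = 0 then A i p *s u p else 0)" for p
      using False by simp
    then show "(if j = 0 then \<Sum>j<n. A i j *s u j else 0)
      = (\<Sum>p<n. \<Sum>q<n. (A i p * (if j = 0 then b q else 0)) *s (if q = 0 then u p else 0))"
      by (cases "j = 0") simp_all
  qed
  ultimately show ?thesis by simp
qed

lemma colnorm_scale:
  assumes "\<And>i. i < n \<Longrightarrow> u i \<in> S"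
  shows "colnorm n (\<lambda>i. a *s u i) = cmod a * colnorm n u"
proof -
  have "N n (\<lambda>i j. a *s (if j = 0 then u i else 0)) = cmod a * colnorm n u"
    unfolding colnorm_def using assms zero_S by (intro N_scale) simp
  then show ?thesis by (simp add: colnorm_def if_distrib[of "\<lambda>x. a *s x"] cong: if_cong)
qed

lemma colnorm_add:
  assumes "\<And>i. i < n \<Longrightarrow> u i \<in> S" "\<And>i. i < n \<Longrightarrow> v i \<in> S"
  shows "colnorm n (\<lambda>i. u i + v i) \<le> colnorm n u + colnorm n v"
proof -
  have "N n (\<lambda>i j. (if j = 0 then u i else 0) + (if j = 0 then v i else 0)) \<le> colnorm n u + colnorm n v"
    unfolding colnorm_def using assms zero_S by (intro N_add) simp_all
  moreover have "(\<lambda>i j. (if j = 0 then u i else 0) + (if j = 0 then v i else 0))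
      = (\<lambda>i j. if j = (0::nat) then u i + v i else 0)"
    by (simp add: fun_eq_iff)
  ultimately show ?thesis by (simp add: colnorm_def)
qed

text \<open>
  A stacked column is the block diagonal matrix of its parts applied to a scalar vector with two
  non-zero entries. With the parts normalized, the Euclidean norm of that vector is the square root of the sum of
  squares. Adding \<open>e\<close> avoids dividing by zero.
\<close>

lemma colnorm_stack:
  assumes u: "\<And>i. i < n \<Longrightarrow> u i \<in> S" and v: "\<And>i. i < m \<Longrightarrow> v i \<in> S"
  shows "(colnorm (n + m) (stack n u v))\<^sup>2 \<le> (colnorm n u)\<^sup>2 + (colnorm m v)\<^sup>2"
proof (cases "n = 0 \<or> m = 0")
  case True
  then consider "n = 0" | "m = 0" by blast
  then show ?thesis
  proof cases
    case 1
    then have "stack n u v = v" by (simp add: stack_def fun_eq_iff)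
    with 1 have "colnorm (n + m) (stack n u v) = colnorm m v" by simp
    then show ?thesis by simp
  next
    case 2
    then have "colnorm (n + m) (stack n u v) = colnorm n u" by (simp, intro colnorm_cong) simp
    then show ?thesis by simp
  qed
next
  case False
  have stack_S: "stack n u v i \<in> S" if "i < n + m" for i
    using that u v by (rule stack_cases)
  have uv0: "0 \<le> colnorm n u" "0 \<le> colnorm m v"
    by (rule colnorm_nonneg, rule u v, assumption)+
  have "(colnorm (n + m) (stack n u v))\<^sup>2 \<le> (colnorm n u + e)\<^sup>2 + (colnorm m v + e)\<^sup>2" if e: "e > 0" for e
  proof -
    define s where "s = colnorm n u + e"
    define t where "t = colnorm m v + e"
    have st: "s > 0" "t > 0" using uv0 e by (auto simp: s_def t_def)
    define \<rho> where "\<rho> = sqrt (s\<^sup>2 + t\<^sup>2)"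
    have \<rho>: "\<rho> > 0" "\<rho>\<^sup>2 = s\<^sup>2 + t\<^sup>2" using st by (auto simp: \<rho>_def add_pos_pos)
    define D where "D i j = (if i < n \<and> j < n then (if j = 0 then complex_of_real (1 / s) *s u i else 0)
        else if n \<le> i \<and> n \<le> j then (if j - n = 0 then complex_of_real (1 / t) *s v (i - n) else 0) else 0)" for i j
    define b where "b q = complex_of_real (if q = 0 then s / \<rho> else if q = n then t / \<rho> else 0)" for q
    have D_S: "D i j \<in> S" if "i < n + m" "j < n + m" for i j
      using that u v zero_S unfolding D_def by (auto intro!: subspace_scale[OF subspace_S])
    have "colnorm n (\<lambda>i. complex_of_real (1 / s) *s u i) \<le> 1"
    proof -
      have "colnorm n (\<lambda>i. complex_of_real (1 / s) *s u i) = cmod (complex_of_real (1 / s)) * colnorm n u"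
        by (rule colnorm_scale) (rule u)
      also have "\<dots> = colnorm n u / s" using st by (simp add: norm_divide)
      also have "\<dots> \<le> 1" using st e by (simp add: s_def)
      finally show ?thesis .
    qed
    moreover have "colnorm m (\<lambda>i. complex_of_real (1 / t) *s v i) \<le> 1"
    proof -
      have "colnorm m (\<lambda>i. complex_of_real (1 / t) *s v i) = cmod (complex_of_real (1 / t)) * colnorm m v"
        by (rule colnorm_scale) (rule v)
      also have "\<dots> = colnorm m v / t" using st by (simp add: norm_divide)
      also have "\<dots> \<le> 1" using st e by (simp add: t_def)
      finally show ?thesis .
    qed
    moreover have "N (n + m) D \<le> max (colnorm n (\<lambda>i. complex_of_real (1 / s) *s u i)) (colnorm m (\<lambda>i. complex_of_real (1 / t) *s v i))"
      unfolding D_def[abs_def] colnorm_def using u v zero_S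
      by (intro N_diag) (auto intro!: subspace_scale[OF subspace_S])
    ultimately have D1: "N (n + m) D \<le> 1" by linarith
    have "(\<Sum>q<n + m. (cmod (b q))\<^sup>2) = (s / \<rho>)\<^sup>2 + (t / \<rho>)\<^sup>2"
    proof -
      have "(\<Sum>q<n. (cmod (b q))\<^sup>2) = (\<Sum>q<n. if q = 0 then (s / \<rho>)\<^sup>2 else 0)"
        by (intro sum.cong) (auto simp: b_def simp del: of_real_divide)
      moreover have "(\<Sum>q<m. (cmod (b (n + q)))\<^sup>2) = (\<Sum>q<m. if q = 0 then (t / \<rho>)\<^sup>2 else 0)"
        using False by (intro sum.cong) (auto simp: b_def simp del: of_real_divide)
      ultimately show ?thesis using False by (simp add: sum_lessThan_add)
    qed
    also have "\<dots> = 1" using \<rho> st by (simp add: power_divide flip: add_divide_distrib)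
    finally have "(\<Sum>q<n + m. (cmod (b q))\<^sup>2) \<le> 1" by simp
    from colnorm_apply_le[of "n + m" D b, OF D_S this]
    have "colnorm (n + m) (\<lambda>i. \<Sum>j<n + m. b j *s D i j) \<le> 1" using D1 by simp
    moreover have "colnorm (n + m) (\<lambda>i. \<Sum>j<n + m. b j *s D i j)
        = colnorm (n + m) (\<lambda>i. complex_of_real (1 / \<rho>) *s stack n u v i)"
    proof (rule colnorm_cong)
      fix i assume i: "i < n + m"
      have sum1: "(\<Sum>j<n. b j *s D i j) = (\<Sum>j<n. if j = 0 then complex_of_real (s / \<rho>) *s D i 0 else 0)"
        by (intro sum.cong) (auto simp: b_def simp del: of_real_divide)
      have sum2: "(\<Sum>j<m. b (n + j) *s D i (n + j)) = (\<Sum>j<m. if j = 0 then complex_of_real (t / \<rho>) *s D i n else 0)"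
        using False by (intro sum.cong) (auto simp: b_def simp del: of_real_divide)
      have "(\<Sum>j<n + m. b j *s D i j) = complex_of_real (s / \<rho>) *s D i 0 + complex_of_real (t / \<rho>) *s D i n"
        unfolding sum_lessThan_add sum1 sum2 using False by simp
      also have "\<dots> = complex_of_real (1 / \<rho>) *s stack n u v i"
      proof (cases "i < n")
        case True
        then show ?thesis using st False by (simp add: D_def)
      next
        case False
        then show ?thesis using st \<open>\<not> (n = 0 \<or> m = 0)\<close> by (simp add: D_def stack_def)
      qed
      finally show "(\<Sum>j<n + m. b j *s D i j) = complex_of_real (1 / \<rho>) *s stack n u v i" .
    qed
    ultimately have "cmod (complex_of_real (1 / \<rho>)) * colnorm (n + m) (stack n u v) \<le> 1"
      by (subst colnorm_scale[symmetric]) (auto simp: stack_S)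
    then have "colnorm (n + m) (stack n u v) \<le> \<rho>"
      using \<rho> by (simp add: norm_divide)
    then have "(colnorm (n + m) (stack n u v))\<^sup>2 \<le> \<rho>\<^sup>2"
      by (intro power_mono colnorm_nonneg stack_S)
    then show ?thesis by (simp add: \<rho> s_def t_def)
  qed
  then have "\<forall>\<^sub>F e in at_right 0. (colnorm (n + m) (stack n u v))\<^sup>2 \<le> (colnorm n u + e)\<^sup>2 + (colnorm m v + e)\<^sup>2"
    unfolding eventually_at_right_field by (intro exI[of _ 1]) simp
  moreover have "((\<lambda>e. (colnorm n u + e)\<^sup>2 + (colnorm m v + e)\<^sup>2) \<longlongrightarrow> (colnorm n u + 0)\<^sup>2 + (colnorm m v + 0)\<^sup>2) (at_right 0)"
    by (intro tendsto_intros)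
  ultimately have "(colnorm (n + m) (stack n u v))\<^sup>2 \<le> (colnorm n u + 0)\<^sup>2 + (colnorm m v + 0)\<^sup>2"
    by (intro tendsto_lowerbound) auto
  then show ?thesis by simp
qed

lemma column_norm_colnorm:
  assumes "K \<ge> 0"
  shows "column_norm sc S (\<lambda>n u. K * colnorm n u)"
proof
  show "subspace S" by (rule subspace_S)
  show "0 \<le> K * colnorm n u" if "\<And>i. i < n \<Longrightarrow> u i \<in> S" for n u
    using colnorm_nonneg[of n u, OF that] assms by simp
  show "K * colnorm n u = K * colnorm n v" if "\<And>i. i < n \<Longrightarrow> u i = v i" for n u v
    using colnorm_cong[of n u v, OF that] by simp
  show "K * colnorm m (\<lambda>i. \<Sum>j<n. A i j *s u j) \<le> K * colnorm n u"
    if "contr m n A" "\<And>j. j < n \<Longrightarrow> u j \<in> S" for m n A u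
    using assms by (intro mult_left_mono colnorm_contr that)
  show "K * colnorm n (\<lambda>i. a *s u i) = cmod a * (K * colnorm n u)" if "\<And>i. i < n \<Longrightarrow> u i \<in> S" for n u a
    using colnorm_scale[of n u, OF that] by simp
  show "K * colnorm n (\<lambda>i. u i + v i) \<le> K * colnorm n u + K * colnorm n v"
    if "\<And>i. i < n \<Longrightarrow> u i \<in> S" "\<And>i. i < n \<Longrightarrow> v i \<in> S" for n u v
    unfolding distrib_left[symmetric] using assms by (intro mult_left_mono colnorm_add that)
  show "(K * colnorm (n + m) (stack n u v))\<^sup>2 \<le> (K * colnorm n u)\<^sup>2 + (K * colnorm m v)\<^sup>2"
    if "\<And>i. i < n \<Longrightarrow> u i \<in> S" "\<And>i. i < m \<Longrightarrow> v i \<in> S" for n m u v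
    unfolding power_mult_distrib distrib_left[symmetric]
    by (intro mult_left_mono colnorm_stack that) auto
qed

end

lemma scalar_mat_norm_contr:
  assumes "contr m n a"
  shows "0 \<le> scalar_mat_norm (mat m n (\<lambda>(i, j). a i j))" "scalar_mat_norm (mat m n (\<lambda>(i, j). a i j)) \<le> 1"
proof -
  let ?M = "mat m n (\<lambda>(i, j). a i j)"
  let ?V = "{l2_norm_vec (?M *\<^sub>v v) | v. v \<in> carrier_vec (dim_col ?M) \<and> l2_norm_vec v \<le> 1}"
  have le: "l2_norm_vec (?M *\<^sub>v v) \<le> 1" if v: "v \<in> carrier_vec n" "l2_norm_vec v \<le> 1" for v
  proof -
    have "(?M *\<^sub>v v) $ i = (\<Sum>j<n. a i j * v $ j)" if "i < m" for i
      using that v(1) by (simp add: scalar_prod_def lessThan_atLeast0)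
    then have "l2_norm_vec (?M *\<^sub>v v) = sqrt (\<Sum>i<m. (cmod (\<Sum>j<n. a i j * v $ j))\<^sup>2)"
      by (simp add: l2_norm_vec_def)
    also have "\<dots> \<le> sqrt (\<Sum>j<n. (cmod (v $ j))\<^sup>2)"
      using assms unfolding contr_def by (intro real_sqrt_le_mono) blast
    also have "\<dots> = l2_norm_vec v" using v(1) by (simp add: l2_norm_vec_def)
    finally show ?thesis using v(2) by simp
  qed
  have zero: "l2_norm_vec (?M *\<^sub>v 0\<^sub>v n) \<in> ?V"
    by (auto intro!: exI[of _ "0\<^sub>v n"] simp: l2_norm_vec_def)
  have "?V \<noteq> {}" using zero by blast
  then show "scalar_mat_norm ?M \<le> 1"
    unfolding scalar_mat_norm_def by (rule cSup_least) (auto intro: le)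
  have "bdd_above ?V" by (rule bdd_aboveI[of _ 1]) (auto intro: le)
  from cSup_upper[OF zero this] have "l2_norm_vec (?M *\<^sub>v 0\<^sub>v n) \<le> scalar_mat_norm ?M"
    unfolding scalar_mat_norm_def .
  moreover have "0 \<le> l2_norm_vec (?M *\<^sub>v 0\<^sub>v n)" unfolding l2_norm_vec_def by (simp add: sum_nonneg)
  ultimately show "0 \<le> scalar_mat_norm ?M" by linarith
qed

definition os_fnorm :: "'a op_space \<Rightarrow> nat \<Rightarrow> (nat \<Rightarrow> nat \<Rightarrow> 'a) \<Rightarrow> real" where
  "os_fnorm V n f = os_norm V (mat n n (\<lambda>(i, j). f i j))"

lemma mat_in_os_mats: "(\<And>i j. i < n \<Longrightarrow> j < n \<Longrightarrow> f i j \<in> os_carrier V) \<Longrightarrow> mat n n (\<lambda>(i, j). f i j) \<in> os_mats V n"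
  by (simp add: os_mats_def)

lemma operator_space_matrix_norm:
  assumes "operator_space V"
  shows "matrix_norm (os_scale V) (os_carrier V) (os_fnorm V)"
proof -
  have vs: "vector_space (os_scale V)" and sub: "os_subspace V (os_carrier V)"
    and nn: "\<And>n x. x \<in> os_mats V n \<Longrightarrow> os_norm V x \<ge> 0"
    and sc: "\<And>n x c. x \<in> os_mats V n \<Longrightarrow> os_norm V (map_mat (os_scale V c) x) = cmod c * os_norm V x"
    and add: "\<And>n x y. x \<in> os_mats V n \<Longrightarrow> y \<in> os_mats V n \<Longrightarrow> os_norm V (x + y) \<le> os_norm V x + os_norm V y"
    and diag: "\<And>m n x y. x \<in> os_mats V m \<Longrightarrow> y \<in> os_mats V n \<Longrightarrow>
        os_norm V (os_diag_sum x y) = max (os_norm V x) (os_norm V y)"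
    and sand: "\<And>m n x a b. x \<in> os_mats V m \<Longrightarrow> a \<in> carrier_mat n m \<Longrightarrow> b \<in> carrier_mat m n \<Longrightarrow>
        os_norm V (os_sandwich V a x b) \<le> scalar_mat_norm a * os_norm V x * scalar_mat_norm b"
    using assms unfolding operator_space_def by blast+
  interpret vector_space "os_scale V" by (rule vs)
  show ?thesis
  proof
    show "subspace (os_carrier V)"
      using sub unfolding os_subspace_def subspace_def by blast
    show "0 \<le> os_fnorm V n f" if "\<And>i j. i < n \<Longrightarrow> j < n \<Longrightarrow> f i j \<in> os_carrier V" for n f
      unfolding os_fnorm_def by (rule nn[OF mat_in_os_mats]) (rule that)
    show "os_fnorm V n f = os_fnorm V n g" if "\<And>i j. i < n \<Longrightarrow> j < n \<Longrightarrow> f i j = g i j" for n f g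
      unfolding os_fnorm_def by (rule arg_cong[of _ _ "os_norm V"]) (auto intro!: eq_matI simp: that)
    show "os_fnorm V n (\<lambda>i j. os_scale V a (f i j)) = cmod a * os_fnorm V n f"
      if "\<And>i j. i < n \<Longrightarrow> j < n \<Longrightarrow> f i j \<in> os_carrier V" for n f a
    proof -
      have "map_mat (os_scale V a) (mat n n (\<lambda>(i, j). f i j)) = mat n n (\<lambda>(i, j). os_scale V a (f i j))"
        by (rule eq_matI) auto
      then show ?thesis unfolding os_fnorm_def using sc[OF mat_in_os_mats[of n f V, OF that], of a] by simp
    qed
    show "os_fnorm V n (\<lambda>i j. f i j + g i j) \<le> os_fnorm V n f + os_fnorm V n g"
      if f: "\<And>i j. i < n \<Longrightarrow> j < n \<Longrightarrow> f i j \<in> os_carrier V"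
        and g: "\<And>i j. i < n \<Longrightarrow> j < n \<Longrightarrow> g i j \<in> os_carrier V" for n f g
    proof -
      have "mat n n (\<lambda>(i, j). f i j) + mat n n (\<lambda>(i, j). g i j) = mat n n (\<lambda>(i, j). f i j + g i j)"
        by (rule eq_matI) auto
      then show ?thesis
        unfolding os_fnorm_def using add[OF mat_in_os_mats[of n f V, OF f] mat_in_os_mats[of n g V, OF g]] by simp
    qed
    show "os_fnorm V (m + n) (\<lambda>i j. if i < m \<and> j < m then f i j else if m \<le> i \<and> m \<le> j then g (i - m) (j - m) else 0)
        \<le> max (os_fnorm V m f) (os_fnorm V n g)"
      if f: "\<And>i j. i < m \<Longrightarrow> j < m \<Longrightarrow> f i j \<in> os_carrier V"
        and g: "\<And>i j. i < n \<Longrightarrow> j < n \<Longrightarrow> g i j \<in> os_carrier V" for m n f g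
    proof -
      have "os_diag_sum (mat m m (\<lambda>(i, j). f i j)) (mat n n (\<lambda>(i, j). g i j))
          = mat (m + n) (m + n) (\<lambda>(i, j). if i < m \<and> j < m then f i j else if m \<le> i \<and> m \<le> j then g (i - m) (j - m) else 0)"
        unfolding os_diag_sum_def by (rule eq_matI) auto
      then show ?thesis
        unfolding os_fnorm_def using diag[OF mat_in_os_mats[of m f V, OF f] mat_in_os_mats[of n g V, OF g]] by simp
    qed
    show "os_fnorm V n (\<lambda>i j. \<Sum>p<m. \<Sum>q<m. os_scale V (a i p * b q j) (f p q)) \<le> os_fnorm V m f"
      if a: "contr n m a" and b: "contr m n b"
        and f: "\<And>i j. i < m \<Longrightarrow> j < m \<Longrightarrow> f i j \<in> os_carrier V" for n m a b f
    proof -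
      let ?a = "mat n m (\<lambda>(i, j). a i j)" and ?b = "mat m n (\<lambda>(i, j). b i j)"
      have "os_sandwich V ?a (mat m m (\<lambda>(i, j). f i j)) ?b
          = mat n n (\<lambda>(i, j). \<Sum>p<m. \<Sum>q<m. os_scale V (a i p * b q j) (f p q))"
        unfolding os_sandwich_def by (rule eq_matI) auto
      then have "os_fnorm V n (\<lambda>i j. \<Sum>p<m. \<Sum>q<m. os_scale V (a i p * b q j) (f p q))
          \<le> scalar_mat_norm ?a * os_fnorm V m f * scalar_mat_norm ?b"
        unfolding os_fnorm_def using sand[OF mat_in_os_mats[of m f V, OF f], of ?a n ?b] by simp
      also have "\<dots> \<le> 1 * os_fnorm V m f * 1"
        using scalar_mat_norm_contr[OF a] scalar_mat_norm_contr[OF b] nn[OF mat_in_os_mats[of m f V, OF f]]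
        unfolding os_fnorm_def by (intro mult_mono mult_nonneg_nonneg) auto
      finally show ?thesis by simp
    qed
  qed
qed

section \<open>Row and column spaces as Hilbert spaces\<close>

lemma bounded_complex_subsequence:
  fixes z :: "nat \<Rightarrow> complex"
  assumes "\<And>k. cmod (z k) \<le> M"
  shows "\<exists>r \<zeta>. strict_mono r \<and> (\<lambda>k. z (r k)) \<longlonglongrightarrow> \<zeta>"
proof -
  have real_sub: "\<exists>r. strict_mono r \<and> convergent (\<lambda>k. x (r k))" if "\<And>k. \<bar>x k\<bar> \<le> M" for x :: "nat \<Rightarrow> real"
  proof -
    obtain r where r: "strict_mono r" "monoseq (\<lambda>k. x (r k))"
      using seq_monosub[of x] by (auto simp: comp_def)
    have "Bseq (\<lambda>k. x (r k))" by (rule BseqI'[of _ M]) (simp add: that)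
    with r show ?thesis using Bseq_monoseq_convergent by blast
  qed
  have "\<bar>Re (z k)\<bar> \<le> M" for k using abs_Re_le_cmod[of "z k"] assms[of k] by linarith
  from real_sub[of "\<lambda>k. Re (z k)", OF this] obtain r where r: "strict_mono r" "convergent (\<lambda>k. Re (z (r k)))" by (elim exE conjE)
  have "\<bar>Im (z (r k))\<bar> \<le> M" for k using abs_Im_le_cmod[of "z (r k)"] assms[of "r k"] by linarith
  from real_sub[of "\<lambda>k. Im (z (r k))", OF this] obtain r' where r': "strict_mono r'" "convergent (\<lambda>k. Im (z (r (r' k))))" by (elim exE conjE)
  obtain x where "(\<lambda>k. Re (z (r k))) \<longlonglongrightarrow> x" using r(2) by (auto simp: convergent_def)
  from LIMSEQ_subseq_LIMSEQ[OF this r'(1)] have x: "(\<lambda>k. Re (z (r (r' k)))) \<longlonglongrightarrow> x" by (simp add: comp_def)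
  obtain y where y: "(\<lambda>k. Im (z (r (r' k)))) \<longlonglongrightarrow> y" using r'(2) by (auto simp: convergent_def)
  have "(\<lambda>k. Complex (Re (z (r (r' k)))) (Im (z (r (r' k))))) \<longlonglongrightarrow> Complex x y"
    by (rule tendsto_Complex[OF x y])
  then have "(\<lambda>k. z ((r \<circ> r') k)) \<longlonglongrightarrow> Complex x y" by simp
  moreover have "strict_mono (r \<circ> r')" using r(1) r'(1) by (rule strict_mono_o)
  ultimately show ?thesis by blast
qed

text \<open>
  The unit ball is mapped to bounded multiples of a single vector.
\<close>

lemma rank_one_compact:
  assumes sm: "\<And>f i. f \<in> ell2 \<Longrightarrow> summable (\<lambda>j. a i j * f j)"
    and app: "\<And>x. inf_mat_apply a (coord x) = coord (\<phi> x *\<^sub>C h)"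
    and bd: "\<And>x. cmod (\<phi> x) \<le> M * norm x" and M: "M \<ge> 0"
  shows "a \<in> compact_inf_mats"
  unfolding compact_inf_mats_def mem_Collect_eq
proof (intro conjI ballI allI impI)
  show "summable (\<lambda>j. a i j * f j)" if "f \<in> ell2" for f i by (rule sm[OF that])
  show "inf_mat_apply a f \<in> ell2" if "f \<in> ell2" for f
    using app[of "Abs_hilb f"] that coord[of "\<phi> (Abs_hilb f) *\<^sub>C h"] by (simp add: Abs_hilb_inverse)
  fix F :: "nat \<Rightarrow> nat \<Rightarrow> complex"
  assume F: "\<forall>k. F k \<in> ell2 \<and> ell2_norm (F k) \<le> 1"
  define z where "z k = \<phi> (Abs_hilb (F k))" for k
  have aF: "inf_mat_apply a (F k) = coord (z k *\<^sub>C h)" for k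
    using app[of "Abs_hilb (F k)"] F by (simp add: Abs_hilb_inverse z_def)
  have "cmod (z k) \<le> M" for k
  proof -
    have "norm (Abs_hilb (F k)) \<le> 1" using F ell2_norm_eq_norm by metis
    then have "M * norm (Abs_hilb (F k)) \<le> M" using M by (simp add: mult_left_le)
    then show ?thesis using bd[of "Abs_hilb (F k)"] unfolding z_def by linarith
  qed
  from bounded_complex_subsequence[of z M, OF this] obtain r \<zeta>
    where r: "strict_mono r" and \<zeta>: "(\<lambda>k. z (r k)) \<longlonglongrightarrow> \<zeta>" by (elim exE conjE)
  have "ell2_norm (inf_mat_apply a (F (r k)) - coord (\<zeta> *\<^sub>C h)) = cmod (z (r k) - \<zeta>) * norm h" for k
  proof -
    have "inf_mat_apply a (F (r k)) - coord (\<zeta> *\<^sub>C h) = coord ((z (r k) - \<zeta>) *\<^sub>C h)"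
      unfolding aF by (simp add: fun_eq_iff left_diff_distrib)
    then show ?thesis by (simp only: ell2_norm_coord norm_cscale)
  qed
  moreover have "(\<lambda>k. cmod (z (r k) - \<zeta>) * norm h) \<longlonglongrightarrow> cmod (\<zeta> - \<zeta>) * norm h"
    by (intro tendsto_intros \<zeta>)
  ultimately show "\<exists>r g. strict_mono (r::nat \<Rightarrow> nat) \<and> g \<in> ell2 \<and>
           (\<lambda>k. ell2_norm (inf_mat_apply a (F (r k)) - g)) \<longlonglongrightarrow> 0"
    using r coord by (intro exI[of _ r] exI[of _ "coord (\<zeta> *\<^sub>C h)"]) simp
qed

definition colmat :: "hilb \<Rightarrow> nat \<Rightarrow> nat \<Rightarrow> complex" where
  "colmat h i j = (if j = 0 then coord h i else 0)"

definition rowmat :: "hilb \<Rightarrow> nat \<Rightarrow> nat \<Rightarrow> complex" where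
  "rowmat h i j = (if i = 0 then coord h j else 0)"

definition unit0 :: hilb where
  "unit0 = Abs_hilb (\<lambda>i. if i = 0 then 1 else 0)"

lemma coord_unit0: "coord unit0 i = (if i = 0 then 1 else 0)"
proof -
  have "summable (\<lambda>i. (cmod (if i = (0::nat) then 1 else 0))\<^sup>2)"
    by (rule summable_finite[of "{0}"]) auto
  then show ?thesis unfolding unit0_def by (subst coord_Abs) (simp_all add: ell2_def)
qed

lemma suminf_single:
  fixes f :: "nat \<Rightarrow> 'a::{comm_monoid_add, t2_space}"
  assumes "\<And>j. j \<noteq> i \<Longrightarrow> f j = 0"
  shows "(\<Sum>j. f j) = f i"
  using suminf_finite[of "{i}" f] assms by simp

lemma norm_unit0: "norm unit0 = 1"
proof -
  have "(norm unit0)\<^sup>2 = (cmod (coord unit0 0))\<^sup>2"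
    unfolding norm_hilb_power2 by (rule suminf_single) (simp add: coord_unit0)
  then have "(norm unit0)\<^sup>2 = 1\<^sup>2" by (simp add: coord_unit0)
  then show ?thesis by (rule power2_eq_imp_eq) auto
qed

definition conj_hilb :: "hilb \<Rightarrow> hilb" where
  "conj_hilb h = Abs_hilb (\<lambda>i. cnj (coord h i))"

lemma coord_conj_hilb [simp]: "coord (conj_hilb h) i = cnj (coord h i)"
  unfolding conj_hilb_def by (rule coord_Abs) (intro ell2_cnj coord)

lemma norm_conj_hilb [simp]: "norm (conj_hilb h) = norm h"
proof -
  have "(norm (conj_hilb h))\<^sup>2 = (norm h)\<^sup>2" by (simp add: norm_hilb_power2)
  then show ?thesis by (rule power2_eq_imp_eq) auto
qed

text \<open>
  The bilinear pairing, by which a row acts on a vector.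
\<close>

definition pairing :: "hilb \<Rightarrow> hilb \<Rightarrow> complex" where
  "pairing h k = (\<Sum>l. coord h l * coord k l)"

lemma pairing_summable: "summable (\<lambda>l. coord h l * coord k l)"
  by (intro ell2_product_summable coord)

lemma pairing_add: "pairing (h + h') k = pairing h k + pairing h' k"
  unfolding pairing_def
  by (subst suminf_add[OF pairing_summable pairing_summable]) (simp add: distrib_right)

lemma pairing_scale: "pairing (c *\<^sub>C h) k = c * pairing h k"
  unfolding pairing_def by (subst suminf_mult[OF pairing_summable, symmetric]) (simp add: mult.assoc)

lemma pairing_scale_right: "pairing h (c *\<^sub>C k) = c * pairing h k"
  unfolding pairing_def by (subst suminf_mult[OF pairing_summable, symmetric]) (simp add: mult_ac)

lemma pairing_sum: "pairing (\<Sum>i\<in>I. c i *\<^sub>C h i) k = (\<Sum>i\<in>I. c i * pairing (h i) k)"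
proof -
  have "pairing 0 k = 0" using pairing_scale[of 0 0 k] by simp
  then show ?thesis
    by (induction I rule: infinite_finite_induct) (auto simp: pairing_add pairing_scale)
qed

lemma Re_pairing: "Re (pairing h k) = inner h (conj_hilb k)"
  unfolding pairing_def inner_hilb_def
  by (subst Re_suminf[OF pairing_summable]) simp

lemma pairing_le: "cmod (pairing h k) \<le> norm h * norm k"
proof (cases "pairing h k = 0")
  case False
  define c where "c = cnj (pairing h k) / cmod (pairing h k)"
  have c: "cmod c = 1" using False by (simp add: c_def norm_divide)
  have "c * pairing h k = cmod (pairing h k)"
    using False by (simp add: c_def complex_norm_square[symmetric] power2_eq_square mult.commute)
  then have "cmod (pairing h k) = Re (pairing (c *\<^sub>C h) k)" by (simp add: pairing_scale)
  also have "\<dots> = inner (c *\<^sub>C h) (conj_hilb k)" by (rule Re_pairing)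
  also have "\<dots> \<le> norm (c *\<^sub>C h) * norm (conj_hilb k)" by (rule norm_cauchy_schwarz)
  finally show ?thesis by (simp add: c)
qed simp

lemma pairing_conj: "pairing h (conj_hilb h) = complex_of_real ((norm h)\<^sup>2)"
proof -
  have "pairing h (conj_hilb h) = (\<Sum>l. complex_of_real ((cmod (coord h l))\<^sup>2))"
    by (simp add: pairing_def complex_norm_square del: of_real_power)
  also have "\<dots> = complex_of_real ((norm h)\<^sup>2)"
    unfolding norm_hilb_power2 by (rule suminf_of_real[symmetric]) (rule coord_summable)
  finally show ?thesis .
qed

lemma apply_colmat: "inf_mat_apply (colmat h) (coord k) = coord (coord k 0 *\<^sub>C h)"
proof
  fix i
  have "inf_mat_apply (colmat h) (coord k) i = colmat h i 0 * coord k 0"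
    unfolding inf_mat_apply_def by (rule suminf_single) (simp add: colmat_def)
  then show "inf_mat_apply (colmat h) (coord k) i = coord (coord k 0 *\<^sub>C h) i"
    by (simp add: colmat_def)
qed

lemma apply_rowmat: "inf_mat_apply (rowmat h) (coord k) = coord (pairing h k *\<^sub>C unit0)"
  by (auto simp: inf_mat_apply_def rowmat_def coord_unit0 pairing_def fun_eq_iff)

lemma colmat_compact: "colmat h \<in> compact_inf_mats"
proof (rule rank_one_compact[OF _ apply_colmat])
  show "summable (\<lambda>j. colmat h i j * f j)" for i f
    by (rule summable_finite[of "{0}"]) (auto simp: colmat_def)
  show "cmod (coord x 0) \<le> 1 * norm x" for x using cmod_coord_le_norm[of x 0] by simp
qed simp

lemma rowmat_compact: "rowmat h \<in> compact_inf_mats"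
proof (rule rank_one_compact[OF _ apply_rowmat pairing_le])
  show "summable (\<lambda>j. rowmat h i j * f j)" if "f \<in> ell2" for i f
    using ell2_product_summable[OF coord that, of h] by (cases "i = 0") (auto simp: rowmat_def)
qed simp

lemma column_in_ell2:
  assumes "a \<in> compact_inf_mats"
  shows "(\<lambda>i. a i 0) \<in> ell2"
proof -
  have "inf_mat_apply a (coord unit0) \<in> ell2"
    using assms coord unfolding compact_inf_mats_def by blast
  moreover have "inf_mat_apply a (coord unit0) = (\<lambda>i. a i 0)"
  proof
    fix i
    have "inf_mat_apply a (coord unit0) i = a i 0 * coord unit0 0"
      unfolding inf_mat_apply_def by (rule suminf_single) (simp add: coord_unit0)
    then show "inf_mat_apply a (coord unit0) i = a i 0" by (simp add: coord_unit0)
  qed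
  ultimately show ?thesis by simp
qed

text \<open>
  If the row were not square summable, then the operator would be unbounded on the normalized
  truncations of the conjugate row; relative compactness of the image of the unit ball excludes
  this.
\<close>

lemma row_in_ell2:
  assumes a: "a \<in> compact_inf_mats"
  shows "a 0 \<in> ell2"
proof -
  define s where "s N = (\<Sum>j<N. (cmod (a 0 j))\<^sup>2)" for N
  have s0: "s N \<ge> 0" for N unfolding s_def by (intro sum_nonneg) auto
  define F where "F N j = (if j < N then cnj (a 0 j) / complex_of_real (sqrt (s N)) else 0)" for N j
  have F_sums: "(\<Sum>j. (cmod (F N j))\<^sup>2) = s N / s N" "summable (\<lambda>j. (cmod (F N j))\<^sup>2)" for N
  proof -
    have "(\<Sum>j. (cmod (F N j))\<^sup>2) = (\<Sum>j<N. (cmod (F N j))\<^sup>2)"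
      by (rule suminf_finite) (auto simp: F_def)
    also have "\<dots> = s N / s N"
      using s0[of N] by (simp add: F_def norm_divide power_divide s_def flip: sum_divide_distrib)
    finally show "(\<Sum>j. (cmod (F N j))\<^sup>2) = s N / s N" .
    show "summable (\<lambda>j. (cmod (F N j))\<^sup>2)"
      by (rule summable_finite[of "{..<N}"]) (auto simp: F_def)
  qed
  have F: "\<forall>N. F N \<in> ell2 \<and> ell2_norm (F N) \<le> 1"
    using F_sums by (auto simp: ell2_def ell2_norm_def)
  have aF: "inf_mat_apply a (F N) 0 = complex_of_real (sqrt (s N))" for N
  proof -
    have "inf_mat_apply a (F N) 0 = (\<Sum>j<N. a 0 j * F N j)"
      unfolding inf_mat_apply_def by (rule suminf_finite) (auto simp: F_def)
    also have "\<dots> = (\<Sum>j<N. complex_of_real ((cmod (a 0 j))\<^sup>2 / sqrt (s N)))"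
      by (intro sum.cong) (simp_all add: F_def complex_norm_square del: of_real_power)
    also have "\<dots> = complex_of_real (s N / sqrt (s N))"
      by (simp add: s_def sum_divide_distrib)
    finally show ?thesis using s0[of N] by (simp add: real_div_sqrt)
  qed
  from a F obtain r g where r: "strict_mono (r::nat \<Rightarrow> nat)" and g: "g \<in> ell2"
    and lim: "(\<lambda>k. ell2_norm (inf_mat_apply a (F (r k)) - g)) \<longlonglongrightarrow> 0"
    unfolding compact_inf_mats_def by blast
  have "Bseq (\<lambda>k. ell2_norm (inf_mat_apply a (F (r k)) - g))"
    using lim by (rule convergent_imp_Bseq[OF convergentI])
  then obtain B where B: "\<And>k. \<bar>ell2_norm (inf_mat_apply a (F (r k)) - g)\<bar> \<le> B"
    unfolding Bseq_def by auto
  have "sqrt (s N) \<le> cmod (g 0) + B" for N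
  proof -
    have "s N \<le> s (r N)"
      unfolding s_def using seq_suble[OF r, of N] by (intro sum_mono2) auto
    then have "sqrt (s N) \<le> sqrt (s (r N))" by simp
    also have "\<dots> = cmod (inf_mat_apply a (F (r N)) 0)" using s0 by (simp add: aF)
    also have "\<dots> \<le> cmod (g 0) + cmod ((inf_mat_apply a (F (r N)) - g) 0)"
      using norm_triangle_ineq[of "g 0" "inf_mat_apply a (F (r N)) 0 - g 0"] by simp
    also have "cmod ((inf_mat_apply a (F (r N)) - g) 0) \<le> B"
    proof -
      have "inf_mat_apply a (F (r N)) \<in> ell2"
        using a F unfolding compact_inf_mats_def by blast
      then have "(\<lambda>i. inf_mat_apply a (F (r N)) i + - 1 * g i) \<in> ell2"
        using g by (intro ell2_add ell2_scale)
      then have "inf_mat_apply a (F (r N)) - g \<in> ell2" by (simp add: fun_diff_def)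
      then have "cmod ((inf_mat_apply a (F (r N)) - g) 0) \<le> ell2_norm (inf_mat_apply a (F (r N)) - g)"
        using cmod_coord_le_norm[of "Abs_hilb (inf_mat_apply a (F (r N)) - g)" 0]
        by (metis coord_Abs ell2_norm_eq_norm)
      then show ?thesis using B[of N] by linarith
    qed
    finally show ?thesis by simp
  qed
  then have "(sqrt (s N))\<^sup>2 \<le> (cmod (g 0) + B)\<^sup>2" for N by (intro power_mono) (auto simp: s0)
  then have "summable (\<lambda>j. (cmod (a 0 j))\<^sup>2)"
    using s0 by (intro summableI_nonneg_bounded[of _ "(cmod (g 0) + B)\<^sup>2"]) (simp_all add: s_def)
  then show ?thesis by (simp add: ell2_def)
qed

lemma column_space_simps [simp]:
  "os_norm column_space = block_norm" "os_scale column_space = (\<lambda>c a i j. c * a i j)"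
  by (simp_all add: column_space_def os_restrict_def compact_space_def)

lemma row_space_simps [simp]:
  "os_norm row_space = block_norm" "os_scale row_space = (\<lambda>c a i j. c * a i j)"
  by (simp_all add: row_space_def os_restrict_def compact_space_def)

lemma carrier_column_space: "os_carrier column_space = range colmat"
proof -
  have carrier: "os_carrier column_space = {a \<in> compact_inf_mats. \<forall>i j. j \<noteq> 0 \<longrightarrow> a i j = 0}"
    by (simp add: column_space_def os_restrict_def)
  have in_range: "a \<in> range colmat" if "a \<in> compact_inf_mats" "\<forall>i j. j \<noteq> 0 \<longrightarrow> a i j = 0" for a
  proof (rule range_eqI)
    show "a = colmat (Abs_hilb (\<lambda>i. a i 0))"
      using that(2) coord_Abs[OF column_in_ell2[OF that(1)]] by (auto simp: fun_eq_iff colmat_def)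
  qed
  show ?thesis
    unfolding carrier
  proof (intro equalityI subsetI)
    fix a assume "a \<in> range colmat"
    then obtain h where "a = colmat h" ..
    then show "a \<in> {a \<in> compact_inf_mats. \<forall>i j. j \<noteq> 0 \<longrightarrow> a i j = 0}"
      by (simp add: colmat_compact) (simp add: colmat_def)
  qed (elim CollectE conjE, rule in_range)
qed

lemma carrier_row_space: "os_carrier row_space = range rowmat"
proof -
  have carrier: "os_carrier row_space = {a \<in> compact_inf_mats. \<forall>i j. i \<noteq> 0 \<longrightarrow> a i j = 0}"
    by (simp add: row_space_def os_restrict_def)
  have in_range: "a \<in> range rowmat" if "a \<in> compact_inf_mats" "\<forall>i j. i \<noteq> 0 \<longrightarrow> a i j = 0" for a
  proof (rule range_eqI)
    show "a = rowmat (Abs_hilb (a 0))"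
      using that(2) coord_Abs[OF row_in_ell2[OF that(1)]] by (auto simp: fun_eq_iff rowmat_def)
  qed
  show ?thesis
    unfolding carrier
  proof (intro equalityI subsetI)
    fix a assume "a \<in> range rowmat"
    then obtain h where "a = rowmat h" ..
    then show "a \<in> {a \<in> compact_inf_mats. \<forall>i j. i \<noteq> 0 \<longrightarrow> a i j = 0}"
      by (simp add: rowmat_compact) (simp add: rowmat_def)
  qed (elim CollectE conjE, rule in_range)
qed

lemma colmat_linear: "colmat (h + k) = colmat h + colmat k" "colmat (c *\<^sub>C h) = (\<lambda>i j. c * colmat h i j)"
  "colmat 0 = 0"
  by (auto simp: fun_eq_iff colmat_def)

lemma rowmat_linear: "rowmat (h + k) = rowmat h + rowmat k" "rowmat (c *\<^sub>C h) = (\<lambda>i j. c * rowmat h i j)"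
  "rowmat 0 = 0"
  by (auto simp: fun_eq_iff rowmat_def)

section \<open>Matrix norms of the row and column spaces\<close>

lemma ell2_sum_norm_coord: "ell2_sum_norm n (\<lambda>i. coord (h i)) = sqrt (\<Sum>i<n. (norm (h i))\<^sup>2)"
  by (simp add: ell2_sum_norm_def ell2_norm_coord)

lemma ell2_sum_norm_cong: "(\<And>i. i < n \<Longrightarrow> F i = G i) \<Longrightarrow> ell2_sum_norm n F = ell2_sum_norm n G"
  by (simp add: ell2_sum_norm_def)

lemma sum_fun_coord: "(\<Sum>j\<in>J. coord (h j)) = coord (\<Sum>j\<in>J. h j)"
  by (induction J rule: infinite_finite_induct) (auto simp: fun_eq_iff)

text \<open>
  Block matrices with entries in the row or column space act by explicit maps \<open>L i j\<close>. The bound \<open>K\<close>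
  is needed in the second claim too: without it the supremum that defines the block norm
  could be a default value.
\<close>

lemma block_norm_le:
  assumes A: "A \<in> carrier_mat n n"
    and app: "\<And>k i j. i < n \<Longrightarrow> j < n \<Longrightarrow> inf_mat_apply (A $$ (i, j)) (coord k) = coord (L i j k)"
    and K: "\<And>k. (\<Sum>j<n. (norm (k j))\<^sup>2) \<le> 1 \<Longrightarrow> (\<Sum>i<n. (norm (\<Sum>j<n. L i j (k j)))\<^sup>2) \<le> K\<^sup>2"
    and "K \<ge> 0"
  shows "block_norm A \<le> K"
    and "(\<Sum>j<n. (norm (k j))\<^sup>2) \<le> 1 \<Longrightarrow> sqrt (\<Sum>i<n. (norm (\<Sum>j<n. L i j (k j)))\<^sup>2) \<le> block_norm A"
proof -
  let ?V = "{ell2_sum_norm (dim_row A) (block_apply A F) | F.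
     (\<forall>j<dim_col A. F j \<in> ell2) \<and> ell2_sum_norm (dim_col A) F \<le> 1}"
  have V: "?V = {sqrt (\<Sum>i<n. (norm (\<Sum>j<n. L i j (k j)))\<^sup>2) | k. (\<Sum>j<n. (norm (k j))\<^sup>2) \<le> 1}"
    (is "_ = ?W")
  proof -
    have val: "ell2_sum_norm n (block_apply A F) = sqrt (\<Sum>i<n. (norm (\<Sum>j<n. L i j (k j)))\<^sup>2)"
      if "\<And>j. j < n \<Longrightarrow> F j = coord (k j)" for F k
    proof -
      have "block_apply A F i = coord (\<Sum>j<n. L i j (k j))" if i: "i < n" for i
        unfolding block_apply_def sum_fun_coord[symmetric] using A i \<open>\<And>j. j < n \<Longrightarrow> F j = coord (k j)\<close>
        by (intro sum.cong) (auto simp: app)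
      then have "ell2_sum_norm n (block_apply A F) = ell2_sum_norm n (\<lambda>i. coord (\<Sum>j<n. L i j (k j)))"
        by (rule ell2_sum_norm_cong)
      then show ?thesis by (simp add: ell2_sum_norm_coord)
    qed
    show ?thesis
    proof (rule Set.set_eqI, rule iffI)
      fix v assume "v \<in> ?V"
      then obtain F where F: "\<forall>j<n. F j \<in> ell2" "ell2_sum_norm n F \<le> 1"
        and v: "v = ell2_sum_norm n (block_apply A F)" using A by auto
      define k where "k j = Abs_hilb (F j)" for j
      have k: "F j = coord (k j)" if "j < n" for j
        using F(1) that by (simp add: k_def Abs_hilb_inverse)
      have "ell2_sum_norm n F = sqrt (\<Sum>j<n. (norm (k j))\<^sup>2)"
        unfolding ell2_sum_norm_coord[symmetric] by (rule ell2_sum_norm_cong) (rule k)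
      then have "(\<Sum>j<n. (norm (k j))\<^sup>2) \<le> 1" using F(2) by simp
      moreover have "v = sqrt (\<Sum>i<n. (norm (\<Sum>j<n. L i j (k j)))\<^sup>2)"
        unfolding v by (rule val) (rule k)
      ultimately show "v \<in> ?W" by blast
    next
      fix v assume "v \<in> ?W"
      then obtain k where k: "(\<Sum>j<n. (norm (k j))\<^sup>2) \<le> 1"
        and v: "v = sqrt (\<Sum>i<n. (norm (\<Sum>j<n. L i j (k j)))\<^sup>2)" by blast
      have "v = ell2_sum_norm (dim_row A) (block_apply A (\<lambda>j. coord (k j)))"
        using A val[of "\<lambda>j. coord (k j)" k] by (simp add: v)
      moreover have "ell2_sum_norm (dim_col A) (\<lambda>j. coord (k j)) \<le> 1"
        using A k by (simp add: ell2_sum_norm_coord)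
      ultimately show "v \<in> ?V" using coord by blast
    qed
  qed
  have le: "v \<le> K" if "v \<in> ?W" for v
  proof -
    from that obtain k where k: "(\<Sum>j<n. (norm (k j))\<^sup>2) \<le> 1"
        and v: "v = sqrt (\<Sum>i<n. (norm (\<Sum>j<n. L i j (k j)))\<^sup>2)" by blast
    show ?thesis unfolding v using K[OF k] \<open>K \<ge> 0\<close> by (intro real_le_lsqrt) (auto intro: sum_nonneg)
  qed
  have "sqrt (\<Sum>i<n. (norm (\<Sum>j<n. L i j ((\<lambda>_. 0) j)))\<^sup>2) \<in> ?W"
    unfolding mem_Collect_eq by (rule exI[of _ "\<lambda>_. 0"]) simp
  then have ne: "?W \<noteq> {}" by blast
  show "block_norm A \<le> K" unfolding block_norm_def V using ne le by (rule cSup_least)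
  show "sqrt (\<Sum>i<n. (norm (\<Sum>j<n. L i j (k j)))\<^sup>2) \<le> block_norm A" if "(\<Sum>j<n. (norm (k j))\<^sup>2) \<le> 1" for k
    unfolding block_norm_def V using that le by (intro cSup_upper bdd_aboveI[of _ K]) blast+
qed

lemma hilb_cauchy_schwarz_sum: "(\<Sum>j<n. norm (h j :: hilb) * norm (k j :: hilb))\<^sup>2 \<le> (\<Sum>j<n. (norm (h j))\<^sup>2) * (\<Sum>j<n. (norm (k j))\<^sup>2)"
proof -
  have "(\<Sum>j<n. norm (h j) * norm (k j)) \<le> L2_set (\<lambda>j. norm (h j)) {..<n} * L2_set (\<lambda>j. norm (k j)) {..<n}"
    using L2_set_mult_ineq[of "\<lambda>j. norm (h j)" "\<lambda>j. norm (k j)" "{..<n}"] by simp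
  then have "(\<Sum>j<n. norm (h j) * norm (k j))\<^sup>2 \<le> (L2_set (\<lambda>j. norm (h j)) {..<n} * L2_set (\<lambda>j. norm (k j)) {..<n})\<^sup>2"
    by (intro power_mono sum_nonneg) auto
  then show ?thesis by (simp add: power_mult_distrib L2_set_def sum_nonneg)
qed

lemma sum_norm_crude_bound:
  fixes h :: "nat \<Rightarrow> nat \<Rightarrow> hilb"
  assumes "(\<Sum>j<n. (cmod (\<xi> j))\<^sup>2) \<le> 1"
  shows "(\<Sum>i<m. (norm (\<Sum>j<n. \<xi> j *\<^sub>C h i j))\<^sup>2) \<le> (\<Sum>i<m. \<Sum>j<n. norm (h i j))\<^sup>2"
proof -
  have \<xi>: "cmod (\<xi> j) \<le> 1" if "j < n" for j
  proof -
    have "(cmod (\<xi> j))\<^sup>2 \<le> (\<Sum>j<n. (cmod (\<xi> j))\<^sup>2)" using that by (intro member_le_sum) auto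
    then have "(cmod (\<xi> j))\<^sup>2 \<le> 1" using assms by linarith
    then show ?thesis by (simp add: power_le_one_iff)
  qed
  have row: "norm (\<Sum>j<n. \<xi> j *\<^sub>C h i j) \<le> (\<Sum>j<n. norm (h i j))" for i
    by (rule order_trans[OF norm_sum]) (intro sum_mono, simp add: \<xi> mult_left_le_one_le)
  have "(\<Sum>i<m. (norm (\<Sum>j<n. \<xi> j *\<^sub>C h i j))\<^sup>2) \<le> (\<Sum>i<m. (\<Sum>j<n. norm (h i j))\<^sup>2)"
    by (intro sum_mono power_mono row) auto
  also have "\<dots> \<le> (\<Sum>i<m. \<Sum>j<n. norm (h i j))\<^sup>2"
  proof -
    have "(L2_set (\<lambda>i. \<Sum>j<n. norm (h i j)) {..<m})\<^sup>2 \<le> (\<Sum>i<m. \<Sum>j<n. norm (h i j))\<^sup>2"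
      by (intro power_mono L2_set_le_sum) (auto intro: sum_nonneg)
    then show ?thesis by (simp add: L2_set_def sum_nonneg)
  qed
  finally show ?thesis .
qed

context
  fixes n :: nat and h :: "nat \<Rightarrow> nat \<Rightarrow> hilb"
begin

private lemma col_values:
  assumes "\<And>\<xi>. (\<Sum>j<n. (cmod (\<xi> j))\<^sup>2) \<le> 1 \<Longrightarrow> (\<Sum>i<n. (norm (\<Sum>j<n. \<xi> j *\<^sub>C h i j))\<^sup>2) \<le> K\<^sup>2"
    and k: "(\<Sum>j<n. (norm (k j))\<^sup>2) \<le> 1"
  shows "(\<Sum>i<n. (norm (\<Sum>j<n. coord (k j) 0 *\<^sub>C h i j))\<^sup>2) \<le> K\<^sup>2"
proof (rule assms(1))
  have "(\<Sum>j<n. (cmod (coord (k j) 0))\<^sup>2) \<le> (\<Sum>j<n. (norm (k j))\<^sup>2)"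
    by (intro sum_mono power_mono cmod_coord_le_norm) auto
  then show "(\<Sum>j<n. (cmod (coord (k j) 0))\<^sup>2) \<le> 1" using k by linarith
qed

lemma block_norm_colmat_le:
  assumes "\<And>\<xi>. (\<Sum>j<n. (cmod (\<xi> j))\<^sup>2) \<le> 1 \<Longrightarrow> (\<Sum>i<n. (norm (\<Sum>j<n. \<xi> j *\<^sub>C h i j))\<^sup>2) \<le> K\<^sup>2" "K \<ge> 0"
  shows "block_norm (mat n n (\<lambda>(i, j). colmat (h i j))) \<le> K"
  by (rule block_norm_le(1)[where L = "\<lambda>i j k. coord k 0 *\<^sub>C h i j", OF _ _ col_values[OF assms(1)] assms(2)])
    (simp_all add: apply_colmat)

lemma block_norm_colmat_crude: "block_norm (mat n n (\<lambda>(i, j). colmat (h i j))) \<le> (\<Sum>i<n. \<Sum>j<n. norm (h i j))"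
  by (rule block_norm_colmat_le) (simp_all add: sum_norm_crude_bound sum_nonneg)

lemma block_norm_colmat_ge:
  assumes "n > 0"
  shows "sqrt (\<Sum>i<n. (norm (h i 0))\<^sup>2) \<le> block_norm (mat n n (\<lambda>(i, j). colmat (h i j)))"
proof -
  define k where "k j = (if j = (0::nat) then unit0 else 0)" for j
  have "(\<Sum>j<n. (norm (k j))\<^sup>2) = (\<Sum>j<n. if j = 0 then 1 else 0)"
    by (intro sum.cong) (auto simp: k_def norm_unit0)
  then have k: "(\<Sum>j<n. (norm (k j))\<^sup>2) \<le> 1" using assms by simp
  have "sqrt (\<Sum>i<n. (norm (\<Sum>j<n. coord (k j) 0 *\<^sub>C h i j))\<^sup>2) \<le> block_norm (mat n n (\<lambda>(i, j). colmat (h i j)))"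
    by (rule block_norm_le(2)[where L = "\<lambda>i j k. coord k 0 *\<^sub>C h i j" and K = "\<Sum>i<n. \<Sum>j<n. norm (h i j)",
          OF _ _ col_values _ k])
      (simp_all add: apply_colmat sum_norm_crude_bound sum_nonneg)
  moreover have "(\<Sum>j<n. coord (k j) 0 *\<^sub>C h i j) = h i 0" for i
  proof -
    have "(\<Sum>j<n. coord (k j) 0 *\<^sub>C h i j) = (\<Sum>j<n. if j = 0 then h i 0 else 0)"
      by (intro sum.cong) (auto simp: k_def coord_unit0)
    then show ?thesis using assms by simp
  qed
  ultimately show ?thesis by simp
qed

private lemma row_values:
  assumes K: "\<And>\<xi>. (\<Sum>i<n. (cmod (\<xi> i))\<^sup>2) \<le> 1 \<Longrightarrow> (\<Sum>j<n. (norm (\<Sum>i<n. \<xi> i *\<^sub>C h i j))\<^sup>2) \<le> K\<^sup>2"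
    and k: "(\<Sum>j<n. (norm (k j))\<^sup>2) \<le> 1"
  shows "(\<Sum>i<n. (norm (\<Sum>j<n. pairing (h i j) (k j) *\<^sub>C unit0))\<^sup>2) \<le> K\<^sup>2"
proof -
  define s where "s i = (\<Sum>j<n. pairing (h i j) (k j))" for i
  define R where "R = sqrt (\<Sum>i<n. (cmod (s i))\<^sup>2)"
  have R2: "R\<^sup>2 = (\<Sum>i<n. (cmod (s i))\<^sup>2)" by (simp add: R_def sum_nonneg)
  have "(\<Sum>j<n. pairing (h i j) (k j) *\<^sub>C unit0) = s i *\<^sub>C unit0" for i
    by (simp add: s_def hilb.scale_sum_left)
  then have eq: "(\<Sum>i<n. (norm (\<Sum>j<n. pairing (h i j) (k j) *\<^sub>C unit0))\<^sup>2) = R\<^sup>2"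
    by (simp add: R2 norm_unit0)
  show ?thesis
  proof (cases "R = 0")
    case True
    then show ?thesis unfolding eq by simp
  next
    case False
    define \<xi> where "\<xi> i = cnj (s i) / complex_of_real R" for i
    have "(\<Sum>i<n. (cmod (\<xi> i))\<^sup>2) = R\<^sup>2 / R\<^sup>2"
      by (simp add: \<xi>_def norm_divide power_divide R2 flip: sum_divide_distrib)
    then have "(\<Sum>i<n. (cmod (\<xi> i))\<^sup>2) \<le> 1" using False by simp
    note \<xi> = K[OF this]
    have "(\<Sum>i<n. \<xi> i * s i) = complex_of_real (R\<^sup>2) / complex_of_real R"
      unfolding R2 by (simp add: \<xi>_def sum_divide_distrib complex_norm_square mult.commute del: of_real_power)
    also have "\<dots> = complex_of_real R" using False by (simp add: power2_eq_square)
    finally have "complex_of_real R = (\<Sum>i<n. \<Sum>j<n. \<xi> i * pairing (h i j) (k j))"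
      by (simp add: s_def sum_distrib_left)
    also have "\<dots> = (\<Sum>j<n. pairing (\<Sum>i<n. \<xi> i *\<^sub>C h i j) (k j))"
      by (subst sum.swap) (simp add: pairing_sum)
    finally have "\<bar>R\<bar> = cmod (\<Sum>j<n. pairing (\<Sum>i<n. \<xi> i *\<^sub>C h i j) (k j))"
      by (metis norm_of_real real_norm_def)
    also have "\<dots> \<le> (\<Sum>j<n. norm (\<Sum>i<n. \<xi> i *\<^sub>C h i j) * norm (k j))"
      by (rule order_trans[OF norm_sum]) (intro sum_mono pairing_le)
    finally have "\<bar>R\<bar>\<^sup>2 \<le> (\<Sum>j<n. norm (\<Sum>i<n. \<xi> i *\<^sub>C h i j) * norm (k j))\<^sup>2"
      by (intro power_mono) auto
    also have "\<dots> \<le> (\<Sum>j<n. (norm (\<Sum>i<n. \<xi> i *\<^sub>C h i j))\<^sup>2) * (\<Sum>j<n. (norm (k j))\<^sup>2)"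
      by (rule hilb_cauchy_schwarz_sum)
    also have "\<dots> \<le> K\<^sup>2 * 1"
      using \<xi> k by (intro mult_mono) (auto intro: sum_nonneg)
    finally show ?thesis unfolding eq by simp
  qed
qed

text \<open>
  By duality, it suffices to test a matrix of row operators with scalar vectors from the left.
\<close>

lemma block_norm_rowmat_le:
  assumes "\<And>\<xi>. (\<Sum>i<n. (cmod (\<xi> i))\<^sup>2) \<le> 1 \<Longrightarrow> (\<Sum>j<n. (norm (\<Sum>i<n. \<xi> i *\<^sub>C h i j))\<^sup>2) \<le> K\<^sup>2" "K \<ge> 0"
  shows "block_norm (mat n n (\<lambda>(i, j). rowmat (h i j))) \<le> K"
  by (rule block_norm_le(1)[where L = "\<lambda>i j k. pairing (h i j) k *\<^sub>C unit0", OF _ _ row_values[OF assms(1)] assms(2)])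
    (simp_all add: apply_rowmat)

lemma row_crude:
  assumes "(\<Sum>i<n. (cmod (\<xi> i))\<^sup>2) \<le> 1"
  shows "(\<Sum>j<n. (norm (\<Sum>i<n. \<xi> i *\<^sub>C h i j))\<^sup>2) \<le> (\<Sum>j<n. \<Sum>i<n. norm (h i j))\<^sup>2"
  by (rule sum_norm_crude_bound[where h = "\<lambda>j i. h i j"]) (rule assms)

lemma block_norm_rowmat_crude: "block_norm (mat n n (\<lambda>(i, j). rowmat (h i j))) \<le> (\<Sum>j<n. \<Sum>i<n. norm (h i j))"
  by (rule block_norm_rowmat_le) (simp_all add: row_crude sum_nonneg)

lemma block_norm_rowmat_ge:
  assumes "n > 0"
  shows "sqrt (\<Sum>j<n. (norm (h 0 j))\<^sup>2) \<le> block_norm (mat n n (\<lambda>(i, j). rowmat (h i j)))"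
proof -
  define R where "R = sqrt (\<Sum>j<n. (norm (h 0 j))\<^sup>2)"
  have R2: "(\<Sum>j<n. (norm (h 0 j))\<^sup>2) = R\<^sup>2" by (simp add: R_def sum_nonneg)
  define k where "k j = complex_of_real (1 / R) *\<^sub>C conj_hilb (h 0 j)" for j
  have "(\<Sum>j<n. (norm (k j))\<^sup>2) = R\<^sup>2 / R\<^sup>2"
    by (simp add: k_def norm_divide power_mult_distrib power_divide flip: R2 sum_divide_distrib)
  then have k: "(\<Sum>j<n. (norm (k j))\<^sup>2) \<le> 1" by simp
  have "sqrt (\<Sum>i<n. (norm (\<Sum>j<n. pairing (h i j) (k j) *\<^sub>C unit0))\<^sup>2) \<le> block_norm (mat n n (\<lambda>(i, j). rowmat (h i j)))"
    by (rule block_norm_le(2)[where L = "\<lambda>i j k. pairing (h i j) k *\<^sub>C unit0" and K = "\<Sum>j<n. \<Sum>i<n. norm (h i j)",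
          OF _ _ row_values _ k])
      (simp_all add: apply_rowmat row_crude sum_nonneg)
  moreover have "R \<le> sqrt (\<Sum>i<n. (norm (\<Sum>j<n. pairing (h i j) (k j) *\<^sub>C unit0))\<^sup>2)"
  proof (rule real_le_rsqrt)
    have "(\<Sum>j<n. pairing (h 0 j) (k j) *\<^sub>C unit0) = complex_of_real ((1 / R) * R\<^sup>2) *\<^sub>C unit0"
      by (simp add: k_def pairing_scale_right pairing_conj sum_distrib_left flip: R2 hilb.scale_sum_left)
    also have "(1 / R) * R\<^sup>2 = R" by (simp add: power2_eq_square)
    finally have "(norm (\<Sum>j<n. pairing (h 0 j) (k j) *\<^sub>C unit0))\<^sup>2 = R\<^sup>2"
      by (simp only: norm_cscale norm_unit0 norm_of_real) simp
    then show "R\<^sup>2 \<le> (\<Sum>i<n. (norm (\<Sum>j<n. pairing (h i j) (k j) *\<^sub>C unit0))\<^sup>2)"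
      using member_le_sum[of 0 "{..<n}" "\<lambda>i. (norm (\<Sum>j<n. pairing (h i j) (k j) *\<^sub>C unit0))\<^sup>2"] assms
      by simp
  qed
  ultimately show ?thesis unfolding R_def[symmetric] by linarith
qed

end

section \<open>The space of null sequences in the sum of row and column space\<close>

abbreviation c0_RC :: "(nat \<Rightarrow> (nat \<Rightarrow> nat \<Rightarrow> complex) \<times> (nat \<Rightarrow> nat \<Rightarrow> complex)) op_space" where
  "c0_RC \<equiv> os_c0 (os_sum row_space column_space)"

definition rc_seq :: "(nat \<Rightarrow> hilb) \<Rightarrow> (nat \<Rightarrow> hilb) \<Rightarrow> nat \<Rightarrow> (nat \<Rightarrow> nat \<Rightarrow> complex) \<times> (nat \<Rightarrow> nat \<Rightarrow> complex)" where
  "rc_seq g h k = (rowmat (g k), colmat (h k))"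

lemma c0_RC_norm:
  "os_norm c0_RC (mat n n (\<lambda>(i, j). rc_seq (g i j) (h i j))) =
    (SUP k. max (block_norm (mat n n (\<lambda>(i, j). rowmat (g i j k)))) (block_norm (mat n n (\<lambda>(i, j). colmat (h i j k)))))"
proof -
  have "map_mat fst (map_mat (\<lambda>f. f k) (mat n n (\<lambda>(i, j). rc_seq (g i j) (h i j)))) = mat n n (\<lambda>(i, j). rowmat (g i j k))"
    and "map_mat snd (map_mat (\<lambda>f. f k) (mat n n (\<lambda>(i, j). rc_seq (g i j) (h i j)))) = mat n n (\<lambda>(i, j). colmat (h i j k))" for k
    by (auto intro!: eq_matI simp: rc_seq_def)
  then show ?thesis by (simp add: os_c0_def os_sum_def)
qed

lemma c0_RC_norm_le:
  assumes "\<And>k. block_norm (mat n n (\<lambda>(i, j). rowmat (g i j k))) \<le> K"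
    "\<And>k. block_norm (mat n n (\<lambda>(i, j). colmat (h i j k))) \<le> K"
  shows "os_norm c0_RC (mat n n (\<lambda>(i, j). rc_seq (g i j) (h i j))) \<le> K"
  unfolding c0_RC_norm by (rule cSUP_least) (simp_all add: assms)

lemma c0_RC_norm_ge:
  assumes g: "\<And>i j. i < n \<Longrightarrow> j < n \<Longrightarrow> Bseq (g i j)" and h: "\<And>i j. i < n \<Longrightarrow> j < n \<Longrightarrow> Bseq (h i j)"
  shows "block_norm (mat n n (\<lambda>(i, j). rowmat (g i j k))) \<le> os_norm c0_RC (mat n n (\<lambda>(i, j). rc_seq (g i j) (h i j)))"
    and "block_norm (mat n n (\<lambda>(i, j). colmat (h i j k))) \<le> os_norm c0_RC (mat n n (\<lambda>(i, j). rc_seq (g i j) (h i j)))"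
proof -
  let ?m = "\<lambda>k. max (block_norm (mat n n (\<lambda>(i, j). rowmat (g i j k)))) (block_norm (mat n n (\<lambda>(i, j). colmat (h i j k))))"
  have "\<exists>B. \<forall>k. norm (f k) \<le> B" if "Bseq f" for f :: "nat \<Rightarrow> hilb"
    using that unfolding Bseq_def by blast
  then obtain bound where bound: "\<And>f k. Bseq f \<Longrightarrow> norm (f k :: hilb) \<le> bound f" by metis
  have m_le: "?m k \<le> max (\<Sum>j<n. \<Sum>i<n. bound (g i j)) (\<Sum>i<n. \<Sum>j<n. bound (h i j))" for k
  proof (rule max.mono)
    have "block_norm (mat n n (\<lambda>(i, j). rowmat (g i j k))) \<le> (\<Sum>j<n. \<Sum>i<n. norm (g i j k))"
      by (rule block_norm_rowmat_crude)
    also have "\<dots> \<le> (\<Sum>j<n. \<Sum>i<n. bound (g i j))" by (intro sum_mono bound g) auto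
    finally show "block_norm (mat n n (\<lambda>(i, j). rowmat (g i j k))) \<le> (\<Sum>j<n. \<Sum>i<n. bound (g i j))" .
    have "block_norm (mat n n (\<lambda>(i, j). colmat (h i j k))) \<le> (\<Sum>i<n. \<Sum>j<n. norm (h i j k))"
      by (rule block_norm_colmat_crude)
    also have "\<dots> \<le> (\<Sum>i<n. \<Sum>j<n. bound (h i j))" by (intro sum_mono bound h) auto
    finally show "block_norm (mat n n (\<lambda>(i, j). colmat (h i j k))) \<le> (\<Sum>i<n. \<Sum>j<n. bound (h i j))" .
  qed
  have "bdd_above (range ?m)" by (rule bdd_aboveI2) (rule m_le)
  then have "?m k \<le> (SUP k. ?m k)" by (intro cSUP_upper) auto
  then show "block_norm (mat n n (\<lambda>(i, j). rowmat (g i j k))) \<le> os_norm c0_RC (mat n n (\<lambda>(i, j). rc_seq (g i j) (h i j)))"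
    and "block_norm (mat n n (\<lambda>(i, j). colmat (h i j k))) \<le> os_norm c0_RC (mat n n (\<lambda>(i, j). rc_seq (g i j) (h i j)))"
    unfolding c0_RC_norm by auto
qed

lemma block_norm_single: "block_norm (mat 1 1 (\<lambda>_. rowmat h)) = norm h" "block_norm (mat 1 1 (\<lambda>_. colmat h)) = norm h"
proof -
  have "mat 1 1 (\<lambda>_. rowmat h) = mat 1 1 (\<lambda>(i, j). rowmat h)" "mat 1 1 (\<lambda>_. colmat h) = mat 1 1 (\<lambda>(i, j). colmat h)"
    by auto
  then show "block_norm (mat 1 1 (\<lambda>_. rowmat h)) = norm h" "block_norm (mat 1 1 (\<lambda>_. colmat h)) = norm h"
    using block_norm_rowmat_crude[of 1 "\<lambda>_ _. h"] block_norm_rowmat_ge[of 1 "\<lambda>_ _. h"]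
      block_norm_colmat_crude[of 1 "\<lambda>_ _. h"] block_norm_colmat_ge[of 1 "\<lambda>_ _. h"]
    by simp_all
qed

lemma RC_vnorm: "os_vnorm (os_sum row_space column_space) (rowmat g, colmat h) = max (norm g) (norm h)"
proof -
  have "map_mat fst (mat 1 1 (\<lambda>_. (rowmat g, colmat h))) = mat 1 1 (\<lambda>_. rowmat g)"
    "map_mat snd (mat 1 1 (\<lambda>_. (rowmat g, colmat h))) = mat 1 1 (\<lambda>_. colmat h)"
    by (auto intro!: eq_matI)
  then show ?thesis using block_norm_single by (simp add: os_vnorm_def os_sum_def)
qed

lemma carrier_c0_RC: "os_carrier c0_RC = {rc_seq g h | g h. g \<longlonglongrightarrow> 0 \<and> h \<longlonglongrightarrow> 0}"
proof (intro equalityI subsetI)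
  fix f assume "f \<in> os_carrier c0_RC"
  then have f: "\<forall>k. fst (f k) \<in> range rowmat \<and> snd (f k) \<in> range colmat"
    and lim: "(\<lambda>k. os_vnorm (os_sum row_space column_space) (f k)) \<longlonglongrightarrow> 0"
    by (auto simp: os_c0_def os_sum_def carrier_row_space carrier_column_space mem_Times_iff)
  have "\<forall>k. \<exists>g. fst (f k) = rowmat g" "\<forall>k. \<exists>h. snd (f k) = colmat h" using f by blast+
  then obtain g h where gh: "\<And>k. fst (f k) = rowmat (g k)" "\<And>k. snd (f k) = colmat (h k)" by metis
  have fk: "f k = (rowmat (g k), colmat (h k))" for k using gh by (simp add: prod_eq_iff)
  have lim': "(\<lambda>k. max (norm (g k)) (norm (h k))) \<longlonglongrightarrow> 0"
    using lim unfolding fk RC_vnorm .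
  have "g \<longlonglongrightarrow> 0" "h \<longlonglongrightarrow> 0"
    by (rule tendsto_0_le[OF lim', of _ 1], intro always_eventually allI, unfold real_norm_def, linarith)+
  moreover have "f = rc_seq g h" by (simp add: fun_eq_iff rc_seq_def fk)
  ultimately show "f \<in> {rc_seq g h | g h. g \<longlonglongrightarrow> 0 \<and> h \<longlonglongrightarrow> 0}" by blast
next
  fix f assume "f \<in> {rc_seq g h | g h. g \<longlonglongrightarrow> 0 \<and> h \<longlonglongrightarrow> 0}"
  then obtain g h where f: "f = rc_seq g h" and "g \<longlonglongrightarrow> 0" "h \<longlonglongrightarrow> 0" by blast
  then have "(\<lambda>k. max (norm (g k)) (norm (h k))) \<longlonglongrightarrow> max (norm (0::hilb)) (norm (0::hilb))"
    by (intro tendsto_intros)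
  then have "(\<lambda>k. os_vnorm (os_sum row_space column_space) (f k)) \<longlonglongrightarrow> 0"
    by (simp add: f rc_seq_def RC_vnorm)
  moreover have "f k \<in> os_carrier (os_sum row_space column_space)" for k
    by (simp add: f rc_seq_def os_sum_def carrier_row_space carrier_column_space)
  ultimately show "f \<in> os_carrier c0_RC" by (simp add: os_c0_def)
qed

lemma rc_seq_linear:
  "rc_seq (\<lambda>k. g k + g' k) (\<lambda>k. h k + h' k) = rc_seq g h + rc_seq g' h'"
  "rc_seq (\<lambda>k. c *\<^sub>C g k) (\<lambda>k. c *\<^sub>C h k) = os_scale c0_RC c (rc_seq g h)"
  by (simp_all add: fun_eq_iff rc_seq_def rowmat_linear colmat_linear os_c0_def os_sum_def)

lemma colmat_inject: "colmat g = colmat h \<longleftrightarrow> g = h"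
proof
  assume "colmat g = colmat h"
  then have "colmat g i 0 = colmat h i 0" for i by simp
  then show "g = h" by (intro hilb_eqI) (simp add: colmat_def)
qed simp

lemma rowmat_inject: "rowmat g = rowmat h \<longleftrightarrow> g = h"
proof
  assume "rowmat g = rowmat h"
  then have "rowmat g 0 i = rowmat h 0 i" for i by simp
  then show "g = h" by (intro hilb_eqI) (simp add: rowmat_def)
qed simp

lemma rc_seq_inject: "rc_seq g h = rc_seq g' h' \<longleftrightarrow> g = g' \<and> h = h'"
proof
  assume "rc_seq g h = rc_seq g' h'"
  then have "rc_seq g h k = rc_seq g' h' k" for k by simp
  then have "g k = g' k \<and> h k = h' k" for k
    unfolding rc_seq_def prod.inject rowmat_inject colmat_inject .
  then show "g = g' \<and> h = h'" by (simp add: fun_eq_iff)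
qed simp

lemma os_restrict_simps [simp]:
  "os_norm (os_restrict V X) = os_norm V" "os_scale (os_restrict V X) = os_scale V" "os_carrier (os_restrict V X) = X"
  by (simp_all add: os_restrict_def)

text \<open>
  A completely bounded map into the space of null sequences, resolved into sequences of maps
  into a Hilbert space. The row components respect the norms of rows and the column components the norms
  of columns, with constant \<open>\<kappa>\<close>; rows are columns for the transposed matrix norms.
\<close>

locale cb_into_c0 =
  fixes Y :: "('y::ab_group_add) op_space" and X :: "'y set"
    and T :: "'y \<Rightarrow> nat \<Rightarrow> (nat \<Rightarrow> nat \<Rightarrow> complex) \<times> (nat \<Rightarrow> nat \<Rightarrow> complex)"
  assumes Y: "operator_space Y" and X: "os_subspace Y X"
    and T: "completely_bounded (os_restrict Y X) c0_RC T"
begin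

abbreviation scale_Y (infixr \<open>*s\<close> 75) where "scale_Y \<equiv> os_scale Y"
abbreviation "S \<equiv> os_carrier Y"
definition "\<kappa> = cb_norm (os_restrict Y X) c0_RC T"

sublocale M: matrix_norm "os_scale Y" S "os_fnorm Y"
  by (rule operator_space_matrix_norm[OF Y])

sublocale R: matrix_norm "os_scale Y" S "\<lambda>n f. os_fnorm Y n (\<lambda>i j. f j i)"
  by (rule M.matrix_norm_transpose)

lemma X_sub: "M.subspace X" "X \<subseteq> S"
  using X unfolding os_subspace_def M.subspace_def by blast+

lemma T_linear:
  "x \<in> X \<Longrightarrow> T x \<in> os_carrier c0_RC"
  "x \<in> X \<Longrightarrow> y \<in> X \<Longrightarrow> T (x + y) = T x + T y"
  "x \<in> X \<Longrightarrow> T (a *s x) = os_scale c0_RC a (T x)"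
  using T unfolding completely_bounded_def os_linear_def by auto

definition "row_part k x = (SOME g. \<exists>h. T x = rc_seq g h) k"
definition "col_part k x = (SOME h. \<exists>g. T x = rc_seq g h) k"

lemma T_parts:
  assumes "x \<in> X"
  shows "T x = rc_seq (\<lambda>k. row_part k x) (\<lambda>k. col_part k x)"
    and "(\<lambda>k. row_part k x) \<longlonglongrightarrow> 0" and "(\<lambda>k. col_part k x) \<longlonglongrightarrow> 0"
proof -
  obtain g h where gh: "T x = rc_seq g h" and lim: "g \<longlonglongrightarrow> 0" "h \<longlonglongrightarrow> 0"
    using T_linear(1)[OF assms] unfolding carrier_c0_RC by blast
  have "(\<lambda>k. row_part k x) = g" unfolding row_part_def gh rc_seq_inject by simp
  moreover have "(\<lambda>k. col_part k x) = h" unfolding col_part_def gh rc_seq_inject by simp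
  ultimately show "T x = rc_seq (\<lambda>k. row_part k x) (\<lambda>k. col_part k x)"
    "(\<lambda>k. row_part k x) \<longlonglongrightarrow> 0" "(\<lambda>k. col_part k x) \<longlonglongrightarrow> 0"
    using gh lim by simp_all
qed

lemma parts_add:
  assumes "x \<in> X" "y \<in> X"
  shows "row_part k (x + y) = row_part k x + row_part k y" "col_part k (x + y) = col_part k x + col_part k y"
proof -
  have "x + y \<in> X" using assms by (rule M.subspace_add[OF X_sub(1)])
  from T_parts(1)[OF this] T_linear(2)[OF assms]
  have "rc_seq (\<lambda>k. row_part k (x + y)) (\<lambda>k. col_part k (x + y))
      = rc_seq (\<lambda>k. row_part k x + row_part k y) (\<lambda>k. col_part k x + col_part k y)"
    using T_parts(1)[OF assms(1)] T_parts(1)[OF assms(2)] by (simp only: rc_seq_linear)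
  then show "row_part k (x + y) = row_part k x + row_part k y" "col_part k (x + y) = col_part k x + col_part k y"
    unfolding rc_seq_inject by (simp_all add: fun_eq_iff)
qed

lemma parts_scale:
  assumes "x \<in> X"
  shows "row_part k (a *s x) = a *\<^sub>C row_part k x" "col_part k (a *s x) = a *\<^sub>C col_part k x"
proof -
  have "a *s x \<in> X" using assms by (rule M.subspace_scale[OF X_sub(1)])
  from T_parts(1)[OF this] T_linear(3)[OF assms]
  have "rc_seq (\<lambda>k. row_part k (a *s x)) (\<lambda>k. col_part k (a *s x))
      = rc_seq (\<lambda>k. a *\<^sub>C row_part k x) (\<lambda>k. a *\<^sub>C col_part k x)"
    using T_parts(1)[OF assms] by (simp only: rc_seq_linear)
  then show "row_part k (a *s x) = a *\<^sub>C row_part k x" "col_part k (a *s x) = a *\<^sub>C col_part k x"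
    unfolding rc_seq_inject by (simp_all add: fun_eq_iff)
qed

lemma parts_bound_unit:
  assumes f: "\<And>i j. i < n \<Longrightarrow> j < n \<Longrightarrow> f i j \<in> X" and f1: "os_fnorm Y n f \<le> 1" and n: "n > 0"
  shows "sqrt (\<Sum>j<n. (norm (row_part k (f 0 j)))\<^sup>2) \<le> \<kappa>"
    and "sqrt (\<Sum>i<n. (norm (col_part k (f i 0)))\<^sup>2) \<le> \<kappa>"
proof -
  let ?A = "{os_norm c0_RC (map_mat T x) | n x. x \<in> os_mats (os_restrict Y X) n \<and> os_norm (os_restrict Y X) x \<le> 1}"
  obtain K where K: "\<And>n x. x \<in> os_mats (os_restrict Y X) n \<Longrightarrow> os_norm c0_RC (map_mat T x) \<le> K * os_norm Y x"
    using T unfolding completely_bounded_def by auto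
  have bdd: "bdd_above ?A"
  proof (rule bdd_aboveI[of _ "\<bar>K\<bar>"])
    fix r assume "r \<in> ?A"
    then obtain n x where x: "x \<in> os_mats (os_restrict Y X) n" "os_norm Y x \<le> 1" and r: "r = os_norm c0_RC (map_mat T x)"
      by auto
    have "x \<in> os_mats Y n" using x(1) X_sub(2) by (auto simp: os_mats_def)
    then have "0 \<le> os_norm Y x" using Y unfolding operator_space_def by blast
    have "r \<le> K * os_norm Y x" unfolding r by (rule K[OF x(1)])
    also have "\<dots> \<le> \<bar>K\<bar> * 1" using x(2) \<open>0 \<le> os_norm Y x\<close> by (intro mult_mono) auto
    finally show "r \<le> \<bar>K\<bar>" by simp
  qed
  define F where "F = mat n n (\<lambda>(i, j). f i j)"
  have FX: "F \<in> os_mats (os_restrict Y X) n" unfolding F_def by (rule mat_in_os_mats) (simp add: f)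
  have "os_norm c0_RC (map_mat T F) \<in> ?A"
    using FX f1 unfolding os_fnorm_def F_def[symmetric] by auto
  then have "os_norm c0_RC (map_mat T F) \<le> \<kappa>"
    unfolding \<kappa>_def cb_norm_def by (rule cSup_upper) (rule bdd)
  moreover have "map_mat T F = mat n n (\<lambda>(i, j). rc_seq (\<lambda>k. row_part k (f i j)) (\<lambda>k. col_part k (f i j)))"
    unfolding F_def by (rule eq_matI) (auto simp: T_parts(1)[OF f])
  ultimately have le: "os_norm c0_RC (mat n n (\<lambda>(i, j). rc_seq (\<lambda>k. row_part k (f i j)) (\<lambda>k. col_part k (f i j)))) \<le> \<kappa>"
    by simp
  have bs: "Bseq (\<lambda>k. row_part k (f i j))" "Bseq (\<lambda>k. col_part k (f i j))" if "i < n" "j < n" for i j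
    using T_parts(2,3)[OF f[OF that]] by (auto intro: convergent_imp_Bseq convergentI)
  have "block_norm (mat n n (\<lambda>(i, j). rowmat (row_part k (f i j)))) \<le> \<kappa>"
    using c0_RC_norm_ge(1)[of n "\<lambda>i j k. row_part k (f i j)" "\<lambda>i j k. col_part k (f i j)", OF bs] le by (rule order_trans)
  then show "sqrt (\<Sum>j<n. (norm (row_part k (f 0 j)))\<^sup>2) \<le> \<kappa>"
    using block_norm_rowmat_ge[OF n, of "\<lambda>i j. row_part k (f i j)"] by linarith
  have "block_norm (mat n n (\<lambda>(i, j). colmat (col_part k (f i j)))) \<le> \<kappa>"
    using c0_RC_norm_ge(2)[of n "\<lambda>i j k. row_part k (f i j)" "\<lambda>i j k. col_part k (f i j)", OF bs] le by (rule order_trans)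
  then show "sqrt (\<Sum>i<n. (norm (col_part k (f i 0)))\<^sup>2) \<le> \<kappa>"
    using block_norm_colmat_ge[OF n, of "\<lambda>i j. col_part k (f i j)"] by linarith
qed

lemma zero_X: "0 \<in> X"
  by (rule M.subspace_0[OF X_sub(1)])

lemma kappa_nonneg: "\<kappa> \<ge> 0"
proof -
  have "os_fnorm Y 1 (\<lambda>_ _. 0) = 0" by (rule M.N_zero) simp
  then have "norm (row_part 0 0) \<le> \<kappa>"
    using parts_bound_unit(1)[of 1 "\<lambda>_ _. 0" 0] zero_X by simp
  then show ?thesis by (rule order_trans[OF norm_ge_zero])
qed

text \<open>
  The completely bounded norm only controls matrices in the unit ball; the components are
  homogeneous, so that the general case follows by scaling.
\<close>

lemma parts_bound:
  assumes f: "\<And>i j. i < n \<Longrightarrow> j < n \<Longrightarrow> f i j \<in> X" and n: "n > 0"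
  shows "(\<Sum>j<n. (norm (row_part k (f 0 j)))\<^sup>2) \<le> (\<kappa> * os_fnorm Y n f)\<^sup>2"
    and "(\<Sum>i<n. (norm (col_part k (f i 0)))\<^sup>2) \<le> (\<kappa> * os_fnorm Y n f)\<^sup>2"
proof -
  define r where "r = os_fnorm Y n f"
  have fS: "f i j \<in> S" if "i < n" "j < n" for i j using f[OF that] X_sub(2) by blast
  have r0: "r \<ge> 0" unfolding r_def by (rule M.N_nonneg) (rule fS)
  have "(\<Sum>j<n. (norm (row_part k (f 0 j)))\<^sup>2) \<le> (\<kappa> * r)\<^sup>2 \<and> (\<Sum>i<n. (norm (col_part k (f i 0)))\<^sup>2) \<le> (\<kappa> * r)\<^sup>2"
  proof (cases "r = 0")
    case True
    have "mat n n (\<lambda>(i, j). f i j) \<in> os_mats Y n" by (rule mat_in_os_mats) (rule fS)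
    then have eq: "mat n n (\<lambda>(i, j). f i j) = 0\<^sub>m n n"
      using Y True unfolding operator_space_def r_def os_fnorm_def by blast
    have f0: "f i j = 0" if "i < n" "j < n" for i j
      using arg_cong[OF eq, of "\<lambda>A. A $$ (i, j)"] that by simp
    have "row_part k 0 = 0" "col_part k 0 = 0"
      using parts_scale[OF zero_X, of k 0] by simp_all
    then show ?thesis using f0 n by simp
  next
    case False
    define b where "b = complex_of_real (1 / r)"
    have b: "cmod b = 1 / r" using r0 by (simp add: b_def norm_divide)
    have "os_fnorm Y n (\<lambda>i j. b *s f i j) = cmod b * os_fnorm Y n f"
      by (rule M.N_scale) (rule fS)
    then have "os_fnorm Y n (\<lambda>i j. b *s f i j) \<le> 1" using False by (simp add: b r_def)
    note unit = parts_bound_unit[of n "\<lambda>i j. b *s f i j", OF M.subspace_scale[OF X_sub(1) f] this n, of k]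
    have resc: "q \<le> (\<kappa> * r)\<^sup>2" if "sqrt (q / r\<^sup>2) \<le> \<kappa>" "q \<ge> 0" for q
    proof -
      have "(sqrt (q / r\<^sup>2))\<^sup>2 \<le> \<kappa>\<^sup>2" using that by (intro power_mono) auto
      then show ?thesis using that False by (simp add: power_mult_distrib field_simps)
    qed
    have "(\<Sum>j<n. (norm (row_part k (b *s f 0 j)))\<^sup>2) = (\<Sum>j<n. (norm (row_part k (f 0 j)))\<^sup>2) / r\<^sup>2"
      using n by (simp add: parts_scale f b power_mult_distrib power_divide flip: sum_divide_distrib)
    moreover have "(\<Sum>i<n. (norm (col_part k (b *s f i 0)))\<^sup>2) = (\<Sum>i<n. (norm (col_part k (f i 0)))\<^sup>2) / r\<^sup>2"
      using n by (simp add: parts_scale f b power_mult_distrib power_divide flip: sum_divide_distrib)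
    ultimately show ?thesis
      using unit by (auto intro!: resc sum_nonneg)
  qed
  then show "(\<Sum>j<n. (norm (row_part k (f 0 j)))\<^sup>2) \<le> (\<kappa> * os_fnorm Y n f)\<^sup>2"
    "(\<Sum>i<n. (norm (col_part k (f i 0)))\<^sup>2) \<le> (\<kappa> * os_fnorm Y n f)\<^sup>2"
    unfolding r_def by simp_all
qed

sublocale C: column_norm "os_scale Y" S "\<lambda>n u. \<kappa> * M.colnorm n u"
  by (rule M.column_norm_colnorm[OF kappa_nonneg])

sublocale D: column_norm "os_scale Y" S "\<lambda>n u. \<kappa> * R.colnorm n u"
  by (rule R.column_norm_colnorm[OF kappa_nonneg])

lemma col_part_admissible: "C.admissible X (col_part k) 1"
  unfolding C.admissible_def
proof (intro conjI ballI allI impI)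
  show "col_part k (x + y) = col_part k x + col_part k y" if "x \<in> X" "y \<in> X" for x y
    using that by (rule parts_add)
  show "col_part k (a *s x) = a *\<^sub>C col_part k x" if "x \<in> X" for a x
    using that by (rule parts_scale)
  fix n :: nat and u assume u: "\<forall>i<n. u i \<in> X"
  show "(\<Sum>i<n. (norm (col_part k (u i)))\<^sup>2) \<le> (1 * (\<kappa> * M.colnorm n u))\<^sup>2"
  proof (cases "n = 0")
    case False
    then show ?thesis
      using parts_bound(2)[of n "\<lambda>i j. if j = 0 then u i else 0" k] u zero_X by (simp add: M.colnorm_def)
  qed simp
qed

lemma row_part_admissible: "D.admissible X (row_part k) 1"
  unfolding D.admissible_def
proof (intro conjI ballI allI impI)
  show "row_part k (x + y) = row_part k x + row_part k y" if "x \<in> X" "y \<in> X" for x y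
    using that by (rule parts_add)
  show "row_part k (a *s x) = a *\<^sub>C row_part k x" if "x \<in> X" for a x
    using that by (rule parts_scale)
  fix n :: nat and u assume u: "\<forall>i<n. u i \<in> X"
  show "(\<Sum>i<n. (norm (row_part k (u i)))\<^sup>2) \<le> (1 * (\<kappa> * R.colnorm n u))\<^sup>2"
  proof (cases "n = 0")
    case False
    then show ?thesis
      using parts_bound(1)[of n "\<lambda>i j. if i = 0 then u j else 0" k] u zero_X by (simp add: R.colnorm_def)
  qed simp
qed

lemma colnorm_single: "M.colnorm 1 (\<lambda>_. v) = os_vnorm Y v" "R.colnorm 1 (\<lambda>_. v) = os_vnorm Y v"
proof -
  have "mat 1 1 (\<lambda>(i, j). if j = 0 then v else 0) = mat 1 1 (\<lambda>_. v)"
    "mat 1 1 (\<lambda>(i, j). if i = 0 then v else 0) = mat 1 1 (\<lambda>_. v)"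
    by (auto intro!: eq_matI)
  then show "M.colnorm 1 (\<lambda>_. v) = os_vnorm Y v" "R.colnorm 1 (\<lambda>_. v) = os_vnorm Y v"
    unfolding M.colnorm_def R.colnorm_def unfolding os_fnorm_def os_vnorm_def by simp_all
qed

text \<open>
  The components are extended separately. Conversely, column estimates for the extended maps bound all matrix
  norms, because a matrix of column operators is normed by its action on scalar vectors, which turns a matrix over
  \<open>Y\<close> into a column of no larger norm; likewise for rows.
\<close>

lemma extension_exists:
  assumes sep: "os_separable Y" and \<epsilon>: "\<epsilon> > 0"
  shows "\<exists>T'. completely_bounded Y c0_RC T' \<and> (\<forall>x\<in>X. T' x = T x) \<and> cb_norm Y c0_RC T' \<le> (2 + \<epsilon>) * \<kappa>"
proof -
  obtain D where D: "countable D" "D \<subseteq> S" and dense: "\<And>v e. v \<in> S \<Longrightarrow> e > 0 \<Longrightarrow> \<exists>d\<in>D. os_vnorm Y (v - d) < e"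
    using sep unfolding os_separable_def by blast
  have dense': "\<exists>d\<in>D. \<kappa> * os_vnorm Y (v - d) < e" if "v \<in> S" "e > 0" for v e
  proof -
    have "e / (\<kappa> + 1) > 0" using that(2) kappa_nonneg by simp
    from dense[OF that(1) this] obtain d where d: "d \<in> D" "os_vnorm Y (v - d) < e / (\<kappa> + 1)" by blast
    have "\<kappa> * os_vnorm Y (v - d) \<le> \<kappa> * (e / (\<kappa> + 1))"
      using d(2) kappa_nonneg by (intro mult_left_mono) auto
    also have "\<dots> < e" using kappa_nonneg that(2) by (simp add: field_simps)
    finally show ?thesis using d(1) by blast
  qed
  have "\<exists>c'. (\<forall>k. \<forall>x\<in>X. c' k x = col_part k x) \<and> (\<forall>k. C.admissible S (c' k) (2 + \<epsilon>)) \<and>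
    (\<forall>u\<in>S. (\<lambda>k. c' k u) \<longlonglongrightarrow> 0)"
    by (rule C.null_sequence_extension[OF X_sub D _ col_part_admissible T_parts(3) \<epsilon>])
      (simp_all only: colnorm_single dense')
  then obtain c' where c': "\<forall>k. \<forall>x\<in>X. c' k x = col_part k x" "\<forall>k. C.admissible S (c' k) (2 + \<epsilon>)"
    "\<forall>u\<in>S. (\<lambda>k. c' k u) \<longlonglongrightarrow> 0"
    by (elim exE conjE)
  note c'_ext = c'(1)[rule_format] and c'_adm = c'(2)[rule_format] and c'_null = c'(3)[rule_format]
  have "\<exists>r'. (\<forall>k. \<forall>x\<in>X. r' k x = row_part k x) \<and> (\<forall>k. D.admissible S (r' k) (2 + \<epsilon>)) \<and>
    (\<forall>u\<in>S. (\<lambda>k. r' k u) \<longlonglongrightarrow> 0)"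
    by (rule D.null_sequence_extension[OF X_sub D _ row_part_admissible T_parts(2) \<epsilon>])
      (simp_all only: colnorm_single dense')
  then obtain r' where r': "\<forall>k. \<forall>x\<in>X. r' k x = row_part k x" "\<forall>k. D.admissible S (r' k) (2 + \<epsilon>)"
    "\<forall>u\<in>S. (\<lambda>k. r' k u) \<longlonglongrightarrow> 0"
    by (elim exE conjE)
  note r'_ext = r'(1)[rule_format] and r'_adm = r'(2)[rule_format] and r'_null = r'(3)[rule_format]
  define T' where "T' y = rc_seq (\<lambda>k. r' k y) (\<lambda>k. c' k y)" for y
  have lin: "os_linear Y c0_RC T'"
    unfolding os_linear_def
  proof (intro conjI ballI allI)
    show "T' y \<in> os_carrier c0_RC" if "y \<in> S" for y
      unfolding carrier_c0_RC T'_def using r'_null[OF that] c'_null[OF that] by blast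
    show "T' (x + y) = T' x + T' y" if "x \<in> S" "y \<in> S" for x y
      unfolding T'_def rc_seq_linear[symmetric] using that
      by (simp add: D.admissible_add[OF r'_adm] C.admissible_add[OF c'_adm])
    show "T' (a *s x) = os_scale c0_RC a (T' x)" if "x \<in> S" for a x
      unfolding T'_def rc_seq_linear[symmetric] using that
      by (simp add: D.admissible_scale[OF r'_adm] C.admissible_scale[OF c'_adm])
  qed
  have bound: "os_norm c0_RC (map_mat T' x) \<le> ((2 + \<epsilon>) * \<kappa>) * os_norm Y x" if x: "x \<in> os_mats Y n" for n x
  proof -
    define f where "f i j = x $$ (i, j)" for i j
    have xf: "x = mat n n (\<lambda>(i, j). f i j)"
      using x by (intro eq_matI) (auto simp: os_mats_def f_def)
    have fS: "f i j \<in> S" if "i < n" "j < n" for i j using x that by (auto simp: os_mats_def f_def)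
    have norm_x: "os_norm Y x = os_fnorm Y n f" by (simp add: xf os_fnorm_def)
    define L where "L = ((2 + \<epsilon>) * \<kappa>) * os_fnorm Y n f"
    have f0: "os_fnorm Y n f \<ge> 0" by (rule M.N_nonneg) (rule fS)
    have L0: "L \<ge> 0" unfolding L_def using f0 kappa_nonneg \<epsilon> by simp
    have Tx: "map_mat T' x = mat n n (\<lambda>(i, j). rc_seq (\<lambda>k. r' k (f i j)) (\<lambda>k. c' k (f i j)))"
      unfolding xf by (rule eq_matI) (auto simp: T'_def)
    have colb: "block_norm (mat n n (\<lambda>(i, j). colmat (c' k (f i j)))) \<le> L" for k
    proof (rule block_norm_colmat_le[OF _ L0])
      fix \<xi> :: "nat \<Rightarrow> complex" assume \<xi>: "(\<Sum>j<n. (cmod (\<xi> j))\<^sup>2) \<le> 1"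
      define v where "v i = (\<Sum>j<n. \<xi> j *s f i j)" for i
      have vS: "v i \<in> S" if "i < n" for i unfolding v_def using that fS by (intro C.S_closed) auto
      have "(\<Sum>i<n. (norm (\<Sum>j<n. \<xi> j *\<^sub>C c' k (f i j)))\<^sup>2) = (\<Sum>i<n. (norm (c' k (v i)))\<^sup>2)"
        unfolding v_def using fS
        by (intro sum.cong refl) (subst C.admissible_sum[OF c'_adm C.subspace_S], auto)
      also have "\<dots> \<le> ((2 + \<epsilon>) * (\<kappa> * M.colnorm n v))\<^sup>2"
        by (rule C.admissible_bound[OF c'_adm]) (rule vS)
      also have "\<dots> \<le> L\<^sup>2"
      proof (rule power_mono)
        have "M.colnorm n v \<le> os_fnorm Y n f"
          unfolding v_def[abs_def] by (rule M.colnorm_apply_le[OF _ \<xi>]) (rule fS)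
        then show "(2 + \<epsilon>) * (\<kappa> * M.colnorm n v) \<le> L"
          unfolding L_def mult.assoc using \<epsilon> kappa_nonneg by (intro mult_left_mono) auto
        show "0 \<le> (2 + \<epsilon>) * (\<kappa> * M.colnorm n v)"
          using \<epsilon> by (intro mult_nonneg_nonneg C.c_nonneg vS) auto
      qed
      finally show "(\<Sum>i<n. (norm (\<Sum>j<n. \<xi> j *\<^sub>C c' k (f i j)))\<^sup>2) \<le> L\<^sup>2" .
    qed
    have rowb: "block_norm (mat n n (\<lambda>(i, j). rowmat (r' k (f i j)))) \<le> L" for k
    proof (rule block_norm_rowmat_le[OF _ L0])
      fix \<xi> :: "nat \<Rightarrow> complex" assume \<xi>: "(\<Sum>i<n. (cmod (\<xi> i))\<^sup>2) \<le> 1"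
      define v where "v j = (\<Sum>i<n. \<xi> i *s f i j)" for j
      have vS: "v i \<in> S" if "i < n" for i unfolding v_def using that fS by (intro C.S_closed) auto
      have "(\<Sum>j<n. (norm (\<Sum>i<n. \<xi> i *\<^sub>C r' k (f i j)))\<^sup>2) = (\<Sum>j<n. (norm (r' k (v j)))\<^sup>2)"
        unfolding v_def using fS
        by (intro sum.cong refl) (subst D.admissible_sum[OF r'_adm D.subspace_S], auto)
      also have "\<dots> \<le> ((2 + \<epsilon>) * (\<kappa> * R.colnorm n v))\<^sup>2"
        by (rule D.admissible_bound[OF r'_adm]) (rule vS)
      also have "\<dots> \<le> L\<^sup>2"
      proof (rule power_mono)
        have "R.colnorm n v \<le> os_fnorm Y n f"
          unfolding v_def[abs_def] by (rule R.colnorm_apply_le[of n "\<lambda>i j. f j i", OF _ \<xi>]) (rule fS)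
        then show "(2 + \<epsilon>) * (\<kappa> * R.colnorm n v) \<le> L"
          unfolding L_def mult.assoc using \<epsilon> kappa_nonneg by (intro mult_left_mono) auto
        show "0 \<le> (2 + \<epsilon>) * (\<kappa> * R.colnorm n v)"
          using \<epsilon> by (intro mult_nonneg_nonneg D.c_nonneg vS) auto
      qed
      finally show "(\<Sum>j<n. (norm (\<Sum>i<n. \<xi> i *\<^sub>C r' k (f i j)))\<^sup>2) \<le> L\<^sup>2" .
    qed
    show ?thesis
      unfolding Tx norm_x L_def[symmetric] by (rule c0_RC_norm_le) (rule rowb, rule colb)
  qed
  have "cb_norm Y c0_RC T' \<le> (2 + \<epsilon>) * \<kappa>"
    unfolding cb_norm_def
  proof (rule cSup_least)
    have "mat 0 0 (\<lambda>(i, j). 0) \<in> os_mats Y 0" by (rule mat_in_os_mats) simp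
    moreover have "os_norm Y (mat 0 0 (\<lambda>(i, j). 0)) = 0"
      using M.N_zero[of 0 "\<lambda>_ _. 0"] by (simp add: os_fnorm_def)
    ultimately have "os_norm c0_RC (map_mat T' (mat 0 0 (\<lambda>(i, j). 0)))
        \<in> {os_norm c0_RC (map_mat T' x) | n x. x \<in> os_mats Y n \<and> os_norm Y x \<le> 1}"
      unfolding mem_Collect_eq by (intro exI conjI) (rule refl, assumption, simp)
    then show "{os_norm c0_RC (map_mat T' x) | n x. x \<in> os_mats Y n \<and> os_norm Y x \<le> 1} \<noteq> {}"
      by blast
    fix r assume "r \<in> {os_norm c0_RC (map_mat T' x) | n x. x \<in> os_mats Y n \<and> os_norm Y x \<le> 1}"
    then obtain n x where r: "r = os_norm c0_RC (map_mat T' x)" and x: "x \<in> os_mats Y n" "os_norm Y x \<le> 1" by blast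
    have "r \<le> ((2 + \<epsilon>) * \<kappa>) * os_norm Y x" unfolding r by (rule bound[OF x(1)])
    also have "\<dots> \<le> ((2 + \<epsilon>) * \<kappa>) * 1"
      using x(2) \<epsilon> kappa_nonneg by (intro mult_left_mono) auto
    finally show "r \<le> (2 + \<epsilon>) * \<kappa>" by simp
  qed
  moreover have "completely_bounded Y c0_RC T'"
    unfolding completely_bounded_def using lin bound by blast
  moreover have "T' x = T x" if "x \<in> X" for x
    unfolding T'_def T_parts(1)[OF that] by (simp add: r'_ext[OF that] c'_ext[OF that])
  ultimately show ?thesis by blast
qed

end

theorem mainTheorem11:
  fixes \<epsilon> :: real
  assumes "\<epsilon> > 0"
  shows "has_CSEP TYPE('y::ab_group_add) (2 + \<epsilon>) (os_c0 (os_sum row_space column_space))"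
  unfolding has_CSEP_def
proof (intro allI impI, elim conjE)
  fix Y :: "'y op_space" and X T
  assume Y: "operator_space Y" and sep: "os_separable Y" and X: "os_closed_subspace Y X"
    and T: "completely_bounded (os_restrict Y X) c0_RC T"
  interpret cb_into_c0 Y X T
    using Y X T by unfold_locales (auto simp: os_closed_subspace_def)
  show "\<exists>T'. completely_bounded Y c0_RC T' \<and> (\<forall>x\<in>X. T' x = T x) \<and>
      cb_norm Y c0_RC T' \<le> (2 + \<epsilon>) * cb_norm (os_restrict Y X) c0_RC T"
    using extension_exists[OF sep assms] unfolding \<kappa>_def .
qed

end
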